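(* Let $b$ and $c$ be integers with $1<b<c$, and let $\omega=e^{2\pi i/3}$. The only possible common zeros in $\mathbb{C}$ of the polynomials $1+x^b+(-1-x)^b$ and $1+x^c+(-1-x)^c$ are $0,-1,\omega,\omega^2$. The common zeros at $0,-1$ occur when $2\nmid bc$, while the common zeros at $\omega,\omega^2$ occur when $3\nmid bc$. Consequently, when $6\mid bc$, the two polynomials have no common zeros. *)

theory Defs
  imports "HOL-Computational_Algebra.Polynomial" Complex_Main
begin

definition trinom :: "nat \<Rightarrow> complex poly" where
  "trinom n = 1 + [:0, 1:] ^ n + (- 1 - [:0, 1:]) ^ n"

definition common_zeros :: "complex poly \<Rightarrow> complex poly \<Rightarrow> complex set" where
  "common_zeros p q = {x. poly p x = 0 \<and> poly q x = 0}"

definition \<omega> :: complex where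
  "\<omega> = exp (2 * complex_of_real pi * \<i> / 3)"

end

theory Submission
  imports Defs
    "HOL-Computational_Algebra.Primes"
    "HOL-Computational_Algebra.Fundamental_Theorem_Algebra"
    "HOL-Computational_Algebra.Formal_Laurent_Series"
    "HOL-Analysis.Complex_Transcendental"
begin

text \<open>
  A common zero \<open>x\<close> yields three numbers \<open>x\<^sub>1 = 1\<close>, \<open>x\<^sub>2 = x\<close>, \<open>x\<^sub>3 = - 1 - x\<close> for which the first, the
  \<open>b\<close>-th and the \<open>c\<close>-th powers all have sum \<open>0\<close>. Which of \<open>0, - 1, \<omega>, \<omega>\<^sup>2\<close> are zeros is a matter of
  residues modulo \<open>2\<close> and \<open>3\<close>; the substance is that there are no others. So suppose that \<open>x\<close> is another
  one. It is an algebraic number, and the contradiction comes from a nonzero number \<open>\<eta>\<close> in \<open>\<rat>(x)\<close>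
  that lies in every valuation ring although all its conjugates have modulus less than \<open>1\<close>. There is no such
  number: the product of its conjugates would be a nonzero rational integer of modulus less than \<open>1\<close>
  (\<open>conjugate_norm_ge\<close>).

  The number \<open>\<eta>\<close> comes from Pade approximation. Put \<open>X\<^sub>i = x\<^sub>i\<^sup>b\<close>, so that \<open>X\<^sub>1 + X\<^sub>2 + X\<^sub>3 = 0\<close>. A cubic
  polynomial \<open>Q\<close> whose roots have the differences \<open>X\<^sub>i\<close> gives three residues of \<open>Q\<close> to the power \<open>- (n + 1)\<close>
  with sum \<open>0\<close>. After clearing denominators this is a relation \<open>\<Sum>i. X\<^sub>i ^ (2 * n + 1) * w\<^sub>i = 0\<close>, where each
  \<open>w\<^sub>i\<close> is a form of degree \<open>n\<close> in the two other \<open>X\<^sub>j\<close>, with integer coefficients whose moduli add up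
  to \<open>(3 n + 1) choose n\<close>, about \<open>(27 / 4)\<^sup>n\<close>. If \<open>c = (2 n + 1) b + m\<close>, then the vector of the \<open>x\<^sub>i\<^sup>m\<close> satisfies
  the same linear equation as the vector of the \<open>w\<^sub>i\<close>. So the cross product of these two vectors is \<open>\<lambda>\<close> times the
  vector of the \<open>X\<^sub>i ^ (2 * n + 1)\<close>. Reading off \<open>\<lambda>\<close> from the largest of the \<open>x\<^sub>i\<close>, at each place, shows
  that \<open>\<lambda>\<close> is at most the size of its coefficients times the \<open>- k\<close>-th power of that largest number, where
  \<open>k = (n + 1) b - m\<close>. Then \<open>\<eta>\<close> is the product of a power of \<open>\<lambda>\<close> and of a power of the symmetric
  functions \<open>e\<^sub>2, e\<^sub>3\<close> of the \<open>x\<^sub>i\<close>, chosen such that the total degree is \<open>0\<close>. Since \<open>\<bar>e\<^sub>2 e\<^sub>3\<bar>\<close> is at most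
  \<open>sqrt (4 / 27)\<close> times the fifth power of the largest \<open>\<bar>x\<^sub>i\<bar>\<close> (\<open>invariants_product_le\<close>), the two
  occurrences of \<open>27 / 4\<close> compete, and \<open>\<eta>\<close> is small as soon as \<open>b > 10\<close> and \<open>n\<close> is large
  (\<open>second_exponent_excluded\<close>). The number \<open>\<lambda>\<close> may vanish, but not also for the second relation that one gets
  by lowering one exponent in \<open>Q\<close>, because the two relations are independent (\<open>independent_syzygies\<close>).

  It remains to see that \<open>c / b\<close>, and hence \<open>n\<close>, is large. The case \<open>n = 0\<close> already gives \<open>c \<ge> 2 b - 3\<close>
  (\<open>second_exponent_lower_bound\<close>). A non-archimedean place where the \<open>x\<^sub>i\<close> have different absolute values would
  force \<open>c\<close> to be much closer to \<open>b\<close> (\<open>common_zero_not_val_pos\<close>), so that all \<open>x\<^sub>i\<close> are units and the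
  invariant \<open>e\<^sub>2\<^sup>3 / e\<^sub>3\<^sup>2\<close> is integral. Some conjugate of it has modulus at least \<open>1\<close>; for that conjugate the
  smallest \<open>\<bar>x\<^sub>i\<bar>\<close> is at most \<open>2 / 3\<close> of the largest, and comparing arguments in
  \<open>(1 + z\<^sup>b)\<^sup>c = \<plusminus> (1 + z\<^sup>c)\<^sup>b\<close> shows that \<open>c \<ge> 2 (3 / 2)\<^sup>b\<close> (\<open>archimedean_gap\<close>). This settles \<open>b \<ge> 13\<close>.
  For \<open>b \<le> 12\<close> the invariant can be computed. It is not integral, or there is no nontrivial zero at all,
  except for \<open>b = 8\<close> and \<open>b = 11\<close>, where it is \<open>4\<close> and \<open>1\<close>; there the three numbers are explicit enough for
  the same argument to work with better constants.
\<close>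

section \<open>Valuation rings of the complex numbers\<close>

locale complex_subring =
  fixes B :: "complex set"
  assumes one_mem [simp, intro]: "1 \<in> B"
    and diff_mem [intro]: "x \<in> B \<Longrightarrow> y \<in> B \<Longrightarrow> x - y \<in> B"
    and mult_mem [intro]: "x \<in> B \<Longrightarrow> y \<in> B \<Longrightarrow> x * y \<in> B"
begin

lemma zero_mem [simp, intro]: "0 \<in> B"
  using diff_mem[OF one_mem one_mem] by simp

lemma uminus_mem [intro]: "x \<in> B \<Longrightarrow> - x \<in> B"
  using diff_mem[OF zero_mem] by simp

lemma add_mem [intro]: "x \<in> B \<Longrightarrow> y \<in> B \<Longrightarrow> x + y \<in> B"
  using diff_mem[of x "- y"] by (simp add: uminus_mem)

lemma power_mem [intro]: "x \<in> B \<Longrightarrow> x ^ n \<in> B"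
  by (induction n) auto

lemma of_nat_mem [simp, intro]: "of_nat n \<in> B"
  by (induction n) auto

lemma of_int_mem [simp, intro]: "of_int n \<in> B"
  by (cases n rule: int_cases2) auto

lemma numeral_mem [simp, intro]: "numeral n \<in> B"
  using of_nat_mem[of "numeral n"] by simp

lemma sum_mem [intro]: "(\<And>i. i \<in> I \<Longrightarrow> f i \<in> B) \<Longrightarrow> sum f I \<in> B"
  by (induction I rule: infinite_finite_induct) auto

lemma prod_list_mem: "(\<And>i. i \<in> set xs \<Longrightarrow> f i \<in> B) \<Longrightarrow> (\<Prod>i\<leftarrow>xs. f i) \<in> B"
  by (induction xs) auto

end

definition adjoin :: "complex set \<Rightarrow> complex \<Rightarrow> complex set" where
  "adjoin B z = {poly q z |q. \<forall>i. coeff q i \<in> B}"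

context complex_subring
begin

lemma subring_adjoin: "complex_subring (adjoin B z)"
proof
  show "1 \<in> adjoin B z"
    unfolding adjoin_def by (auto intro!: exI[of _ 1])
next
  fix x y assume "x \<in> adjoin B z" "y \<in> adjoin B z"
  then obtain p q where p: "x = poly p z" "\<forall>i. coeff p i \<in> B"
    and q: "y = poly q z" "\<forall>i. coeff q i \<in> B"
    unfolding adjoin_def by blast
  show "x - y \<in> adjoin B z"
    unfolding adjoin_def using p q by (intro CollectI exI[of _ "p - q"]) auto
  show "x * y \<in> adjoin B z"
    unfolding adjoin_def using p q by (intro CollectI exI[of _ "p * q"]) (auto simp: coeff_mult)
qed

lemma adjoin_superset: "B \<subseteq> adjoin B z"
proof
  fix x assume "x \<in> B"
  then show "x \<in> adjoin B z"
    unfolding adjoin_def by (auto intro!: exI[of _ "[:x:]"] simp: coeff_pCons split: nat.splits)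
qed

lemma adjoin_self: "z \<in> adjoin B z"
  unfolding adjoin_def by (auto intro!: exI[of _ "[:0,1:]"] simp: coeff_pCons split: nat.splits)

end

text \<open>
  The parameter \<open>p\<close> is the residue characteristic. Divisibility in \<open>B\<close> is a total preorder and plays the role of
  an extension of the \<open>p\<close>-adic valuation to \<open>\<complex>\<close>; its value group need not consist of real numbers.
\<close>

locale valuation_ring = complex_subring +
  fixes p :: nat
  assumes total: "z \<noteq> 0 \<Longrightarrow> z \<in> B \<or> inverse z \<in> B"
    and prime: "prime p"
    and p_nonunit: "inverse (of_nat p) \<notin> B"

text \<open>
  Any subring that is maximal among those without \<open>1 / p\<close> will do. If neither \<open>z\<close> nor \<open>1 / z\<close> belonged to it,
  then adjoining either of them would produce \<open>1 / p\<close>, that is, an equation expressing \<open>1\<close> as a polynomial in \<open>z\<close>,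
  and one as a polynomial in \<open>1 / z\<close>, with coefficients divisible by \<open>p\<close>. Each equation can be used to lower the
  degree of the other one, until the degree is \<open>0\<close> and \<open>p\<close> is a unit.
\<close>

theorem exists_valuation_ring:
  assumes p: "prime p"
  shows "\<exists>B. valuation_ring B p"
proof -
  define S where "S = {B. complex_subring B \<and> inverse (of_nat p) \<notin> B}"
  have p0: "of_nat p \<noteq> (0::complex)"
    using p by auto
  have "\<int> \<in> S"
  proof -
    have "inverse (of_nat p) \<notin> (\<int> :: complex set)"
    proof
      assume "inverse (of_nat p) \<in> (\<int> :: complex set)"
      then obtain k where "inverse (of_nat p) = (of_int k :: complex)"
        by (auto elim: Ints_cases)
      then have "of_nat p * of_int k = (1::complex)"
        using p0 by (simp add: field_simps)
      then have "of_int (int p * k) = (of_int 1 :: complex)"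
        by simp
      then have "int p * k = 1"
        by (simp only: of_int_eq_iff)
      then have "int p = 1"
        using zmult_eq_1_iff[of "int p" k] by auto
      then show False
        using p prime_gt_1_nat[of p] by simp
    qed
    then show ?thesis
      by (simp add: S_def complex_subring_def)
  qed
  have "\<exists>M\<in>S. \<forall>X\<in>S. M \<subseteq> X \<longrightarrow> X = M"
  proof (rule subset_Zorn_nonempty)
    show "S \<noteq> {}"
      using \<open>\<int> \<in> S\<close> by blast
  next
    fix C assume ne: "C \<noteq> {}" and chain: "subset.chain S C"
    have CS: "C \<subseteq> S" and lin: "\<And>X Y. X \<in> C \<Longrightarrow> Y \<in> C \<Longrightarrow> X \<subseteq> Y \<or> Y \<subseteq> X"
      using chain by (auto simp: subset.chain_def)
    have "complex_subring (\<Union>C)"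
    proof
      show "1 \<in> \<Union>C"
        using ne CS by (auto simp: S_def complex_subring_def)
    next
      fix x y assume "x \<in> \<Union>C" "y \<in> \<Union>C"
      then obtain X where X: "X \<in> C" "x \<in> X" "y \<in> X"
        using lin by blast
      then have "complex_subring X"
        using CS by (auto simp: S_def)
      then show "x - y \<in> \<Union>C" "x * y \<in> \<Union>C"
        using X by (auto dest: complex_subring.diff_mem complex_subring.mult_mem)
    qed
    then show "\<Union>C \<in> S"
      using CS by (auto simp: S_def)
  qed
  then obtain B where "B \<in> S" and maximal: "\<And>X. X \<in> S \<Longrightarrow> B \<subseteq> X \<Longrightarrow> X = B"
    by blast
  then have pB: "inverse (of_nat p) \<notin> B"
    by (simp add: S_def)
  interpret complex_subring B
    using \<open>B \<in> S\<close> by (simp add: S_def)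
  have rel: "\<exists>q. (\<forall>i. coeff q i \<in> B) \<and> of_nat p * poly q z = 1" if "z \<notin> B" for z
  proof -
    have "adjoin B z \<notin> S"
      using maximal[of "adjoin B z"] adjoin_superset adjoin_self[of z] that by blast
    then have "inverse (of_nat p) \<in> adjoin B z"
      using subring_adjoin by (auto simp: S_def)
    then show ?thesis
      using p0 unfolding adjoin_def
      by (smt (verit, best) mem_Collect_eq of_nat_eq_0_iff right_inverse)
  qed
  \<comment> \<open>The prime \<open>p\<close> lies in the Jacobson radical, which allows to solve for a constant term below.\<close>
  have unit: "inverse (1 - of_nat p * a) \<in> B" if a: "a \<in> B" for a
  proof (rule ccontr)
    define u where "u = 1 - of_nat p * a"
    assume "inverse (1 - of_nat p * a) \<notin> B"
    then obtain q where q: "\<forall>i. coeff q i \<in> B" and q1: "of_nat p * poly q (inverse u) = 1"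
      using rel unfolding u_def by blast
    define N where "N = degree q"
    have "u \<noteq> 0"
      using pB a p0 unfolding u_def by (metis eq_iff_diff_eq_0 inverse_unique)
    have "u ^ N * poly q (inverse u) = (\<Sum>i\<le>N. coeff q i * u ^ (N - i))"
      unfolding poly_altdef N_def[symmetric] sum_distrib_left
    proof (intro sum.cong refl)
      fix i assume "i \<in> {..N}"
      then have "u ^ N = u ^ (N - i) * u ^ i"
        by (simp flip: power_add)
      then show "u ^ N * (coeff q i * inverse u ^ i) = coeff q i * u ^ (N - i)"
        using \<open>u \<noteq> 0\<close> by (simp add: field_simps)
    qed
    moreover have "u \<in> B"
      unfolding u_def using a by blast
    ultimately have mem: "u ^ N * poly q (inverse u) \<in> B"
      using q by auto
    have "\<exists>a'\<in>B. u ^ k = 1 - of_nat p * a'" for k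
    proof (induction k)
      case 0
      show ?case by (auto intro!: bexI[of _ 0])
    next
      case (Suc k)
      then obtain a' where a': "a' \<in> B" "u ^ k = 1 - of_nat p * a'" by blast
      have "u ^ Suc k = 1 - of_nat p * (a' + a - of_nat p * a * a')"
        unfolding power_Suc a'(2) by (simp add: u_def algebra_simps)
      then show ?case
        using a a' by blast
    qed
    then obtain a' where a': "a' \<in> B" "u ^ N = 1 - of_nat p * a'" by blast
    have "of_nat p * (u ^ N * poly q (inverse u) + a')
        = u ^ N * (of_nat p * poly q (inverse u)) + of_nat p * a'"
      by (simp add: algebra_simps)
    also have "\<dots> = 1"
      by (simp add: q1 a'(2))
    finally have "of_nat p * (u ^ N * poly q (inverse u) + a') = 1" .
    then have "inverse (of_nat p) = u ^ N * poly q (inverse u) + a'"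
      using inverse_unique by metis
    then show False
      using pB mem a'(1) by auto
  qed
  define R where "R z n \<longleftrightarrow> (\<exists>q. (\<forall>i. coeff q i \<in> B) \<and> degree q \<le> n \<and> of_nat p * poly q z = 1)"
    for z n
  have reduce: "n > 0 \<and> R z (n - 1)"
    if z: "z \<noteq> 0" and R1: "R z n" and R2: "R (inverse z) k" and "k \<le> n" for z n k
  proof -
    from R1 obtain q where q: "\<And>i. coeff q i \<in> B" "degree q \<le> n" "of_nat p * poly q z = 1"
      unfolding R_def by blast
    from R2 obtain r where r: "\<And>i. coeff r i \<in> B" "degree r \<le> k" "of_nat p * poly r (inverse z) = 1"
      unfolding R_def by blast
    have "n > 0"
    proof (rule ccontr)
      assume "\<not> n > 0"
      then have "poly q z = coeff q 0"
        using q(2) by (simp add: poly_altdef)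
      then show False
        using q(1)[of 0] q(3) pB inverse_unique by metis
    qed
    define v where "v = inverse (1 - of_nat p * coeff r 0)"
    have vB: "v \<in> B"
      unfolding v_def using unit r(1) by blast
    have nz: "1 - of_nat p * coeff r 0 \<noteq> 0"
      using pB r(1)[of 0] by (metis eq_iff_diff_eq_0 inverse_unique)
    have "poly r (inverse z) = (\<Sum>j\<le>k. coeff r j * inverse z ^ j)"
      unfolding poly_altdef using r(2) by (intro sum.mono_neutral_left) (auto simp: coeff_eq_0)
    also have "\<dots> = coeff r 0 + (\<Sum>j=1..k. coeff r j * inverse z ^ j)"
      by (subst sum.atMost_shift) (simp add: sum.atLeast1_atMost_eq lessThan_Suc_atMost)
    finally have "of_nat p * (\<Sum>j=1..k. coeff r j * inverse z ^ j) = 1 - of_nat p * coeff r 0"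
      using r(3) by (simp add: algebra_simps)
    then have one: "v * (of_nat p * (\<Sum>j=1..k. coeff r j * inverse z ^ j)) = 1"
      using nz by (simp add: v_def)
    \<comment> \<open>The leading term of \<open>q\<close> is replaced, using the equation for \<open>1 / z\<close> solved for its constant term.\<close>
    define q' where "q' = q - monom (coeff q n) n
      + (\<Sum>j=1..k. monom (of_nat p * coeff q n * v * coeff r j) (n - j))"
    have "coeff q' i \<in> B" for i
      unfolding q'_def coeff_sum coeff_add coeff_diff coeff_monom
      using q(1) r(1) vB by (intro add_mem diff_mem sum_mem) auto
    moreover have "degree q' \<le> n - 1"
    proof (rule degree_le, intro allI impI)
      fix i assume "n - 1 < i"
      then have "i \<ge> n" using \<open>n > 0\<close> by simp
      moreover have "coeff q i = 0" if "i > n"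
        using that q(2) by (intro coeff_eq_0) simp
      ultimately show "coeff q' i = 0"
        using \<open>n > 0\<close> unfolding q'_def by (cases "i = n") (auto simp: coeff_sum intro!: sum.neutral)
    qed
    moreover have "of_nat p * poly q' z = 1"
    proof -
      have "(\<Sum>j=1..k. of_nat p * coeff q n * v * coeff r j * z ^ (n - j))
          = (\<Sum>j=1..k. (coeff q n * z ^ n) * (v * (of_nat p * (coeff r j * inverse z ^ j))))"
      proof (intro sum.cong refl)
        fix j assume "j \<in> {1..k}"
        then have "z ^ n = z ^ (n - j) * z ^ j"
          using \<open>k \<le> n\<close> by (simp flip: power_add)
        then show "of_nat p * coeff q n * v * coeff r j * z ^ (n - j)
            = (coeff q n * z ^ n) * (v * (of_nat p * (coeff r j * inverse z ^ j)))"
          using z by (simp add: field_simps)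
      qed
      also have "\<dots> = coeff q n * z ^ n * (v * (of_nat p * (\<Sum>j=1..k. coeff r j * inverse z ^ j)))"
        by (simp add: sum_distrib_left)
      also have "\<dots> = coeff q n * z ^ n"
        by (simp only: one mult_1_right)
      finally show ?thesis
        using q(3) by (simp add: q'_def poly_monom poly_sum)
    qed
    ultimately show ?thesis
      using \<open>n > 0\<close> unfolding R_def by blast
  qed
  have no_R: "\<not> (R z n \<and> R (inverse z) k)" if "z \<noteq> 0" for z n k
    using that
  proof (induction "n + k" arbitrary: n k z rule: less_induct)
    case less
    show ?case
    proof
      assume R: "R z n \<and> R (inverse z) k"
      show False
      proof (cases "k \<le> n")
        case True
        then have "n > 0 \<and> R z (n - 1)"
          using reduce less.prems R by blast
        then show False
          using less.hyps[of "n - 1" k z] less.prems R by simp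
      next
        case False
        then have "k > 0 \<and> R (inverse z) (k - 1)"
          using reduce[of "inverse z" k n] less.prems R by simp
        then show False
          using less.hyps[of n "k - 1" z] less.prems R by simp
      qed
    qed
  qed
  have "z \<in> B \<or> inverse z \<in> B" if "z \<noteq> 0" for z
  proof (rule ccontr)
    assume "\<not> (z \<in> B \<or> inverse z \<in> B)"
    then show False
      using rel[of z] rel[of "inverse z"] no_R[OF that] unfolding R_def by blast
  qed
  then have "valuation_ring B p"
    using p pB by unfold_locales auto
  then show ?thesis by blast
qed

section \<open>Conjugates and norms of algebraic numbers\<close>

text \<open>
  Polynomials over \<open>\<rat>\<close> enter only through the functions on \<open>\<complex>\<close> that they define; as functions they have
  closure rules that prove rationality of explicit expressions by mere backchaining.
\<close>

definition rat_poly_fun :: "(complex \<Rightarrow> complex) \<Rightarrow> bool" where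
  "rat_poly_fun F \<longleftrightarrow> (\<exists>q :: rat poly. \<forall>z. F z = poly (map_poly of_rat q) z)"

named_theorems rat_poly_intros

lemma map_poly_of_rat_add:
  "map_poly of_rat (p + q) = (map_poly of_rat p + map_poly of_rat q :: complex poly)"
  by (intro poly_eqI) (simp add: coeff_map_poly of_rat_add)

lemma map_poly_of_rat_diff:
  "map_poly of_rat (p - q) = (map_poly of_rat p - map_poly of_rat q :: complex poly)"
  by (intro poly_eqI) (simp add: coeff_map_poly of_rat_diff)

lemma of_rat_sum': "of_rat (sum f A) = (\<Sum>i\<in>A. of_rat (f i) :: complex)"
  by (induction A rule: infinite_finite_induct) (auto simp: of_rat_add)

lemma map_poly_of_rat_mult:
  "map_poly of_rat (p * q) = (map_poly of_rat p * map_poly of_rat q :: complex poly)"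
  by (intro poly_eqI) (simp add: coeff_map_poly coeff_mult of_rat_sum' of_rat_mult)

lemma rat_poly_fun_ident [rat_poly_intros]: "rat_poly_fun (\<lambda>z. z)"
  unfolding rat_poly_fun_def by (rule exI[of _ "[:0, 1:]"]) (simp add: map_poly_pCons)

lemma rat_poly_fun_of_int [rat_poly_intros]: "rat_poly_fun (\<lambda>z. of_int n)"
  unfolding rat_poly_fun_def by (rule exI[of _ "[:of_int n:]"]) (simp add: map_poly_pCons)

lemma rat_poly_fun_add [rat_poly_intros]:
  "rat_poly_fun F \<Longrightarrow> rat_poly_fun G \<Longrightarrow> rat_poly_fun (\<lambda>z. F z + G z)"
  unfolding rat_poly_fun_def by (metis map_poly_of_rat_add poly_add)

lemma rat_poly_fun_diff [rat_poly_intros]: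
  "rat_poly_fun F \<Longrightarrow> rat_poly_fun G \<Longrightarrow> rat_poly_fun (\<lambda>z. F z - G z)"
  unfolding rat_poly_fun_def by (metis map_poly_of_rat_diff poly_diff)

lemma rat_poly_fun_mult [rat_poly_intros]:
  "rat_poly_fun F \<Longrightarrow> rat_poly_fun G \<Longrightarrow> rat_poly_fun (\<lambda>z. F z * G z)"
  unfolding rat_poly_fun_def by (metis map_poly_of_rat_mult poly_mult)

lemma rat_poly_fun_one [rat_poly_intros]: "rat_poly_fun (\<lambda>z. 1)"
  using rat_poly_fun_of_int[of 1] by simp

lemma rat_poly_fun_zero [rat_poly_intros]: "rat_poly_fun (\<lambda>z. 0)"
  using rat_poly_fun_of_int[of 0] by simp

lemma rat_poly_fun_uminus [rat_poly_intros]: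
  "rat_poly_fun F \<Longrightarrow> rat_poly_fun (\<lambda>z. - F z)"
  using rat_poly_fun_diff[OF rat_poly_fun_zero] by simp

lemma rat_poly_fun_of_nat [rat_poly_intros]: "rat_poly_fun (\<lambda>z. of_nat n)"
  using rat_poly_fun_of_int[of "int n"] by simp

lemma rat_poly_fun_numeral [rat_poly_intros]: "rat_poly_fun (\<lambda>z. numeral n)"
  using rat_poly_fun_of_nat[of "numeral n"] by simp

lemma rat_poly_fun_power [rat_poly_intros]:
  "rat_poly_fun F \<Longrightarrow> rat_poly_fun (\<lambda>z. F z ^ n)"
  by (induction n) (auto intro: rat_poly_intros)

lemma rat_poly_fun_sum [rat_poly_intros]:
  "(\<And>i. i \<in> I \<Longrightarrow> rat_poly_fun (F i)) \<Longrightarrow> rat_poly_fun (\<lambda>z. \<Sum>i\<in>I. F i z)"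
  by (induction I rule: infinite_finite_induct) (auto intro: rat_poly_intros)

text \<open>
  For algebraic \<open>x\<close>, these are the roots of the minimal polynomial of \<open>x\<close>.
\<close>

definition conjugate :: "complex \<Rightarrow> complex \<Rightarrow> bool" where
  "conjugate x x' \<longleftrightarrow> (\<forall>F. rat_poly_fun F \<longrightarrow> F x = 0 \<longleftrightarrow> F x' = 0)"

lemma conjugateD: "conjugate x x' \<Longrightarrow> rat_poly_fun F \<Longrightarrow> F x = 0 \<longleftrightarrow> F x' = 0"
  unfolding conjugate_def by blast

lemma conjugate_refl: "conjugate x x"
  unfolding conjugate_def by blast

lemma poly_prod_linear:
  "poly (\<Prod>a\<leftarrow>as. [:- a, 1:]) (z :: complex) = (\<Prod>a\<leftarrow>as. z - a)"
  by (induction as) (auto simp: algebra_simps)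

lemma degree_lead_coeff_prod_linear:
  "degree (\<Prod>a\<leftarrow>as. [:- a, 1 :: complex:]) = length as
    \<and> lead_coeff (\<Prod>a\<leftarrow>as. [:- a, 1 :: complex:]) = 1"
proof (induction as)
  case (Cons a as)
  have "(\<Prod>a\<leftarrow>as. [:- a, 1 :: complex:]) \<noteq> 0"
    using Cons by auto
  then show ?case
    using Cons degree_mult_eq[of "[:- a, 1:]" "\<Prod>a\<leftarrow>as. [:- a, 1:]"]
      lead_coeff_mult[of "[:- a, 1:]" "\<Prod>a\<leftarrow>as. [:- a, 1:]"]
    by (auto simp del: mult_pCons_left)
qed auto

lemma prod_list_diff_swap:
  "(\<Prod>a\<leftarrow>as. \<Prod>b\<leftarrow>bs. a - b) = (- 1) ^ (length as * length bs) * (\<Prod>b\<leftarrow>bs. \<Prod>a\<leftarrow>as. b - (a :: complex))"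
proof (induction as)
  case Nil
  show ?case by (induction bs) auto
next
  case (Cons a as)
  have 1: "(\<Prod>b\<leftarrow>bs. a - b) = (- 1) ^ length bs * (\<Prod>b\<leftarrow>bs. b - a)"
    by (induction bs) (auto simp: algebra_simps)
  have 2: "(\<Prod>b\<leftarrow>bs. (b - a) * (\<Prod>a\<leftarrow>as. b - a))
      = (\<Prod>b\<leftarrow>bs. b - a) * (\<Prod>b\<leftarrow>bs. \<Prod>a\<leftarrow>as. b - a)"
    by (induction bs) auto
  show ?case
    by (simp add: Cons.IH 1 2 power_add)
qed

lemma prod_list_const_mult:
  "(\<Prod>a\<leftarrow>as. c * f a) = c ^ length as * (\<Prod>a\<leftarrow>as. f a :: complex)"
  by (induction as) auto

lemma complex_poly_factor_list:
  obtains as where "smult (lead_coeff p) (\<Prod>a\<leftarrow>as. [:- a, 1 :: complex:]) = p"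
proof -
  obtain as where as: "mset as = proots p"
    using ex_mset by blast
  have "(\<Prod>a\<in>#proots p. [:- a, 1:]) = (\<Prod>a\<leftarrow>as. [:- a, 1:])"
    by (subst prod_mset_prod_list [symmetric]) (simp add: as)
  then show ?thesis
    using that complex_poly_decompose_multiset[of p] by metis
qed

text \<open>
  The product is the resultant of \<open>f\<close> and \<open>g\<close> up to a power of the leading coefficient of \<open>f\<close>. Rationality is
  the Euclidean algorithm: \<open>g\<close> may be replaced by \<open>g mod f\<close>, and exchanging the two polynomials changes the product only
  by rational factors.
\<close>

lemma prod_over_roots_rational:
  fixes f g :: "rat poly"
  assumes "c \<noteq> 0" and "map_poly of_rat f = smult c (\<Prod>a\<leftarrow>as. [:- a, 1 :: complex:])"
  shows "(\<Prod>a\<leftarrow>as. poly (map_poly of_rat g) a) \<in> \<rat>"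
  using assms
proof (induction "degree f" arbitrary: f g c as rule: less_induct)
  case less
  let ?C = "map_poly of_rat :: rat poly \<Rightarrow> complex poly"
  have deg: "degree f = length as"
  proof -
    have "degree (?C f) = length as"
      using less.prems degree_lead_coeff_prod_linear[of as] by (simp add: less.prems(2))
    moreover have "degree (?C f) = degree f"
      by (intro degree_map_poly) simp
    ultimately show ?thesis by simp
  qed
  have root: "poly (?C f) a = 0" if "a \<in> set as" for a
    using that unfolding less.prems(2) by (auto simp: poly_prod_linear prod_list_zero_iff)
  define r where "r = g mod f"
  have "poly (?C g) a = poly (?C r) a" if "a \<in> set as" for a
  proof -
    have "?C g = ?C f * ?C (g div f) + ?C r"
      unfolding r_def map_poly_of_rat_mult[symmetric] map_poly_of_rat_add[symmetric] by simp
    then show ?thesis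
      using root[OF that] by simp
  qed
  then have eq: "(\<Prod>a\<leftarrow>as. poly (?C g) a) = (\<Prod>a\<leftarrow>as. poly (?C r) a)"
    by (intro arg_cong[of _ _ prod_list] map_cong refl)
  show ?case
  proof (cases "degree f = 0 \<or> r = 0")
    case True
    then show ?thesis
    proof
      assume "degree f = 0"
      then show ?thesis using deg by simp
    next
      assume "r = 0"
      then have "(\<Prod>a\<leftarrow>as. poly (?C r) a) = 0 ^ length as"
        by (simp add: map_replicate_const)
      then show ?thesis
        unfolding eq by (simp add: power_0_left)
    qed
  next
    case False
    then have dr: "degree r < degree f"
      using degree_mod_less[of f g] unfolding r_def by (cases "f = 0") auto
    obtain bs where bs: "smult (lead_coeff (?C r)) (\<Prod>b\<leftarrow>bs. [:- b, 1:]) = ?C r"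
      using complex_poly_factor_list[of "?C r"] by blast
    define l where "l = lead_coeff (?C r)"
    have l: "l \<noteq> 0" "l \<in> \<rat>"
      using False unfolding l_def by (auto simp: coeff_map_poly degree_map_poly)
    have c: "c \<in> \<rat>"
    proof -
      have "lead_coeff (?C f) = c"
        unfolding less.prems(2) lead_coeff_smult using degree_lead_coeff_prod_linear[of as] by (metis mult.right_neutral)
      then show ?thesis by (auto simp: coeff_map_poly)
    qed
    have IH: "(\<Prod>b\<leftarrow>bs. poly (?C f) b) \<in> \<rat>"
      using less.hyps[OF dr l(1), of bs f] bs by (simp add: l_def)
    have fb: "poly (?C f) b = c * (\<Prod>a\<leftarrow>as. b - a)" for b
      unfolding less.prems(2) by (simp add: poly_prod_linear)
    have rl: "?C r = smult l (\<Prod>b\<leftarrow>bs. [:- b, 1:])"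
      using bs by (simp add: l_def)
    have ra: "poly (?C r) a = l * (\<Prod>b\<leftarrow>bs. a - b)" for a
      by (simp add: poly_prod_linear rl)
    have "(\<Prod>b\<leftarrow>bs. poly (?C f) b) = c ^ length bs * (\<Prod>b\<leftarrow>bs. \<Prod>a\<leftarrow>as. b - a)"
      by (simp add: fb prod_list_const_mult)
    then have "(\<Prod>b\<leftarrow>bs. \<Prod>a\<leftarrow>as. b - a) = (\<Prod>b\<leftarrow>bs. poly (?C f) b) / c ^ length bs"
      using less.prems(1) by simp
    then have "(\<Prod>b\<leftarrow>bs. \<Prod>a\<leftarrow>as. b - a) \<in> \<rat>"
      using IH c by simp
    moreover have "(\<Prod>a\<leftarrow>as. poly (?C r) a)
        = l ^ length as * ((- 1) ^ (length as * length bs) * (\<Prod>b\<leftarrow>bs. \<Prod>a\<leftarrow>as. b - a))"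
      by (simp add: ra prod_list_const_mult prod_list_diff_swap[of bs])
    ultimately show ?thesis
      using eq l by simp
  qed
qed

lemma (in valuation_ring) rational_denominator:
  assumes "of_int a / of_int (int p * d) \<in> B" and "coprime a (int p * d)" and "d \<noteq> 0"
  shows False
proof -
  have p0: "of_nat p \<noteq> (0 :: complex)"
    using prime by auto
  have "of_int d * (of_int a / of_int (int p * d)) \<in> B"
    using assms by blast
  then have ap: "of_int a / of_nat p \<in> B"
    using assms(3) p0 by simp
  have "coprime a (int p)"
    using assms(2) by simp
  then obtain u v where uv: "u * a + v * int p = 1"
    by (metis bezout_int coprime_imp_gcd_eq_1)
  have "of_int u * (of_int a / of_nat p) + of_int v = (of_int (u * a + v * int p) :: complex) / of_nat p"
    using p0 by (simp add: field_simps)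
  then have "of_int u * (of_int a / of_nat p) + of_int v = inverse (of_nat p :: complex)"
    unfolding uv by (simp add: inverse_eq_divide)
  moreover have "of_int u * (of_int a / of_nat p) + of_int v \<in> B"
    using ap by blast
  ultimately show False
    using p_nonunit by simp
qed

text \<open>
  Such a number is an integer, because a prime in its denominator would be inverted in some valuation ring.
\<close>

lemma rational_in_valuation_rings_ge_1:
  assumes q: "q \<in> \<rat>" "q \<noteq> (0 :: complex)" and B: "\<And>B p. valuation_ring B p \<Longrightarrow> q \<in> B"
  shows "norm q \<ge> 1"
proof -
  obtain a d where ad: "q = of_int a / of_int d" "d > 0" "coprime a d"
    using q(1) by (elim Rats_cases')
  have "d = 1"
  proof (rule ccontr)
    assume "d \<noteq> 1"
    obtain p where p: "prime p" "p dvd nat d"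
    proof -
      have "nat d \<noteq> 1"
        using \<open>d \<noteq> 1\<close> ad(2) by linarith
      then show ?thesis
        using prime_factor_nat that by blast
    qed
    then obtain e where e: "d = int p * e"
      by (metis ad(2) dvd_def int_dvd_int_iff nat_0_le order_less_imp_le)
    obtain B where "valuation_ring B p"
      using exists_valuation_ring[OF p(1)] by blast
    then show False
      using valuation_ring.rational_denominator[of B p a e] B[of B p] ad e
      by (metis mult_zero_right order_less_irrefl)
  qed
  then have "q = of_int a" "a \<noteq> 0"
    using ad q by auto
  then show ?thesis
    by (auto simp: norm_of_int)
qed

lemma norm_prod_list_less_1:
  assumes "\<And>a. a \<in> set as \<Longrightarrow> norm (f a :: complex) < 1" "as \<noteq> []"
  shows "norm (\<Prod>a\<leftarrow>as. f a) < 1"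
  using assms
proof (induction as)
  case (Cons a as)
  have "norm (\<Prod>a\<leftarrow>as. f a) \<le> 1"
    using Cons by (cases "as = []") (auto intro: less_imp_le)
  then have "norm (f a) * norm (\<Prod>a\<leftarrow>as. f a) \<le> norm (f a) * 1"
    by (intro mult_left_mono) auto
  also have "\<dots> < 1"
    using Cons.prems by simp
  finally show ?case
    by (simp add: norm_mult)
qed auto

lemma minimal_polynomial_exists:
  fixes x :: complex and p :: "rat poly"
  assumes "p \<noteq> 0" and "poly (map_poly of_rat p) x = 0"
  obtains f where "f \<noteq> 0" and "poly (map_poly of_rat f) x = 0"
    and "\<And>h. poly (map_poly of_rat h) x = 0 \<Longrightarrow> f dvd h"
proof -
  let ?C = "map_poly of_rat :: rat poly \<Rightarrow> complex poly"
  define D where "D = {f :: rat poly. f \<noteq> 0 \<and> poly (?C f) x = 0}"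
  have "p \<in> D"
    using assms by (simp add: D_def)
  define f where "f = arg_min degree (\<lambda>f. f \<in> D)"
  have f: "f \<in> D" and fmin: "\<And>g. g \<in> D \<Longrightarrow> degree f \<le> degree g"
    unfolding f_def using arg_min_nat_lemma[of "\<lambda>f. f \<in> D", OF \<open>p \<in> D\<close>, of degree] by blast+
  have f0: "f \<noteq> 0" "poly (?C f) x = 0"
    using f by (auto simp: D_def)
  have "f dvd h" if "poly (?C h) x = 0" for h
  proof -
    have "h mod f = 0 \<or> degree (h mod f) < degree f"
      using f0(1) degree_mod_less by blast
    moreover have "?C h = ?C f * ?C (h div f) + ?C (h mod f)"
      unfolding map_poly_of_rat_mult[symmetric] map_poly_of_rat_add[symmetric] by simp
    then have "poly (?C (h mod f)) x = 0"
      using that f0 by simp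
    ultimately have "h mod f = 0"
      using fmin[of "h mod f"] unfolding D_def by force
    then show ?thesis by (simp add: mod_eq_0_iff_dvd)
  qed
  then show ?thesis
    using that f0 by blast
qed

text \<open>
  This is the irreducibility of \<open>f\<close> in disguise: the minimal polynomial \<open>g\<close> of \<open>x'\<close> divides \<open>f\<close>, and the
  cofactor has too small a degree to vanish at \<open>x\<close>, so that \<open>g\<close> vanishes there.
\<close>

lemma conjugate_if_root_of_minimal_polynomial:
  fixes f :: "rat poly"
  assumes f: "f \<noteq> 0" "poly (map_poly of_rat f) x = 0"
    and dvd: "\<And>h. poly (map_poly of_rat h) x = 0 \<Longrightarrow> f dvd h"
    and x': "poly (map_poly of_rat f) x' = 0"
  shows "conjugate x x'"
proof -
  let ?C = "map_poly of_rat :: rat poly \<Rightarrow> complex poly"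
  obtain g where g: "g \<noteq> 0" "poly (?C g) x' = 0" "\<And>h. poly (?C h) x' = 0 \<Longrightarrow> g dvd h"
    using minimal_polynomial_exists[OF f(1) x'] by blast
  obtain k where k: "f = g * k"
    using g(3)[OF x'] by (auto elim: dvdE)
  have "degree g > 0"
    using g(1,2) by (cases g) (auto simp: map_poly_pCons split: if_splits)
  then have "degree k < degree f"
    using f(1) k by (simp add: degree_mult_eq)
  then have "poly (?C k) x \<noteq> 0"
    using dvd[of k] dvd_imp_degree_le[of f k] f(1) k by auto
  then have gx: "poly (?C g) x = 0"
    using f(2) k by (simp add: map_poly_of_rat_mult)
  have "poly (?C h) x = 0 \<longleftrightarrow> poly (?C h) x' = 0" for h
    using dvd[of h] g(3)[of h] gx x' by (auto elim!: dvdE simp: map_poly_of_rat_mult)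
  then show ?thesis
    unfolding conjugate_def rat_poly_fun_def by auto
qed

text \<open>
  The product of \<open>F x' / G x'\<close> over the roots \<open>x'\<close> of the minimal polynomial of \<open>x\<close> is rational, nonzero and in all
  valuation rings, hence an integer, so that not all factors can have modulus less than \<open>1\<close>. The hypotheses on \<open>P\<close> and
  \<open>y\<close> say that \<open>x\<close> is algebraic.
\<close>

theorem conjugate_norm_ge:
  assumes alg: "rat_poly_fun P" "P x = 0" "P y \<noteq> 0"
    and F: "rat_poly_fun F" "F x \<noteq> 0"
    and G: "rat_poly_fun G" "G x \<noteq> 0"
    and integral: "\<And>x' B p. conjugate x x' \<Longrightarrow> valuation_ring B p \<Longrightarrow> F x' / G x' \<in> B"
  shows "\<exists>x'. conjugate x x' \<and> norm (F x') \<ge> norm (G x')"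
proof (rule ccontr)
  assume small: "\<not> ?thesis"
  let ?C = "map_poly of_rat :: rat poly \<Rightarrow> complex poly"
  obtain p0 where p0: "\<And>z. P z = poly (?C p0) z"
    using alg(1) unfolding rat_poly_fun_def by blast
  then have "p0 \<noteq> 0" "poly (?C p0) x = 0"
    using alg(2,3) by auto
  then obtain f where f0: "f \<noteq> 0" "poly (?C f) x = 0"
    and dvd: "\<And>h. poly (?C h) x = 0 \<Longrightarrow> f dvd h"
    using minimal_polynomial_exists by blast
  have conj: "conjugate x x'" if "poly (?C f) x' = 0" for x'
    using conjugate_if_root_of_minimal_polynomial[OF f0 dvd that] .
  obtain as where as: "smult (lead_coeff (?C f)) (\<Prod>a\<leftarrow>as. [:- a, 1:]) = ?C f"
    using complex_poly_factor_list[of "?C f"] by blast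
  define c where "c = lead_coeff (?C f)"
  have c: "c \<noteq> 0" "?C f = smult c (\<Prod>a\<leftarrow>as. [:- a, 1:])"
    using f0(1) as unfolding c_def by (auto simp: coeff_map_poly degree_map_poly)
  have root: "a \<in> set as \<longleftrightarrow> poly (?C f) a = 0" for a
    using c by (auto simp: poly_prod_linear prod_list_zero_iff)
  have "as \<noteq> []"
    using root[of x] f0 by auto
  have rat: "(\<Prod>a\<leftarrow>as. H a) \<in> \<rat>" if "rat_poly_fun H" for H
  proof -
    from that obtain h where "\<And>z. H z = poly (?C h) z"
      unfolding rat_poly_fun_def by blast
    then show ?thesis
      using prod_over_roots_rational[OF c, of h] by simp
  qed
  have nz: "F a \<noteq> 0" "G a \<noteq> 0" if "a \<in> set as" for a
    using that root conj conjugateD F G by blast+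
  have quot: "(\<Prod>a\<leftarrow>as. F a / G a) = (\<Prod>a\<leftarrow>as. F a) / (\<Prod>a\<leftarrow>as. G a)"
    by (induction as) auto
  define q where "q = (\<Prod>a\<leftarrow>as. F a / G a)"
  have "q \<in> \<rat>"
    using rat[OF F(1)] rat[OF G(1)] by (simp add: q_def quot)
  moreover have "q \<noteq> 0"
    using nz by (auto simp: q_def prod_list_zero_iff)
  moreover have "q \<in> B" if "valuation_ring B p" for B p
  proof -
    interpret valuation_ring B p by fact
    show ?thesis
      unfolding q_def using integral that root conj by (intro prod_list_mem) blast
  qed
  ultimately have "norm q \<ge> 1"
    by (rule rational_in_valuation_rings_ge_1)
  moreover have "norm q < 1"
    unfolding q_def
  proof (rule norm_prod_list_less_1)
    fix a assume "a \<in> set as"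
    then show "norm (F a / G a) < 1"
      using small root conj nz by (force simp: norm_divide divide_less_eq_1)
  qed fact
  ultimately show False by simp
qed

section \<open>Residues of reciprocals of cubic polynomials\<close>

text \<open>
  This is the residue at \<open>\<xi>\<close> of the rational function that is the product of \<open>(t - \<xi>) powi (- a)\<close>,
  \<open>(t - \<xi> + u) powi (- b)\<close> and \<open>(t - \<xi> + v) powi (- c)\<close>, expanded in powers of \<open>t - \<xi>\<close>.
\<close>

definition pole_residue :: "complex \<Rightarrow> complex \<Rightarrow> nat \<Rightarrow> nat \<Rightarrow> nat \<Rightarrow> complex" where
  "pole_residue u v a b c =
     fls_residue (inverse (fls_X ^ a * (fls_X + fls_const u) ^ b * (fls_X + fls_const v) ^ c))"

lemma fls_X_plus_const_neq_0: "fls_X + fls_const u \<noteq> (0 :: complex fls)"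
proof
  assume "fls_X + fls_const u = (0 :: complex fls)"
  then have "fls_nth (fls_X + fls_const u) 1 = (0 :: complex)" by simp
  then show False by simp
qed

lemma inverse_powers_difference:
  fixes x y z :: "'a :: field"
  assumes "x \<noteq> 0" "y \<noteq> 0"
  shows "(y - x) * inverse (x ^ Suc a * y ^ Suc b * z)
    = inverse (x ^ Suc a * y ^ b * z) - inverse (x ^ a * y ^ Suc b * z)"
  using assms by (cases "z = 0") (simp_all add: field_simps)

text \<open>
  Partial fractions with respect to each of the three pairs of linear factors.
\<close>

lemma pole_residue_first:
  "u * pole_residue u v (Suc a) (Suc b) c = pole_residue u v (Suc a) b c - pole_residue u v a (Suc b) c"
proof -
  let ?U = "fls_X + fls_const u" and ?V = "fls_X + fls_const v"
  have "fls_const u * inverse (fls_X ^ Suc a * ?U ^ Suc b * ?V ^ c)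
      = inverse (fls_X ^ Suc a * ?U ^ b * ?V ^ c) - inverse (fls_X ^ a * ?U ^ Suc b * ?V ^ c)"
    using inverse_powers_difference[of fls_X ?U a b "?V ^ c"] fls_X_plus_const_neq_0[of u] fls_X_plus_const_neq_0[of v]
    by (simp add: mult_ac fls_minus_const [symmetric] del: power_Suc)
  from arg_cong[OF this, of "\<lambda>f. fls_nth f (- 1)"] show ?thesis
    by (simp add: pole_residue_def)
qed

lemma pole_residue_second:
  "v * pole_residue u v (Suc a) b (Suc c) = pole_residue u v (Suc a) b c - pole_residue u v a b (Suc c)"
proof -
  let ?U = "fls_X + fls_const u" and ?V = "fls_X + fls_const v"
  have "fls_const v * inverse (fls_X ^ Suc a * ?U ^ b * ?V ^ Suc c)
      = inverse (fls_X ^ Suc a * ?U ^ b * ?V ^ c) - inverse (fls_X ^ a * ?U ^ b * ?V ^ Suc c)"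
    using inverse_powers_difference[of fls_X ?V a c "?U ^ b"] fls_X_plus_const_neq_0[of u] fls_X_plus_const_neq_0[of v]
    by (simp add: mult_ac fls_minus_const [symmetric] del: power_Suc)
  from arg_cong[OF this, of "\<lambda>f. fls_nth f (- 1)"] show ?thesis
    by (simp add: pole_residue_def)
qed

lemma pole_residue_third:
  "(v - u) * pole_residue u v a (Suc b) (Suc c) = pole_residue u v a (Suc b) c - pole_residue u v a b (Suc c)"
proof -
  let ?U = "fls_X + fls_const u" and ?V = "fls_X + fls_const v"
  have "fls_const (v - u) * inverse (fls_X ^ a * ?U ^ Suc b * ?V ^ Suc c)
      = inverse (fls_X ^ a * ?U ^ Suc b * ?V ^ c) - inverse (fls_X ^ a * ?U ^ b * ?V ^ Suc c)"
    using inverse_powers_difference[of ?U ?V b c "fls_X ^ a"] fls_X_plus_const_neq_0[of u] fls_X_plus_const_neq_0[of v]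
    by (simp add: mult_ac fls_minus_const [symmetric] del: power_Suc)
  from arg_cong[OF this, of "\<lambda>f. fls_nth f (- 1)"] show ?thesis
    by (simp add: pole_residue_def)
qed

lemma fls_deriv_inverse_power:
  fixes f :: "complex fls"
  assumes "f \<noteq> 0"
  shows "fls_deriv (inverse (f ^ n)) = - of_nat n * fls_deriv f * inverse (f ^ Suc n)"
proof -
  have "0 = fls_deriv (f ^ n * inverse (f ^ n))"
    using assms by simp
  also have "\<dots> = f ^ n * fls_deriv (inverse (f ^ n)) + of_nat n * f ^ (n - 1) * fls_deriv f * inverse (f ^ n)"
    by (simp add: fls_deriv_power algebra_simps)
  finally have "f ^ n * fls_deriv (inverse (f ^ n)) = - (of_nat n * f ^ (n - 1) * fls_deriv f * inverse (f ^ n))"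
    by (simp add: eq_neg_iff_add_eq_0)
  then have eq: "fls_deriv (inverse (f ^ n)) = - (of_nat n * f ^ (n - 1) * fls_deriv f * inverse (f ^ n)) * inverse (f ^ n)"
    using assms by (simp add: field_simps)
  show ?thesis
  proof (cases n)
    case (Suc k)
    have "f ^ k * inverse (f ^ n) = inverse f"
      using assms by (simp add: Suc)
    then have "- (of_nat n * f ^ k * fls_deriv f * inverse (f ^ n)) * inverse (f ^ n)
        = - of_nat n * fls_deriv f * (inverse f * inverse (f ^ n))"
      by (metis (no_types, opaque_lifting) mult.assoc mult.commute mult_minus_left)
    then show ?thesis
      unfolding eq by (simp add: Suc)
  qed simp
qed

lemma pole_residue_deriv:
  "of_nat a * pole_residue u v (Suc a) b c + of_nat b * pole_residue u v a (Suc b) c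
    + of_nat c * pole_residue u v a b (Suc c) = 0"
proof -
  let ?U = "fls_X + fls_const u" and ?V = "fls_X + fls_const v"
  have "fls_deriv (inverse (fls_X ^ a * ?U ^ b * ?V ^ c)) =
     - (of_nat a * inverse (fls_X ^ Suc a * ?U ^ b * ?V ^ c) + of_nat b * inverse (fls_X ^ a * ?U ^ Suc b * ?V ^ c)
        + of_nat c * inverse (fls_X ^ a * ?U ^ b * ?V ^ Suc c))"
    using fls_X_plus_const_neq_0[of u] fls_X_plus_const_neq_0[of v]
    by (simp add: inverse_mult_distrib fls_deriv_inverse_power algebra_simps del: power_Suc)
  from arg_cong[OF this, of "\<lambda>f. fls_nth f (- 1)"]
  have "fls_nth (of_nat a * inverse (fls_X ^ Suc a * ?U ^ b * ?V ^ c) + of_nat b * inverse (fls_X ^ a * ?U ^ Suc b * ?V ^ c)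
        + of_nat c * inverse (fls_X ^ a * ?U ^ b * ?V ^ Suc c)) (- 1) = 0"
    by (simp only: fls_deriv_residue) (simp only: fls_uminus_nth neg_equal_0_iff_equal neg_0_equal_iff_equal)
  then show ?thesis
    by (simp add: pole_residue_def fls_of_nat)
qed

lemma inverse_fps_X_plus_const_power:
  assumes "u \<noteq> 0"
  shows "inverse ((fps_X + fps_const u) ^ b)
    = Abs_fps (\<lambda>k. inverse u ^ b * (of_nat ((b + k - 1) choose k) * (- inverse u :: complex) ^ k))"
proof (cases "b = 0")
  case True
  then show ?thesis
    by (auto intro!: fps_ext)
next
  case False
  have eq: "fps_X + fps_const u = fps_const u * (1 - fps_const (- inverse u) * fps_X)"
    using assms by (intro fps_ext) (auto simp: fps_X_def algebra_simps)
  have "inverse ((fps_X + fps_const u) ^ b)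
      = fps_const (inverse u ^ b) * inverse ((1 - fps_const (- inverse u) * fps_X) ^ b)"
    unfolding eq power_mult_distrib fps_inverse_mult
    using assms by (simp add: fps_const_power fps_const_inverse power_inverse del: fps_const_neg)
  also have "\<dots> = fps_const (inverse u ^ b) * Abs_fps (\<lambda>k. of_nat ((b + k - 1) choose k) * (- inverse u) ^ k)"
    using False by (subst one_minus_const_fps_X_neg_power') auto
  finally show ?thesis
    by (auto intro!: fps_ext)
qed

lemma pole_residue_fps:
  assumes "u \<noteq> 0" "v \<noteq> 0"
  shows "pole_residue u v a b c = (if a = 0 then 0 else
     fps_nth (inverse ((fps_X + fps_const u) ^ b) * inverse ((fps_X + fps_const v) ^ c)) (a - 1))"
proof -
  have inv: "inverse ((fls_X + fls_const w) ^ n) = fps_to_fls (inverse ((fps_X + fps_const w) ^ n))"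
    if "w \<noteq> 0" for w :: complex and n
  proof -
    have "subdegree ((fps_X + fps_const w) ^ n) = 0"
      using that by (intro subdegreeI) auto
    then show ?thesis
      by (simp add: fps_to_fls_power flip: fls_inverse_fps_to_fls)
  qed
  have "inverse (fls_X ^ a * (fls_X + fls_const u) ^ b * (fls_X + fls_const v) ^ c)
     = fls_X_inv ^ a * fps_to_fls (inverse ((fps_X + fps_const u) ^ b) * inverse ((fps_X + fps_const v) ^ c))"
    using assms by (simp add: inverse_mult_distrib inv fls_times_fps_to_fls power_inverse mult.assoc
        flip: fls_inverse_X)
  then show ?thesis
    unfolding pole_residue_def by (simp add: fls_X_inv_power_times_conv_shift nat_diff_distrib)
qed

text \<open>
  The residue with its powers of \<open>u\<close> and \<open>v\<close> in the denominator cleared: a form of degree \<open>k\<close> with natural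
  coefficients.
\<close>

definition residue_form :: "nat \<Rightarrow> nat \<Rightarrow> nat \<Rightarrow> complex \<Rightarrow> complex \<Rightarrow> complex" where
  "residue_form b c k u v =
     (\<Sum>i=0..k. of_nat (((b + i - 1) choose i) * ((c + (k - i) - 1) choose (k - i))) * u ^ (k - i) * v ^ i)"

lemma pole_residue_form:
  assumes "u \<noteq> 0" "v \<noteq> 0"
  shows "u ^ (b + k) * v ^ (c + k) * pole_residue u v (Suc k) b c = (- 1) ^ k * residue_form b c k u v"
proof -
  have res: "pole_residue u v (Suc k) b c
     = (\<Sum>i=0..k. inverse u ^ b * (of_nat ((b + i - 1) choose i) * (- inverse u) ^ i)
        * (inverse v ^ c * (of_nat ((c + (k - i) - 1) choose (k - i)) * (- inverse v) ^ (k - i))))"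
    using assms by (simp add: pole_residue_fps inverse_fps_X_plus_const_power fps_mult_nth)
  show ?thesis
    unfolding res residue_form_def sum_distrib_left
  proof (intro sum.cong refl)
    fix i assume "i \<in> {0..k}"
    then have 1: "u ^ (b + k) = u ^ b * (u ^ (k - i) * u ^ i)" "v ^ (c + k) = v ^ c * (v ^ (k - i) * v ^ i)"
      "(- 1 :: complex) ^ k = (- 1) ^ i * (- 1) ^ (k - i)"
      by (simp_all flip: power_add)
    have 2: "(- inverse u) ^ i = (- 1) ^ i * inverse (u ^ i)"
      "(- inverse v) ^ (k - i) = (- 1) ^ (k - i) * inverse (v ^ (k - i))"
      by (simp_all add: power_minus[of "inverse _"] power_inverse)
    show "u ^ (b + k) * v ^ (c + k) *
         (inverse u ^ b * (of_nat ((b + i - 1) choose i) * (- inverse u) ^ i) *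
          (inverse v ^ c * (of_nat ((c + (k - i) - 1) choose (k - i)) * (- inverse v) ^ (k - i)))) =
         (- 1) ^ k * (of_nat (((b + i - 1) choose i) * ((c + (k - i) - 1) choose (k - i))) * u ^ (k - i) * v ^ i)"
      unfolding 1 2 using assms by (simp add: field_simps)
  qed
qed

text \<open>
  Both sides are coefficients of \<open>inverse ((1 - X) ^ (b + c))\<close>.
\<close>

lemma residue_form_coeff_sum:
  assumes "b > 0" "c > 0"
  shows "(\<Sum>i=0..k. ((b + i - 1) choose i) * ((c + (k - i) - 1) choose (k - i))) = (b + c + k - 1) choose k"
proof -
  have g: "inverse ((1 - fps_X) ^ n) = Abs_fps (\<lambda>k. of_nat ((n + k - 1) choose k) :: complex)" if "n > 0" for n
    using one_minus_const_fps_X_neg_power'[OF that, of "1 :: complex"] by simp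
  have "inverse ((1 - fps_X :: complex fps) ^ (b + c)) = inverse ((1 - fps_X) ^ b) * inverse ((1 - fps_X) ^ c)"
    by (simp add: power_add fps_inverse_mult)
  then have "(\<Sum>i=0..k. of_nat ((b + i - 1) choose i) * of_nat ((c + (k - i) - 1) choose (k - i)) :: complex)
      = of_nat ((b + c + k - 1) choose k)"
    using assms by (simp add: g fps_eq_iff fps_mult_nth)
  then have "of_nat (\<Sum>i=0..k. ((b + i - 1) choose i) * ((c + (k - i) - 1) choose (k - i)))
      = (of_nat ((b + c + k - 1) choose k) :: complex)"
    by simp
  then show ?thesis
    by (simp only: of_nat_eq_iff)
qed

text \<open>
  What will be used about a homogeneous form of degree \<open>e\<close> with integer coefficients whose moduli have a sum at
  most \<open>K\<close>.
\<close>

definition integral_form :: "nat \<Rightarrow> real \<Rightarrow> (complex \<Rightarrow> complex \<Rightarrow> complex) \<Rightarrow> bool" where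
  "integral_form e K w \<longleftrightarrow>
     (\<forall>t u v. w (t * u) (t * v) = t ^ e * w u v) \<and>
     (\<forall>B u v. complex_subring B \<longrightarrow> u \<in> B \<longrightarrow> v \<in> B \<longrightarrow> w u v \<in> B) \<and>
     (\<forall>u v. norm u \<le> 1 \<longrightarrow> norm v \<le> 1 \<longrightarrow> norm (w u v) \<le> K) \<and>
     (\<forall>F G. rat_poly_fun F \<longrightarrow> rat_poly_fun G \<longrightarrow> rat_poly_fun (\<lambda>z. w (F z) (G z)))"

lemma integral_form_residue_form:
  assumes bc: "b > 0" "c > 0" and K: "real ((b + c + k - 1) choose k) \<le> K" and e: "e = p + q + k"
    and s: "s = 1 \<or> s = - (1 :: complex)"
  shows "integral_form e K (\<lambda>u v. s * u ^ p * v ^ q * residue_form b c k u (- v))"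
  unfolding integral_form_def
proof (intro conjI allI impI)
  fix t u v :: complex
  have "residue_form b c k (t * u) (- (t * v)) = t ^ k * residue_form b c k u (- v)"
    unfolding residue_form_def sum_distrib_left
  proof (intro sum.cong refl)
    fix i assume "i \<in> {0..k}"
    then have "t ^ k = t ^ (k - i) * t ^ i" by (simp flip: power_add)
    then show "of_nat (((b + i - 1) choose i) * ((c + (k - i) - 1) choose (k - i))) * (t * u) ^ (k - i) * (- (t * v)) ^ i
        = t ^ k * (of_nat (((b + i - 1) choose i) * ((c + (k - i) - 1) choose (k - i))) * u ^ (k - i) * (- v) ^ i)"
      by (simp add: power_mult_distrib power_minus[of "t * v"] power_minus[of v])
  qed
  then show "s * (t * u) ^ p * (t * v) ^ q * residue_form b c k (t * u) (- (t * v))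
      = t ^ e * (s * u ^ p * v ^ q * residue_form b c k u (- v))"
    by (simp add: e power_mult_distrib power_add)
next
  fix B and u v :: complex
  assume "complex_subring B" and uv: "u \<in> B" "v \<in> B"
  interpret complex_subring B by fact
  have "s \<in> B" using s by auto
  then show "s * u ^ p * v ^ q * residue_form b c k u (- v) \<in> B"
    unfolding residue_form_def using uv by (intro mult_mem sum_mem power_mem uminus_mem of_nat_mem)
next
  fix u v :: complex
  assume uv: "norm u \<le> 1" "norm v \<le> 1"
  have "norm (residue_form b c k u (- v))
    \<le> (\<Sum>i=0..k. real (((b + i - 1) choose i) * ((c + (k - i) - 1) choose (k - i))))"
    unfolding residue_form_def
  proof (rule sum_norm_le)
    fix i
    have "norm u ^ (k - i) * norm v ^ i \<le> 1 * 1"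
      using uv by (intro mult_mono power_le_one) auto
    then have "real (((b + i - 1) choose i) * ((c + (k - i) - 1) choose (k - i))) * (norm u ^ (k - i) * norm v ^ i)
        \<le> real (((b + i - 1) choose i) * ((c + (k - i) - 1) choose (k - i))) * 1"
      by (intro mult_left_mono) auto
    then show "norm (of_nat (((b + i - 1) choose i) * ((c + (k - i) - 1) choose (k - i))) * u ^ (k - i) * (- v) ^ i)
        \<le> real (((b + i - 1) choose i) * ((c + (k - i) - 1) choose (k - i)))"
      by (simp add: norm_mult norm_power mult.assoc)
  qed
  also have "\<dots> = real ((b + c + k - 1) choose k)"
    by (subst residue_form_coeff_sum[OF bc, symmetric]) simp
  finally have 1: "norm (residue_form b c k u (- v)) \<le> K"
    using K by simp
  have "norm s * norm u ^ p * norm v ^ q \<le> 1 * 1 * 1"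
    using uv s by (intro mult_mono power_le_one) auto
  then have "norm s * norm u ^ p * norm v ^ q * norm (residue_form b c k u (- v)) \<le> 1 * K"
    using 1 by (intro mult_mono) auto
  then show "norm (s * u ^ p * v ^ q * residue_form b c k u (- v)) \<le> K"
    by (simp add: norm_mult norm_power)
next
  fix F G assume "rat_poly_fun F" "rat_poly_fun G"
  moreover have "rat_poly_fun (\<lambda>z. s)"
    using s rat_poly_fun_one rat_poly_fun_uminus[OF rat_poly_fun_one] by auto
  ultimately show "rat_poly_fun (\<lambda>z. s * F z ^ p * G z ^ q * residue_form b c k (F z) (- G z))"
    unfolding residue_form_def by (intro rat_poly_intros)
qed

text \<open>
  The linear relations between the residues, at a fixed pole, of the functions with denominators
  \<open>(t - \<xi>\<^sub>1)\<^sup>a (t - \<xi>\<^sub>2)\<^sup>b (t - \<xi>\<^sub>3)\<^sup>c\<close>, where \<open>X1 = \<xi>\<^sub>2 - \<xi>\<^sub>3\<close>, \<open>X2 = \<xi>\<^sub>3 - \<xi>\<^sub>1\<close>, \<open>X3 = \<xi>\<^sub>1 - \<xi>\<^sub>2\<close>. The first three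
  relations are partial fractions; the last one says that a derivative has no residue. They do not depend
  on the pole, so that they are inherited by linear combinations of the residues at different poles.
\<close>

definition contiguous :: "complex \<Rightarrow> complex \<Rightarrow> complex \<Rightarrow> (nat \<Rightarrow> nat \<Rightarrow> nat \<Rightarrow> complex) \<Rightarrow> bool" where
  "contiguous X1 X2 X3 f \<longleftrightarrow>
     (\<forall>a b c. X3 * f (Suc a) (Suc b) c = f (Suc a) b c - f a (Suc b) c) \<and>
     (\<forall>a b c. X1 * f a (Suc b) (Suc c) = f a (Suc b) c - f a b (Suc c)) \<and>
     (\<forall>a b c. X2 * f (Suc a) b (Suc c) = f a b (Suc c) - f (Suc a) b c) \<and>
     (\<forall>a b c. of_nat a * f (Suc a) b c + of_nat b * f a (Suc b) c + of_nat c * f a b (Suc c) = 0)"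

lemma contiguous_add:
  assumes "contiguous X1 X2 X3 f" "contiguous X1 X2 X3 g"
  shows "contiguous X1 X2 X3 (\<lambda>a b c. s * f a b c + t * g a b c)"
  unfolding contiguous_def
proof (intro conjI allI)
  fix a b c
  have f: "X3 * f (Suc a) (Suc b) c = f (Suc a) b c - f a (Suc b) c"
    "X1 * f a (Suc b) (Suc c) = f a (Suc b) c - f a b (Suc c)"
    "X2 * f (Suc a) b (Suc c) = f a b (Suc c) - f (Suc a) b c"
    "of_nat a * f (Suc a) b c + of_nat b * f a (Suc b) c + of_nat c * f a b (Suc c) = 0"
    and g: "X3 * g (Suc a) (Suc b) c = g (Suc a) b c - g a (Suc b) c"
    "X1 * g a (Suc b) (Suc c) = g a (Suc b) c - g a b (Suc c)"
    "X2 * g (Suc a) b (Suc c) = g a b (Suc c) - g (Suc a) b c"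
    "of_nat a * g (Suc a) b c + of_nat b * g a (Suc b) c + of_nat c * g a b (Suc c) = 0"
    using assms by (simp_all add: contiguous_def)
  show "X3 * (s * f (Suc a) (Suc b) c + t * g (Suc a) (Suc b) c)
      = s * f (Suc a) b c + t * g (Suc a) b c - (s * f a (Suc b) c + t * g a (Suc b) c)"
    using f(1) g(1) by algebra
  show "X1 * (s * f a (Suc b) (Suc c) + t * g a (Suc b) (Suc c))
      = s * f a (Suc b) c + t * g a (Suc b) c - (s * f a b (Suc c) + t * g a b (Suc c))"
    using f(2) g(2) by algebra
  show "X2 * (s * f (Suc a) b (Suc c) + t * g (Suc a) b (Suc c))
      = s * f a b (Suc c) + t * g a b (Suc c) - (s * f (Suc a) b c + t * g (Suc a) b c)"
    using f(3) g(3) by algebra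
  show "of_nat a * (s * f (Suc a) b c + t * g (Suc a) b c) + of_nat b * (s * f a (Suc b) c + t * g a (Suc b) c)
      + of_nat c * (s * f a b (Suc c) + t * g a b (Suc c)) = 0"
    using f(4) g(4) by algebra
qed

lemma contiguous_rotate:
  assumes "contiguous X1 X2 X3 f"
  shows "contiguous X3 X1 X2 (\<lambda>a b c. f b c a)"
proof -
  have "of_nat a * f b c (Suc a) + of_nat b * f (Suc b) c a + of_nat c * f b (Suc c) a = 0" for a b c
  proof -
    have "of_nat b * f (Suc b) c a + of_nat c * f b (Suc c) a + of_nat a * f b c (Suc a) = 0"
      using assms unfolding contiguous_def by blast
    then show ?thesis by (simp add: algebra_simps)
  qed
  then show ?thesis
    using assms unfolding contiguous_def by simp
qed

lemma contiguous_pole_residue: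
  assumes "X1 + X2 + X3 = 0"
  shows "contiguous X1 X2 X3 (pole_residue X3 (- X2))"
proof -
  have X1: "X1 = - X2 - X3"
    using assms by (simp add: algebra_simps eq_neg_iff_add_eq_0)
  show ?thesis
    unfolding contiguous_def
  proof (intro conjI allI)
    fix a b c
    show "X3 * pole_residue X3 (- X2) (Suc a) (Suc b) c
        = pole_residue X3 (- X2) (Suc a) b c - pole_residue X3 (- X2) a (Suc b) c"
      by (rule pole_residue_first)
    show "X1 * pole_residue X3 (- X2) a (Suc b) (Suc c)
        = pole_residue X3 (- X2) a (Suc b) c - pole_residue X3 (- X2) a b (Suc c)"
      unfolding X1 by (rule pole_residue_third)
    show "X2 * pole_residue X3 (- X2) (Suc a) b (Suc c)
        = pole_residue X3 (- X2) a b (Suc c) - pole_residue X3 (- X2) (Suc a) b c"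
      using pole_residue_second[of "- X2" X3 a b c] by (simp add: algebra_simps)
    show "of_nat a * pole_residue X3 (- X2) (Suc a) b c + of_nat b * pole_residue X3 (- X2) a (Suc b) c
        + of_nat c * pole_residue X3 (- X2) a b (Suc c) = 0"
      by (rule pole_residue_deriv)
  qed
qed

text \<open>
  The relations lower the sum of the exponents until only one exponent is left.
\<close>

lemma contiguous_constant:
  assumes f: "contiguous X1 X2 X3 f" and X: "X1 \<noteq> 0" "X2 \<noteq> 0" "X3 \<noteq> 0"
    and base: "\<And>a. f a 0 0 = (if a = 1 then 1 else 0)" "\<And>a. f 0 a 0 = (if a = 1 then 1 else 0)"
      "\<And>a. f 0 0 a = (if a = 1 then 1 else 0)"
  shows "f a b c = (if a + b + c = 1 then 1 else 0)"
proof (induction "a + b + c" arbitrary: a b c)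
  case 0
  then show ?case using base(1)[of 0] by simp
next
  case (Suc n)
  consider a' b' where "a = Suc a'" "b = Suc b'" | b' c' where "b = Suc b'" "c = Suc c'"
    | a' c' where "a = Suc a'" "c = Suc c'" | "b = 0" "c = 0" | "a = 0" "c = 0" | "a = 0" "b = 0"
    by (cases a; cases b; cases c) auto
  then show ?case
  proof cases
    case 1
    then have "X3 * f a b c = f a b' c - f a' b c"
      using f by (simp add: contiguous_def)
    then show ?thesis
      using Suc(1)[of a b' c] Suc(1)[of a' b c] Suc(2) 1 X by auto
  next
    case 2
    then have "X1 * f a b c = f a b c' - f a b' c"
      using f by (simp add: contiguous_def)
    then show ?thesis
      using Suc(1)[of a b c'] Suc(1)[of a b' c] Suc(2) 2 X by auto
  next
    case 3
    then have "X2 * f a b c = f a' b c - f a b c'"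
      using f by (simp add: contiguous_def)
    then show ?thesis
      using Suc(1)[of a b c'] Suc(1)[of a' b c] Suc(2) 3 X by auto
  qed (use base in auto)
qed

text \<open>
  The residue theorem on the sphere: the function decays at least quadratically, hence has no residue at infinity.
\<close>

theorem sum_of_residues:
  assumes "X1 + X2 + X3 = 0" and X: "X1 \<noteq> 0" "X2 \<noteq> 0" "X3 \<noteq> 0" and "a + b + c \<ge> 2"
  shows "pole_residue X3 (- X2) a b c + pole_residue X1 (- X3) b c a + pole_residue X2 (- X1) c a b = 0"
proof -
  define f where "f a b c = pole_residue X3 (- X2) a b c + pole_residue X1 (- X3) b c a + pole_residue X2 (- X1) c a b"
    for a b c
  have 1: "contiguous X1 X2 X3 (pole_residue X3 (- X2))"
    using contiguous_pole_residue assms(1) .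
  have 2: "contiguous X1 X2 X3 (\<lambda>a b c. pole_residue X1 (- X3) b c a)"
    using contiguous_rotate[OF contiguous_pole_residue[of X2 X3 X1]] assms(1) by (simp add: add_ac)
  have 3: "contiguous X1 X2 X3 (\<lambda>a b c. pole_residue X2 (- X1) c a b)"
    using contiguous_rotate[OF contiguous_rotate[OF contiguous_pole_residue[of X3 X1 X2]]] assms(1) by (simp add: add_ac)
  have f: "contiguous X1 X2 X3 f"
    using contiguous_add[OF contiguous_add[OF 1 2, of 1 1] 3, of 1 1] unfolding f_def by simp
  have vals: "pole_residue u v k 0 0 = (if k = 1 then 1 else 0)" "pole_residue u v 0 k l = 0"
    if "u \<noteq> 0" "v \<noteq> 0" for u v k l
    using that by (auto simp: pole_residue_fps)
  have "f a b c = (if a + b + c = 1 then 1 else 0)"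
    by (rule contiguous_constant[OF f]) (use X vals in \<open>auto simp: f_def\<close>)
  then show ?thesis
    using assms(5) by (auto simp: f_def)
qed

text \<open>
  By partial fractions, the three values with two exponents lowered agree. The derivative relation between them
  has a positive sum of coefficients, so that this common value is \<open>0\<close>.
\<close>

lemma contiguous_descent:
  assumes f: "contiguous X1 X2 X3 f"
    and z: "f (Suc (Suc a)) (Suc b) (Suc c) = 0" "f (Suc a) (Suc b) (Suc c) = 0"
      "f (Suc (Suc a)) b (Suc c) = 0" "f (Suc (Suc a)) (Suc b) c = 0"
  shows "f a (Suc b) (Suc c) = 0"
      "f (Suc a) b (Suc c) = 0" "f (Suc a) (Suc b) c = 0"
proof -
  have r1: "X3 * f (Suc a) (Suc b) c = f (Suc a) b c - f a (Suc b) c" for a b c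
    using f by (simp add: contiguous_def)
  have r2: "X1 * f a (Suc b) (Suc c) = f a (Suc b) c - f a b (Suc c)" for a b c
    using f by (simp add: contiguous_def)
  have r3: "X2 * f (Suc a) b (Suc c) = f a b (Suc c) - f (Suc a) b c" for a b c
    using f by (simp add: contiguous_def)
  have "f (Suc (Suc a)) b c = f (Suc a) (Suc b) c"
    using r1[of "Suc a" b c] z by simp
  moreover have "f (Suc a) b (Suc c) = f (Suc (Suc a)) b c"
    using r3[of "Suc a" b c] z by simp
  moreover have "of_nat (Suc a) * f (Suc (Suc a)) b c + of_nat b * f (Suc a) (Suc b) c + of_nat c * f (Suc a) b (Suc c) = 0"
    using f unfolding contiguous_def by blast
  ultimately have "of_nat (Suc a + b + c) * f (Suc (Suc a)) b c = 0"
    by (simp add: algebra_simps)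
  then have "f (Suc (Suc a)) b c = 0"
    by (simp only: mult_eq_0_iff of_nat_eq_0_iff) simp
  then show "f (Suc a) b (Suc c) = 0" "f (Suc a) (Suc b) c = 0"
    using \<open>f (Suc (Suc a)) b c = f (Suc a) (Suc b) c\<close> \<open>f (Suc a) b (Suc c) = f (Suc (Suc a)) b c\<close> by auto
  then show "f a (Suc b) (Suc c) = 0"
    using r1[of a b "Suc c"] z by simp
qed

text \<open>
  Lowering one exponent after the other reaches the simplest functions, whose residues are known explicitly. This
  is the source of the independence of the two relations below: a linear functional on vectors of residues that
  vanishes on both of them vanishes.
\<close>

lemma contiguous_vanishing:
  assumes f: "contiguous X1 X2 X3 f" and z: "f (Suc n) (Suc n) (Suc n) = 0" "f n (Suc n) (Suc n) = 0"
  shows "f 0 1 1 = 0" "f 1 0 1 = 0"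
proof -
  define P where "P f a b c \<longleftrightarrow> f (Suc a) (Suc b) (Suc c) = 0 \<and> f a (Suc b) (Suc c) = 0
     \<and> f (Suc a) b (Suc c) = 0 \<and> f (Suc a) (Suc b) c = (0 :: complex)" for f :: "nat \<Rightarrow> nat \<Rightarrow> nat \<Rightarrow> complex" and a b c
  have "X3 * f (Suc n) (Suc n) (Suc n) = f (Suc n) n (Suc n) - f n (Suc n) (Suc n)"
    "X2 * f (Suc n) (Suc n) (Suc n) = f n (Suc n) (Suc n) - f (Suc n) (Suc n) n"
    using f by (simp_all add: contiguous_def)
  then have "P f n n n"
    using z by (auto simp: P_def)
  have down: "P g 0 b c" if "contiguous Y1 Y2 Y3 g" "P g a b c" for Y1 Y2 Y3 g a b c
    using that(2)
  proof (induction a)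
    case (Suc a)
    then show ?case
      using contiguous_descent[OF that(1), of a b c] by (auto simp: P_def)
  qed
  have "P f 0 n n"
    using down[OF f] \<open>P f n n n\<close> by blast
  then have "P (\<lambda>a b c. f c a b) n n 0"
    by (simp add: P_def)
  then have "P (\<lambda>a b c. f c a b) 0 n 0"
    using down[OF contiguous_rotate[OF contiguous_rotate[OF f]]] by blast
  then have "P (\<lambda>a b c. f b c a) n 0 0"
    by (simp add: P_def)
  then have "P (\<lambda>a b c. f b c a) 0 0 0"
    using down[OF contiguous_rotate[OF f]] by blast
  then show "f 0 1 1 = 0" "f 1 0 1 = 0"
    by (auto simp: P_def)
qed

section \<open>Pade approximation at a common zero\<close>

lemma pole_residue_cleared:
  assumes "u \<noteq> 0" "v \<noteq> 0" and N: "N = b + k + p" "N = c + k + q"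
  shows "(u * v) ^ N * pole_residue u (- v) (Suc k) b c = (- 1) ^ c * u ^ p * v ^ q * residue_form b c k u (- v)"
proof -
  have "(u * v) ^ N = u ^ (b + k) * u ^ p * (v ^ (c + k) * v ^ q)"
    unfolding power_mult_distrib power_add[symmetric] N(1)[symmetric] N(2)[symmetric] ..
  also have "v ^ (c + k) = (- 1) ^ (c + k) * (- v) ^ (c + k)"
    by (subst power_mult_distrib[symmetric]) simp
  finally have "(u * v) ^ N * pole_residue u (- v) (Suc k) b c
     = (- 1) ^ (c + k) * u ^ p * v ^ q * (u ^ (b + k) * (- v) ^ (c + k) * pole_residue u (- v) (Suc k) b c)"
    by (simp add: mult_ac)
  also have "\<dots> = (- 1) ^ (c + k) * (- 1) ^ k * u ^ p * v ^ q * residue_form b c k u (- v)"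
    using assms by (subst pole_residue_form) auto
  also have "(- 1 :: complex) ^ (c + k) * (- 1) ^ k = (- 1) ^ c"
    by (simp add: uminus_power_if)
  finally show ?thesis by simp
qed

text \<open>
  The variable whose power is taken is missing from the corresponding coefficient; the two others occur in the
  order in which the residue formula delivers them.
\<close>

definition syzygy :: "nat \<Rightarrow> (complex \<Rightarrow> complex \<Rightarrow> complex) \<Rightarrow> (complex \<Rightarrow> complex \<Rightarrow> complex)
    \<Rightarrow> (complex \<Rightarrow> complex \<Rightarrow> complex) \<Rightarrow> bool" where
  "syzygy N w1 w2 w3 \<longleftrightarrow> (\<forall>X1 X2 X3. X1 + X2 + X3 = 0 \<longrightarrow> X1 \<noteq> 0 \<longrightarrow> X2 \<noteq> 0 \<longrightarrow> X3 \<noteq> 0 \<longrightarrow>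
     X1 ^ N * w1 X3 X2 + X2 ^ N * w2 X1 X3 + X3 ^ N * w3 X2 X1 = 0)"

text \<open>
  The first relation consists of the residues for the exponents \<open>(n + 1, n + 1, n + 1)\<close>, the second one of those
  for \<open>(n, n + 1, n + 1)\<close>, both multiplied by the power \<open>2 n + 1\<close> of \<open>X1 X2 X3\<close>. The last conclusion says that the
  coefficient vectors of the two relations are not parallel, in the form in which it will be used.
\<close>

theorem independent_syzygies:
  assumes n: "n > 0"
  defines "K \<equiv> real ((3 * n + 1) choose n)"
  obtains w v1 v2 v3 where "integral_form n K w" and "syzygy (2 * n + 1) w w w"
    and "integral_form (n + 1) K v1" and "integral_form (n + 1) K v2" and "integral_form (n + 1) K v3"
    and "syzygy (2 * n + 1) v1 v2 v3"
    and "\<And>X1 X2 X3 A B. X1 + X2 + X3 = 0 \<Longrightarrow> X1 \<noteq> 0 \<Longrightarrow> X2 \<noteq> 0 \<Longrightarrow> X3 \<noteq> 0 \<Longrightarrow>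
       A * w X1 X3 + B * w X2 X1 = 0 \<Longrightarrow> A * v2 X1 X3 + B * v3 X2 X1 = 0 \<Longrightarrow> A = 0 \<and> B = 0"
proof -
  define N where "N = 2 * n + 1"
  define w where "w = (\<lambda>u v. (- 1) ^ Suc n * u ^ 0 * v ^ 0 * residue_form (Suc n) (Suc n) n u (- v))"
  define v1 where "v1 = (\<lambda>u v. (- 1) ^ Suc n * u ^ 1 * v ^ 1 * residue_form (Suc n) (Suc n) (n - 1) u (- v))"
  define v2 where "v2 = (\<lambda>u v. (- 1) ^ n * u ^ 0 * v ^ 1 * residue_form (Suc n) n n u (- v))"
  define v3 where "v3 = (\<lambda>u v. (- 1) ^ Suc n * u ^ 1 * v ^ 0 * residue_form n (Suc n) n u (- v))"
  have sgn: "(- 1 :: complex) ^ j = 1 \<or> (- 1 :: complex) ^ j = - 1" for j :: nat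
    by (cases "even j") simp_all
  have pascal: "(3 * n + 1) choose n = ((3 * n) choose (n - 1)) + ((3 * n) choose n)"
    using n choose_reduce_nat[of "3 * n + 1" n] by simp
  have forms: "integral_form n K w" "integral_form (n + 1) K v1" "integral_form (n + 1) K v2" "integral_form (n + 1) K v3"
  proof -
    have idx: "Suc n + Suc n + n - 1 = 3 * n + 1" "Suc n + Suc n + (n - 1) - 1 = 3 * n"
      "Suc n + n + n - 1 = 3 * n" "n + Suc n + n - 1 = 3 * n"
      using n by auto
    have wK: "real ((Suc n + Suc n + n - 1) choose n) \<le> K"
      unfolding idx K_def by simp
    show "integral_form n K w"
      unfolding w_def by (rule integral_form_residue_form[OF _ _ wK]) (use sgn in \<open>auto simp del: power_Suc\<close>)
    have vK: "real ((Suc n + Suc n + (n - 1) - 1) choose (n - 1)) \<le> K"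
      "real ((Suc n + n + n - 1) choose n) \<le> K" "real ((n + Suc n + n - 1) choose n) \<le> K"
      unfolding idx K_def pascal by simp_all
    show "integral_form (n + 1) K v1"
      unfolding v1_def
      by (rule integral_form_residue_form[OF _ _ vK(1)]) (use n sgn in \<open>auto simp del: power_Suc\<close>)
    show "integral_form (n + 1) K v2"
      unfolding v2_def
      by (rule integral_form_residue_form[OF _ _ vK(2)]) (use n sgn in \<open>auto simp del: power_Suc\<close>)
    show "integral_form (n + 1) K v3"
      unfolding v3_def
      by (rule integral_form_residue_form[OF _ _ vK(3)]) (use n sgn in \<open>auto simp del: power_Suc\<close>)
  qed
  have w: "(u * v) ^ N * pole_residue u (- v) (Suc n) (Suc n) (Suc n) = w u v"
    and v1: "(u * v) ^ N * pole_residue u (- v) n (Suc n) (Suc n) = v1 u v"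
    and v2: "(u * v) ^ N * pole_residue u (- v) (Suc n) (Suc n) n = v2 u v"
    and v3: "(u * v) ^ N * pole_residue u (- v) (Suc n) n (Suc n) = v3 u v"
    if "u \<noteq> 0" "v \<noteq> 0" for u v
    using that pole_residue_cleared[of u v N "Suc n" n 0 "Suc n" 0]
      pole_residue_cleared[of u v N "Suc n" "n - 1" 1 "Suc n" 1]
      pole_residue_cleared[of u v N "Suc n" n 0 n 1] pole_residue_cleared[of u v N n n 1 "Suc n" 0] n
    by (simp_all add: w_def v1_def v2_def v3_def N_def)
  have syz: "X1 ^ N * ((X3 * X2) ^ N * r1) + X2 ^ N * ((X1 * X3) ^ N * r2) + X3 ^ N * ((X2 * X1) ^ N * r3) = 0"
    if "r1 + r2 + r3 = 0" for X1 X2 X3 r1 r2 r3 :: complex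
  proof -
    have "X1 ^ N * ((X3 * X2) ^ N * r1) + X2 ^ N * ((X1 * X3) ^ N * r2) + X3 ^ N * ((X2 * X1) ^ N * r3)
       = (X1 * X2 * X3) ^ N * (r1 + r2 + r3)"
      by (simp add: power_mult_distrib algebra_simps)
    then show ?thesis using that by simp
  qed
  have wsyz: "syzygy N w w w"
    unfolding syzygy_def
  proof (intro allI impI)
    fix X1 X2 X3 :: complex
    assume X: "X1 + X2 + X3 = 0" "X1 \<noteq> 0" "X2 \<noteq> 0" "X3 \<noteq> 0"
    show "X1 ^ N * w X3 X2 + X2 ^ N * w X1 X3 + X3 ^ N * w X2 X1 = 0"
      unfolding w[OF X(4,3), symmetric] w[OF X(2,4), symmetric] w[OF X(3,2), symmetric]
      by (intro syz sum_of_residues X) simp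
  qed
  have vsyz: "syzygy N v1 v2 v3"
    unfolding syzygy_def
  proof (intro allI impI)
    fix X1 X2 X3 :: complex
    assume X: "X1 + X2 + X3 = 0" "X1 \<noteq> 0" "X2 \<noteq> 0" "X3 \<noteq> 0"
    show "X1 ^ N * v1 X3 X2 + X2 ^ N * v2 X1 X3 + X3 ^ N * v3 X2 X1 = 0"
      unfolding v1[OF X(4,3), symmetric] v2[OF X(2,4), symmetric] v3[OF X(3,2), symmetric]
      by (intro syz sum_of_residues X) simp
  qed
  have ind: "A = 0 \<and> B = 0"
    if X: "X1 + X2 + X3 = 0" "X1 \<noteq> 0" "X2 \<noteq> 0" "X3 \<noteq> 0"
      and wz: "A * w X1 X3 + B * w X2 X1 = 0" and vz: "A * v2 X1 X3 + B * v3 X2 X1 = 0" for X1 X2 X3 A B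
  proof -
    define f where "f a b c = (A * (X1 * X3) ^ N) * pole_residue X1 (- X3) b c a
        + (B * (X2 * X1) ^ N) * pole_residue X2 (- X1) c a b" for a b c
    have 2: "contiguous X1 X2 X3 (\<lambda>a b c. pole_residue X1 (- X3) b c a)"
      using contiguous_rotate[OF contiguous_pole_residue[of X2 X3 X1]] X(1) by (simp add: add_ac)
    have 3: "contiguous X1 X2 X3 (\<lambda>a b c. pole_residue X2 (- X1) c a b)"
      using contiguous_rotate[OF contiguous_rotate[OF contiguous_pole_residue[of X3 X1 X2]]] X(1) by (simp add: add_ac)
    have "contiguous X1 X2 X3 f"
      using contiguous_add[OF 2 3] unfolding f_def .
    moreover have "f (Suc n) (Suc n) (Suc n) = 0" "f n (Suc n) (Suc n) = 0"
      using wz vz X by (simp_all add: f_def mult.assoc w v2 v3)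
    ultimately have "f 0 1 1 = 0" "f 1 0 1 = 0"
      using contiguous_vanishing by blast+
    moreover have "pole_residue X1 (- X3) 0 1 1 = 0" "pole_residue X2 (- X1) 1 1 0 \<noteq> 0" "pole_residue X1 (- X3) 1 1 0 \<noteq> 0"
      using X by (auto simp: pole_residue_fps)
    ultimately show ?thesis
      using X by (auto simp: f_def)
  qed
  show thesis
    by (rule that[OF forms(1) wsyz[unfolded N_def] forms(2-4) vsyz[unfolded N_def] ind])
qed

definition power_sum_zero :: "nat \<Rightarrow> complex \<Rightarrow> bool" where
  "power_sum_zero n x \<longleftrightarrow> 1 + x ^ n + (- 1 - x) ^ n = 0"

lemma power_sum_not_identically_zero:
  assumes "b \<ge> 2"
  shows "\<exists>y. 1 + y ^ b + (- 1 - y) ^ b \<noteq> (0 :: complex)"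
proof (cases "even b")
  case True
  then show ?thesis
    using assms by (intro exI[of _ 0]) (auto simp: power_0_left)
next
  case False
  have "(2 :: complex) ^ b \<noteq> 2"
  proof
    assume "(2 :: complex) ^ b = 2"
    then have "of_nat (2 ^ b) = (of_nat 2 :: complex)" by simp
    then have "(2 :: nat) ^ b = 2" by (simp only: of_nat_eq_iff)
    moreover have "(2 :: nat) ^ 2 \<le> 2 ^ b"
      using assms by (intro power_increasing) auto
    ultimately show False by simp
  qed
  then show ?thesis
    using False by (intro exI[of _ 1]) (simp add: power_minus_odd algebra_simps)
qed

text \<open>
  The excluded values are \<open>0\<close>, \<open>- 1\<close> and the two primitive cube roots of unity. Up to sign, \<open>x\<^sup>2 + x + 1\<close> and
  \<open>x (1 + x)\<close> are the elementary symmetric functions \<open>e\<^sub>2\<close> and \<open>e\<^sub>3\<close> of \<open>1, x, - 1 - x\<close>; both are nonzero for such \<open>x\<close>.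
\<close>

definition nontrivial :: "complex \<Rightarrow> bool" where
  "nontrivial x \<longleftrightarrow> x \<noteq> 0 \<and> x \<noteq> - 1 \<and> x ^ 2 + x + 1 \<noteq> 0"

lemma conjugate_power_sum_zero: "conjugate x x' \<Longrightarrow> power_sum_zero n x \<longleftrightarrow> power_sum_zero n x'"
  unfolding power_sum_zero_def
  by (rule conjugateD[of x x' "\<lambda>x. 1 + x ^ n + (- 1 - x) ^ n"]) (auto intro!: rat_poly_intros)

lemma conjugate_nontrivial: "conjugate x x' \<Longrightarrow> nontrivial x \<longleftrightarrow> nontrivial x'"
proof -
  assume "conjugate x x'"
  then have "x = 0 \<longleftrightarrow> x' = 0" "x + 1 = 0 \<longleftrightarrow> x' + 1 = 0" "x ^ 2 + x + 1 = 0 \<longleftrightarrow> x' ^ 2 + x' + 1 = 0"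
    using conjugateD[of x x' "\<lambda>x. x"] conjugateD[of x x' "\<lambda>x. x + 1"] conjugateD[of x x' "\<lambda>x. x ^ 2 + x + 1"]
    by (simp_all add: rat_poly_intros)
  then show ?thesis
    by (simp add: nontrivial_def add_eq_0_iff2)
qed

lemma (in valuation_ring) dominant_element:
  assumes "x1 \<noteq> 0" "x2 \<noteq> 0" "x3 \<noteq> 0"
  shows "\<exists>t\<in>{x1, x2, x3}. x1 / t \<in> B \<and> x2 / t \<in> B \<and> x3 / t \<in> B"
proof -
  have tot: "x / y \<in> B \<or> y / x \<in> B" if "x \<noteq> 0" "y \<noteq> 0" for x y
    using total[of "x / y"] that by auto
  have trans: "x / z \<in> B" if "x / y \<in> B" "y / z \<in> B" "y \<noteq> 0" for x y z
    using mult_mem[OF that(1,2)] that(3) by simp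
  have refl: "x / x \<in> B" for x
    by (cases "x = 0") auto
  consider "x2 / x1 \<in> B" "x3 / x1 \<in> B" | "x1 / x2 \<in> B" "x3 / x2 \<in> B" | "x1 / x3 \<in> B" "x2 / x3 \<in> B"
    using tot[of x1 x2] tot[of x2 x3] tot[of x1 x3] trans[of x3 x2 x1] trans[of x3 x1 x2] trans[of x2 x3 x1] trans[of x1 x2 x3] assms
    by blast
  then show ?thesis
    using refl by cases blast+
qed

text \<open>
  Two vectors orthogonal to \<open>V\<close> have a cross product parallel to \<open>V\<close>.
\<close>

lemma cross_product_cyclic:
  fixes V1 :: complex
  assumes "V1 * M1 + V2 * M2 + V3 * M3 = 0" "V1 * W1 + V2 * W2 + V3 * W3 = 0" "V1 \<noteq> 0"
  shows "V2 * (M2 * W3 - M3 * W2) = V1 * (M3 * W1 - M1 * W3)"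
    and "V3 * (M2 * W3 - M3 * W2) = V1 * (M1 * W2 - M2 * W1)"
  using assms(1,2) by algebra+

lemma integral_formD:
  assumes "integral_form e K w"
  shows "w (t * u) (t * v) = t ^ e * w u v"
    and "complex_subring B \<Longrightarrow> u \<in> B \<Longrightarrow> v \<in> B \<Longrightarrow> w u v \<in> B"
    and "norm u \<le> 1 \<Longrightarrow> norm v \<le> 1 \<Longrightarrow> norm (w u v) \<le> K"
    and "rat_poly_fun F \<Longrightarrow> rat_poly_fun G \<Longrightarrow> rat_poly_fun (\<lambda>z. w (F z) (G z))"
  using assms by (simp_all add: integral_form_def)

text \<open>
  The first component of the cross product of the vectors \<open>y\<^sub>i\<^sup>m\<close> and \<open>w\<^sub>i\<close>.
\<close>

definition remainder_at :: "nat \<Rightarrow> nat \<Rightarrow> (complex \<Rightarrow> complex \<Rightarrow> complex) \<Rightarrow> (complex \<Rightarrow> complex \<Rightarrow> complex)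
    \<Rightarrow> complex \<Rightarrow> complex \<Rightarrow> complex \<Rightarrow> complex" where
  "remainder_at b m w2 w3 y1 y2 y3 = y2 ^ m * w3 (y2 ^ b) (y1 ^ b) - y3 ^ m * w2 (y1 ^ b) (y3 ^ b)"

lemma remainder_at_scale:
  assumes "integral_form e K w2" "integral_form e K w3"
  shows "remainder_at b m w2 w3 (t * y1) (t * y2) (t * y3) = t ^ (m + e * b) * remainder_at b m w2 w3 y1 y2 y3"
proof -
  have "remainder_at b m w2 w3 (t * y1) (t * y2) (t * y3)
     = t ^ m * y2 ^ m * ((t ^ b) ^ e * w3 (y2 ^ b) (y1 ^ b)) - t ^ m * y3 ^ m * ((t ^ b) ^ e * w2 (y1 ^ b) (y3 ^ b))"
    unfolding remainder_at_def power_mult_distrib integral_formD(1)[OF assms(1)] integral_formD(1)[OF assms(2)] ..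
  also have "\<dots> = t ^ (m + e * b) * remainder_at b m w2 w3 y1 y2 y3"
    by (simp add: remainder_at_def power_add power_mult mult.commute[of e b] right_diff_distrib mult_ac)
  finally show ?thesis .
qed

lemma remainder_at_mem:
  assumes "integral_form e K w2" "integral_form e K w3" "complex_subring B" "y1 \<in> B" "y2 \<in> B" "y3 \<in> B"
  shows "remainder_at b m w2 w3 y1 y2 y3 \<in> B"
proof -
  interpret complex_subring B by fact
  have "w2 (y1 ^ b) (y3 ^ b) \<in> B" "w3 (y2 ^ b) (y1 ^ b) \<in> B"
    using assms by (auto intro!: integral_formD(2)[OF assms(1)] integral_formD(2)[OF assms(2)])
  then show ?thesis
    unfolding remainder_at_def using assms by blast
qed

lemma remainder_at_norm:
  assumes "integral_form e K w2" "integral_form e K w3" "norm y1 \<le> 1" "norm y2 \<le> 1" "norm y3 \<le> 1"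
  shows "norm (remainder_at b m w2 w3 y1 y2 y3) \<le> 2 * K"
proof -
  have le: "norm (y ^ k) \<le> 1" if "norm y \<le> 1" for y :: complex and k
    using that by (simp add: norm_power power_le_one)
  have "norm (w2 (y1 ^ b) (y3 ^ b)) \<le> K" "norm (w3 (y2 ^ b) (y1 ^ b)) \<le> K"
    using assms le by (auto intro!: integral_formD(3)[OF assms(1)] integral_formD(3)[OF assms(2)])
  then have "norm (y2 ^ m) * norm (w3 (y2 ^ b) (y1 ^ b)) \<le> 1 * K" "norm (y3 ^ m) * norm (w2 (y1 ^ b) (y3 ^ b)) \<le> 1 * K"
    using assms le by (intro mult_mono; simp)+
  then show ?thesis
    unfolding remainder_at_def by (intro order.trans[OF norm_triangle_ineq4]) (simp add: norm_mult)
qed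

text \<open>
  The factor \<open>lam\<close> between the cross product and the vector of the \<open>N b\<close>-th powers can be computed from any of the
  three components. Choosing the one of \<open>t\<close> and dividing everything by \<open>t\<close> shows that \<open>lam\<close> behaves like a form of
  degree \<open>- k\<close>: if \<open>t\<close> dominates the triple, with respect to a valuation or to the modulus, then \<open>lam * t ^ k\<close> is integral
  or small.
\<close>

lemma remainder_scaled:
  assumes forms: "integral_form e K w1" "integral_form e K w2" "integral_form e K w3" and syz: "syzygy N w1 w2 w3"
    and x: "x1 \<noteq> 0" "x2 \<noteq> 0" "x3 \<noteq> (0 :: complex)" and sums: "x1 ^ b + x2 ^ b + x3 ^ b = 0" "x1 ^ c + x2 ^ c + x3 ^ c = 0"
    and c: "c = N * b + m" and k: "N * b = e * b + m + k" and t: "t \<in> {x1, x2, x3}"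
  defines "lam \<equiv> remainder_at b m w2 w3 x1 x2 x3 / x1 ^ (N * b)"
  obtains s where "lam * t ^ k = s"
    and "\<And>B. complex_subring B \<Longrightarrow> x1 / t \<in> B \<Longrightarrow> x2 / t \<in> B \<Longrightarrow> x3 / t \<in> B \<Longrightarrow> s \<in> B"
    and "norm (x1 / t) \<le> 1 \<Longrightarrow> norm (x2 / t) \<le> 1 \<Longrightarrow> norm (x3 / t) \<le> 1 \<Longrightarrow> norm s \<le> 2 * K"
proof -
  have V: "(x1 ^ b) ^ N * x1 ^ m + (x2 ^ b) ^ N * x2 ^ m + (x3 ^ b) ^ N * x3 ^ m = 0"
    using sums(2) unfolding c by (simp add: power_add power_mult mult.commute[of N])
  have W: "(x1 ^ b) ^ N * w1 (x3 ^ b) (x2 ^ b) + (x2 ^ b) ^ N * w2 (x1 ^ b) (x3 ^ b) + (x3 ^ b) ^ N * w3 (x2 ^ b) (x1 ^ b) = 0"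
    using syz sums(1) x unfolding syzygy_def by simp
  have V1: "(x1 ^ b) ^ N \<noteq> 0" using x by simp
  have pw: "y ^ (N * b) = (y ^ b) ^ N" for y :: complex
    by (simp add: power_mult mult.commute[of N])
  have lam2: "lam = remainder_at b m w3 w1 x2 x3 x1 / x2 ^ (N * b)"
    using cross_product_cyclic(1)[OF V W V1] x unfolding lam_def remainder_at_def pw by (simp add: field_simps)
  have lam3: "lam = remainder_at b m w1 w2 x3 x1 x2 / x3 ^ (N * b)"
    using cross_product_cyclic(2)[OF V W V1] x unfolding lam_def remainder_at_def pw by (simp add: field_simps)
  note result = that
  have key: thesis
    if "lam = remainder_at b m v2 v3 y1 y2 y3 / y1 ^ (N * b)" "integral_form e K v2" "integral_form e K v3"
      "t = y1" "t \<noteq> 0" "{y1, y2, y3} = {x1, x2, x3}" for v2 v3 y1 y2 y3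
  proof (rule result)
    let ?s = "remainder_at b m v2 v3 (y1 / t) (y2 / t) (y3 / t)"
    have "remainder_at b m v2 v3 (t * (y1 / t)) (t * (y2 / t)) (t * (y3 / t)) = t ^ (m + e * b) * ?s"
      using remainder_at_scale[OF that(2,3)] .
    then have "lam = t ^ (m + e * b) * ?s / t ^ (N * b)"
      using that(1,4,5) by simp
    also have "t ^ (N * b) = t ^ (m + e * b) * t ^ k"
      unfolding k by (simp add: power_add)
    finally show "lam * t ^ k = ?s"
      using \<open>t \<noteq> 0\<close> by simp
    show "?s \<in> B" if "complex_subring B" "x1 / t \<in> B" "x2 / t \<in> B" "x3 / t \<in> B" for B
      by (rule remainder_at_mem[OF \<open>integral_form e K v2\<close> \<open>integral_form e K v3\<close> that(1)])
        (use that \<open>{y1, y2, y3} = {x1, x2, x3}\<close> in \<open>auto simp: set_eq_iff\<close>)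
    show "norm ?s \<le> 2 * K" if "norm (x1 / t) \<le> 1" "norm (x2 / t) \<le> 1" "norm (x3 / t) \<le> 1"
      by (rule remainder_at_norm[OF \<open>integral_form e K v2\<close> \<open>integral_form e K v3\<close>])
        (use that \<open>{y1, y2, y3} = {x1, x2, x3}\<close> in \<open>auto simp: set_eq_iff\<close>)
  qed
  show thesis
    using t key[of w2 w3 x1 x2 x3] key[of w3 w1 x2 x3 x1] key[of w1 w2 x3 x1 x2] lam2 lam3 forms x
    by (auto simp: lam_def insert_commute)
qed

lemma valuation_ring_is_subring: "valuation_ring B p \<Longrightarrow> complex_subring B"
  by (simp add: valuation_ring_def)

text \<open>
  The number to which the product formula is applied is \<open>F x\<close>, where \<open>F\<close> is a product of powers of the remainder and
  of the symmetric functions of \<open>1, z, - 1 - z\<close>, homogeneous of degree \<open>0\<close>. At each place it can be evaluated on the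
  triple divided by its dominant element \<open>t\<close>; there it is integral, or bounded by the quantity in the last
  hypothesis.
\<close>

theorem no_small_remainder:
  assumes x: "power_sum_zero b x" "power_sum_zero c x" "nontrivial x" and b: "b \<ge> 2"
    and forms: "integral_form e K w1" "integral_form e K w2" "integral_form e K w3" and syz: "syzygy N w1 w2 w3"
    and c: "c = N * b + m" and k: "N * b = e * b + m + k"
    and nz: "remainder_at b m w2 w3 1 x (- 1 - x) \<noteq> 0"
    and bound: "\<And>x'. conjugate x x' \<Longrightarrow>
      norm (x' ^ 2 + x' + 1) ^ i * norm (x' * (1 + x')) ^ j
        \<le> \<rho> * Max {1, norm x', norm (1 + x')} ^ (2 * i + 3 * j)"
    and small: "(2 * K) ^ (2 * i + 3 * j) * \<rho> ^ k < 1"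
  shows False
proof -
  define A where "A = 2 * i + 3 * j"
  define F where "F z = remainder_at b m w2 w3 1 z (- 1 - z) ^ A * ((z ^ 2 + z + 1) ^ i * (z * (1 + z)) ^ j) ^ k" for z
  have "rat_poly_fun (\<lambda>z. w3 (z ^ b) (1 ^ b))" "rat_poly_fun (\<lambda>z. w2 (1 ^ b) ((- 1 - z) ^ b))"
    by (intro integral_formD(4)[OF forms(3)] integral_formD(4)[OF forms(2)] rat_poly_intros)+
  then have F: "rat_poly_fun F"
    unfolding F_def remainder_at_def by (intro rat_poly_intros)
  have "F x \<noteq> 0"
    using nz x(3) by (simp add: F_def nontrivial_def add_eq_0_iff2 add.commute[of 1])
  \<comment> \<open>Evaluation on the triple divided by its element \<open>t\<close>: the powers of \<open>t\<close> in the two factors cancel.\<close>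
  have scaled: "\<exists>s r. F x' = s ^ A * r ^ k
      \<and> (\<forall>B. complex_subring B \<longrightarrow> 1 / t \<in> B \<longrightarrow> x' / t \<in> B \<longrightarrow> (- 1 - x') / t \<in> B \<longrightarrow> s \<in> B \<and> r \<in> B)
      \<and> (norm (1 / t) \<le> 1 \<longrightarrow> norm (x' / t) \<le> 1 \<longrightarrow> norm ((- 1 - x') / t) \<le> 1 \<longrightarrow> norm s \<le> 2 * K)
      \<and> r = (x' ^ 2 + x' + 1) ^ i * (x' * (1 + x')) ^ j / t ^ A"
    if x': "conjugate x x'" and t: "t \<in> {1, x', - 1 - x'}" for x' t
  proof -
    have p: "power_sum_zero b x'" "power_sum_zero c x'" "nontrivial x'"
      using x x' conjugate_power_sum_zero conjugate_nontrivial by blast+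
    have x'0: "x' \<noteq> 0" "- 1 - x' \<noteq> 0"
      using p(3) by (auto simp: nontrivial_def algebra_simps)
    then have t0: "t \<noteq> 0" using t by auto
    have sums: "1 ^ b + x' ^ b + (- 1 - x') ^ b = 0" "1 ^ c + x' ^ c + (- 1 - x') ^ c = 0"
      using p by (simp_all add: power_sum_zero_def)
    obtain s where s: "remainder_at b m w2 w3 1 x' (- 1 - x') / 1 ^ (N * b) * t ^ k = s"
      "\<And>B. complex_subring B \<Longrightarrow> 1 / t \<in> B \<Longrightarrow> x' / t \<in> B \<Longrightarrow> (- 1 - x') / t \<in> B \<Longrightarrow> s \<in> B"
      "norm (1 / t) \<le> 1 \<Longrightarrow> norm (x' / t) \<le> 1 \<Longrightarrow> norm ((- 1 - x') / t) \<le> 1 \<Longrightarrow> norm s \<le> 2 * K"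
      using remainder_scaled[OF forms syz _ x'0 sums c k t] by (metis one_neq_zero)
    define r where "r = (x' ^ 2 + x' + 1) ^ i * (x' * (1 + x')) ^ j / t ^ A"
    have "F x' = s ^ A * r ^ k"
    proof -
      have "s ^ A * r ^ k = (remainder_at b m w2 w3 1 x' (- 1 - x')) ^ A * (t ^ k) ^ A
          * (((x' ^ 2 + x' + 1) ^ i * (x' * (1 + x')) ^ j) ^ k / (t ^ A) ^ k)"
        unfolding s(1)[symmetric] r_def by (simp add: power_mult_distrib power_divide)
      also have "(t ^ k) ^ A = (t ^ A) ^ k"
        by (simp add: mult.commute flip: power_mult)
      finally show ?thesis
        using t0 by (simp add: F_def)
    qed
    moreover have "r \<in> B" if B: "complex_subring B" "1 / t \<in> B" "x' / t \<in> B" "(- 1 - x') / t \<in> B" for B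
    proof -
      interpret complex_subring B by fact
      define e2 where "e2 = x' / t * (x' / t) + x' / t * (1 / t) + 1 / t * (1 / t)"
      define e3 where "e3 = - (1 / t * (x' / t) * ((- 1 - x') / t))"
      have "r = e2 ^ i * e3 ^ j"
      proof -
        have "x' ^ 2 + x' + 1 = t ^ 2 * e2" "x' * (1 + x') = t ^ 3 * e3"
          using t0 by (simp_all add: e2_def e3_def field_simps power2_eq_square power3_eq_cube)
        then show ?thesis
          unfolding r_def A_def using t0 by (simp add: power_mult_distrib power_add power_mult)
      qed
      moreover have "e2 \<in> B" "e3 \<in> B"
        unfolding e2_def e3_def by (intro add_mem mult_mem uminus_mem B)+
      ultimately show ?thesis by blast
    qed
    ultimately show ?thesis
      using s(2,3) r_def by blast
  qed
  obtain y where y: "1 + y ^ b + (- 1 - y) ^ b \<noteq> (0 :: complex)"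
    using power_sum_not_identically_zero[OF b] by blast
  have "\<exists>x'. conjugate x x' \<and> norm (F x') \<ge> norm (1 :: complex)"
  proof (rule conjugate_norm_ge[where G = "\<lambda>_. 1" and P = "\<lambda>x. 1 + x ^ b + (- 1 - x) ^ b", OF _ _ y])
    show "rat_poly_fun (\<lambda>x. 1 + x ^ b + (- 1 - x) ^ b)"
      by (intro rat_poly_intros)
    show "1 + x ^ b + (- 1 - x) ^ b = 0"
      using x by (simp add: power_sum_zero_def)
    show "rat_poly_fun F" "F x \<noteq> 0" "rat_poly_fun (\<lambda>_. 1)" "(1 :: complex) \<noteq> 0"
      using F \<open>F x \<noteq> 0\<close> rat_poly_fun_one by auto
  next
    fix x' B p assume x': "conjugate x x'" and B: "valuation_ring B p"
    interpret valuation_ring B p by fact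
    have "nontrivial x'"
      using x(3) x' conjugate_nontrivial by blast
    then have "x' \<noteq> 0" "- 1 - x' \<noteq> 0"
      by (auto simp: nontrivial_def algebra_simps)
    then obtain t where t: "t \<in> {1, x', - 1 - x'}" "1 / t \<in> B" "x' / t \<in> B" "(- 1 - x') / t \<in> B"
      using dominant_element[of 1 x' "- 1 - x'"] by (metis one_neq_zero)
    obtain s r where "F x' = s ^ A * r ^ k" "s \<in> B" "r \<in> B"
      using scaled[OF x' t(1)] t valuation_ring_is_subring[OF B] by blast
    then show "F x' / 1 \<in> B"
      by auto
  qed
  then obtain x' where x': "conjugate x x'" "norm (F x') \<ge> 1" by auto
  have "nontrivial x'"
    using x(3) x' conjugate_nontrivial by blast
  define M where "M = Max {1, norm x', norm (1 + x')}"
  have "M \<in> {1, norm x', norm (1 + x')}"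
    unfolding M_def by (rule Max_in) auto
  then obtain t where t: "t \<in> {1, x', - 1 - x'}" "norm t = M"
    by (metis insertCI insertE norm_minus_cancel norm_one minus_diff_minus singletonD uminus_add_conv_diff add_uminus_conv_diff minus_add_distrib)
  have M: "M \<ge> 1" "norm x' \<le> M" "norm (1 + x') \<le> M"
    unfolding M_def by (auto intro: Max_ge)
  have "norm (- 1 - x') = norm (1 + x')"
    using norm_minus_cancel[of "1 + x'"] by simp
  then have "norm (1 / t) \<le> 1" "norm (x' / t) \<le> 1" "norm ((- 1 - x') / t) \<le> 1"
    using M by (simp_all add: norm_divide t(2) divide_le_eq_1)
  then obtain s r where sr: "F x' = s ^ A * r ^ k" "norm s \<le> 2 * K"
    "r = (x' ^ 2 + x' + 1) ^ i * (x' * (1 + x')) ^ j / t ^ A"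
    using scaled[OF x'(1) t(1)] by blast
  have "norm r \<le> \<rho>"
    using bound[OF x'(1)] M unfolding sr(3) M_def[symmetric] A_def[symmetric]
    by (simp add: norm_divide norm_mult norm_power t(2) pos_divide_le_eq power_mult_distrib)
  then have "norm (F x') \<le> (2 * K) ^ A * \<rho> ^ k"
    unfolding sr(1) norm_mult norm_power using sr(2) order.trans[OF norm_ge_zero sr(2)]
    by (intro mult_mono power_mono zero_le_power) auto
  then show False
    using x'(2) small unfolding A_def by simp
qed

section \<open>Archimedean estimates\<close>

text \<open>
  For numbers with sum \<open>0\<close>, the modulus of \<open>e\<^sub>2\<close> is a function of the three moduli alone.
\<close>

lemma norm_quadratic_squared:
  fixes z :: complex
  shows "norm (z ^ 2 + z + 1) ^ 2 = 1 + norm z ^ 4 + norm (1 + z) ^ 4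
     - norm z ^ 2 - norm (1 + z) ^ 2 - norm z ^ 2 * norm (1 + z) ^ 2"
proof -
  obtain a b where z: "z = Complex a b" by (cases z)
  have 1: "norm z ^ 2 = a ^ 2 + b ^ 2" "norm (1 + z) ^ 2 = (1 + a) ^ 2 + b ^ 2"
    "norm (z ^ 2 + z + 1) ^ 2 = (a ^ 2 - b ^ 2 + a + 1) ^ 2 + (2 * a * b + b) ^ 2"
    by (simp_all add: cmod_power2 z Re_power2 Im_power2)
  have 2: "norm z ^ 4 = (norm z ^ 2) ^ 2" "norm (1 + z) ^ 4 = (norm (1 + z) ^ 2) ^ 2"
    by simp_all
  show ?thesis
    unfolding 2 1 by (simp add: power2_eq_square algebra_simps)
qed

lemma quadratic_form_le:
  fixes T p q :: real
  assumes "T \<ge> p" "p \<ge> q"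
  shows "T ^ 2 + p ^ 2 + q ^ 2 - T * p - T * q - p * q \<le> (T - q) ^ 2"
proof -
  have "0 \<le> (T - p) * (p - q)"
    using assms by simp
  then show ?thesis
    by (simp add: power2_eq_square algebra_simps)
qed

lemma quadratic_times_product_le:
  fixes T p q :: real
  assumes "T \<ge> p" "p \<ge> q" "q \<ge> 0"
  shows "(T ^ 2 + p ^ 2 + q ^ 2 - T * p - T * q - p * q) * (T * p * q) \<le> 4 / 27 * T ^ 5"
proof -
  have "(T ^ 2 + p ^ 2 + q ^ 2 - T * p - T * q - p * q) * (T * p * q) \<le> (T - q) ^ 2 * (T * T * q)"
    using assms quadratic_form_le[OF assms(1,2)] by (intro mult_mono mult_left_mono mult_right_mono) auto
  also have "\<dots> = T ^ 2 * (q * (T - q) ^ 2)"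
    by (simp add: power2_eq_square)
  also have "\<dots> \<le> T ^ 2 * (4 / 27 * T ^ 3)"
  proof (intro mult_left_mono)
    have "0 \<le> (T - 3 * q) ^ 2 * (4 * T - 3 * q)"
      using assms by simp
    also have "\<dots> = 4 * T ^ 3 - 27 * (q * (T - q) ^ 2)"
      by (simp add: power2_eq_square power3_eq_cube algebra_simps)
    finally show "q * (T - q) ^ 2 \<le> 4 / 27 * T ^ 3"
      by simp
  qed simp
  also have "\<dots> = 4 / 27 * T ^ 5"
    by (simp add: power_add[symmetric])
  finally show ?thesis .
qed

text \<open>
  In terms of the squares \<open>T \<ge> p \<ge> q\<close> of the three moduli, the square of the left-hand side is at most
  \<open>T\<^sup>2 q (T - q)\<^sup>2\<close>, which is largest for \<open>q = T / 3\<close>. The exponents are spelled out to fit the general form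
  of such a bound in \<open>no_small_remainder\<close>.
\<close>

theorem invariants_product_le:
  fixes z :: complex
  shows "norm (z ^ 2 + z + 1) ^ 1 * norm (z * (1 + z)) ^ 1 \<le> sqrt (4 / 27) * Max {1, norm z, norm (1 + z)} ^ (2 * 1 + 3 * 1)"
proof -
  define s r where "s = norm z ^ 2" and "r = norm (1 + z) ^ 2"
  define M where "M = Max {1, norm z, norm (1 + z)}"
  have M: "M \<ge> 1" "norm z \<le> M" "norm (1 + z) \<le> M"
    unfolding M_def by (auto intro: Max_ge)
  have nn: "s \<ge> 0" "r \<ge> 0" by (auto simp: s_def r_def)
  have Q: "norm (z ^ 2 + z + 1) ^ 2 = 1 ^ 2 + s ^ 2 + r ^ 2 - 1 * s - 1 * r - s * r"
    unfolding norm_quadratic_squared s_def r_def by simp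
  have "norm (z ^ 2 + z + 1) ^ 2 * (1 * s * r) \<le> 4 / 27 * (M ^ 2) ^ 5"
  proof -
    have le: "1 \<le> M ^ 2" "s \<le> M ^ 2" "r \<le> M ^ 2"
      using M by (auto simp: s_def r_def intro: power_mono)
    let ?S = "{(1, s, r), (1, r, s), (s, 1, r), (s, r, 1), (r, 1, s), (r, s, 1)}"
    have "norm (z ^ 2 + z + 1) ^ 2 * (1 * s * r) \<le> 4 / 27 * T ^ 5"
      if "(T, p, q) \<in> ?S" "T \<ge> p" "p \<ge> q" for T p q
    proof -
      have "norm (z ^ 2 + z + 1) ^ 2 * (1 * s * r)
          = (T ^ 2 + p ^ 2 + q ^ 2 - T * p - T * q - p * q) * (T * p * q)"
        unfolding Q using that(1) by (auto simp: algebra_simps)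
      then show ?thesis
        using quadratic_times_product_le[OF that(2,3)] that(1) nn by auto
    qed
    moreover have "4 / 27 * T ^ 5 \<le> 4 / 27 * (M ^ 2) ^ 5" if "0 \<le> T" "T \<le> M ^ 2" for T
      using that by (intro mult_left_mono power_mono) auto
    ultimately have *: "norm (z ^ 2 + z + 1) ^ 2 * (1 * s * r) \<le> 4 / 27 * (M ^ 2) ^ 5"
      if "(T, p, q) \<in> ?S" "T \<ge> p" "p \<ge> q"
        "0 \<le> T" "T \<le> M ^ 2" for T p q
      using that by (meson order.trans)
    consider "1 \<ge> s" "s \<ge> r" | "1 \<ge> r" "r \<ge> s" | "s \<ge> 1" "1 \<ge> r" | "s \<ge> r" "r \<ge> 1" | "r \<ge> 1" "1 \<ge> s" | "r \<ge> s" "s \<ge> 1"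
      by linarith
    then show ?thesis
      using *[of 1 s r] *[of 1 r s] *[of s 1 r] *[of s r 1] *[of r 1 s] *[of r s 1] le nn by cases auto
  qed
  also have "\<dots> = (sqrt (4 / 27) * M ^ 5) ^ 2"
    by (simp add: power_mult_distrib flip: power_mult)
  finally have "(norm (z ^ 2 + z + 1) * norm (z * (1 + z))) ^ 2 \<le> (sqrt (4 / 27) * M ^ 5) ^ 2"
    by (simp add: power_mult_distrib norm_mult s_def r_def)
  then have "norm (z ^ 2 + z + 1) * norm (z * (1 + z)) \<le> sqrt (4 / 27) * M ^ 5"
    by (rule power2_le_imp_le) (use M in auto)
  then show ?thesis
    by (simp add: M_def)
qed

text \<open>
  This is the approximation argument for \<open>n = 0\<close>, where the relation is \<open>X\<^sub>1 + X\<^sub>2 + X\<^sub>3 = 0\<close> itself and the remainder is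
  \<open>x\<^sup>m - (- 1 - x)\<^sup>m\<close> with \<open>m = c - b\<close>. For \<open>k = 2 b - c \<ge> 4\<close> it is too small, since \<open>2\<^sup>5 (4 / 27)\<^sup>2 < 1\<close>.
\<close>

theorem second_exponent_lower_bound:
  assumes x: "power_sum_zero b x" "power_sum_zero c x" "nontrivial x" and b: "b \<ge> 2" "b < c"
  shows "2 * b \<le> c + 3"
proof (rule ccontr)
  assume "\<not> 2 * b \<le> c + 3"
  define m k where "m = c - b" and "k = 2 * b - c"
  have mk: "m > 0" "c = 1 * b + m" "1 * b = 0 * b + m + k" "k \<ge> 4"
    using b \<open>\<not> 2 * b \<le> c + 3\<close> by (auto simp: m_def k_def)
  let ?w = "\<lambda>u v :: complex. 1 :: complex"
  have "integral_form 0 1 ?w"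
    unfolding integral_form_def using complex_subring.one_mem rat_poly_fun_one by auto
  moreover have "syzygy 1 ?w ?w ?w"
    by (simp add: syzygy_def)
  moreover have "remainder_at b m ?w ?w 1 x (- 1 - x) \<noteq> 0"
  proof
    assume "remainder_at b m ?w ?w 1 x (- 1 - x) = 0"
    then have eq: "x ^ m = (- 1 - x) ^ m"
      by (simp add: remainder_at_def)
    have "1 + x ^ b * x ^ m + (- 1 - x) ^ b * (- 1 - x) ^ m = 0"
      using x(2) unfolding power_sum_zero_def mk(2) by (simp add: power_add)
    then have "1 + (x ^ b + (- 1 - x) ^ b) * x ^ m = 0"
      by (simp add: eq algebra_simps)
    moreover have "x ^ b + (- 1 - x) ^ b = - 1"
      using x(1) unfolding power_sum_zero_def by (simp add: eq_neg_iff_add_eq_0 add_ac)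
    ultimately have one: "x ^ m = 1" "(- 1 - x) ^ m = 1"
      using eq by simp_all
    \<comment> \<open>Three numbers of equal modulus and sum \<open>0\<close> form an equilateral triangle.\<close>
    have "norm x = 1" "norm (- 1 - x) = 1"
      using one mk(1) by (auto dest!: power_eq_1_iff)
    moreover have "norm (- 1 - x) = norm (1 + x)"
      using norm_minus_cancel[of "1 + x"] by simp
    ultimately have "norm (x ^ 2 + x + 1) ^ 2 = 0"
      unfolding norm_quadratic_squared by simp
    then show False
      using x(3) by (simp add: nontrivial_def)
  qed
  moreover have "(2 * 1) ^ (2 * 1 + 3 * 1) * sqrt (4 / 27) ^ k < 1"
  proof -
    have "sqrt (4 / 27) ^ k \<le> sqrt (4 / 27 :: real) ^ 4"
      using mk(4) by (intro power_decreasing) auto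
    also have "\<dots> = (sqrt (4 / 27) ^ 2) ^ 2"
      by (subst power_mult[symmetric]) simp
    also have "\<dots> = (4 / 27) ^ 2"
      by (subst real_sqrt_pow2) auto
    finally show ?thesis
      by (simp add: power2_eq_square)
  qed
  ultimately show False
    using no_small_remainder[OF x b(1) _ _ _ _ mk(2,3), of 1 ?w ?w ?w 1 1 "sqrt (4 / 27)"] invariants_product_le
    by blast
qed

text \<open>
  The ratio of consecutive binomial coefficients is at most its limit \<open>27 / 4\<close>.
\<close>

lemma double_binomial_le:
  assumes "n \<ge> 2"
  shows "2 * real ((3 * n + 1) choose n) \<le> (27 / 4) ^ n"
  using assms
proof (induction n rule: dec_induct)
  case base
  have "(7 :: nat) choose 2 = 21" by (simp add: choose_two)
  then show ?case by (simp add: power2_eq_square)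
next
  case (step n)
  have f: "real ((3 * n + 1) choose n) = fact (3 * n + 1) / (fact n * fact (2 * n + 1))"
  proof -
    have "3 * n + 1 - n = 2 * n + 1" by auto
    then show ?thesis
      using binomial_fact[of n "3 * n + 1", where 'a = real] by simp
  qed
  have g: "real ((3 * Suc n + 1) choose Suc n) = fact (3 * n + 4) / (fact (Suc n) * fact (2 * n + 3))"
  proof -
    have "3 * Suc n + 1 - Suc n = 2 * n + 3" "3 * Suc n + 1 = 3 * n + 4" by auto
    then show ?thesis
      using binomial_fact[of "Suc n" "3 * Suc n + 1", where 'a = real] by (simp add: add.commute)
  qed
  have fs: "fact (3 * n + 4) = (3 * real n + 4) * (3 * real n + 3) * (3 * real n + 2) * fact (3 * n + 1)"
    "fact (2 * n + 3) = (2 * real n + 3) * (2 * real n + 2) * fact (2 * n + 1)"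
    "fact (Suc n) = (real n + 1) * fact n"
  proof -
    have "3 * n + 4 = Suc (Suc (Suc (3 * n + 1)))" "2 * n + 3 = Suc (Suc (2 * n + 1))" by auto
    then show "fact (3 * n + 4) = (3 * real n + 4) * (3 * real n + 3) * (3 * real n + 2) * fact (3 * n + 1)"
      "fact (2 * n + 3) = (2 * real n + 3) * (2 * real n + 2) * fact (2 * n + 1)"
      by (simp_all only: fact_Suc) (simp_all add: algebra_simps)
  qed (simp add: algebra_simps)
  define c where "c = real ((3 * n + 1) choose n)"
  have "real ((3 * Suc n + 1) choose Suc n) = c * ((3 * real n + 4) * (3 * real n + 3) * (3 * real n + 2)
      / ((real n + 1) * ((2 * real n + 3) * (2 * real n + 2))))"
  proof -
    have "(P * F) / ((Q * G) * (R * H)) = F / (G * H) * (P / (Q * R))" for P Q R F G H :: real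
      by (simp add: mult_ac)
    then show ?thesis
      unfolding g c_def f fs .
  qed
  also have "(3 * real n + 4) * (3 * real n + 3) * (3 * real n + 2)
      / ((real n + 1) * ((2 * real n + 3) * (2 * real n + 2))) \<le> 27 / 4"
    by (simp add: divide_le_eq algebra_simps add_pos_nonneg)
  finally have "real ((3 * Suc n + 1) choose Suc n) \<le> c * (27 / 4)"
    by (simp add: c_def mult_left_mono)
  then show ?case
    using step.IH unfolding c_def by simp
qed

text \<open>
  At least one of the two independent relations has a nonzero remainder. Since \<open>m < 2 b\<close>, the exponents
  \<open>(n + 1) b - m\<close> and \<open>n b - m\<close> that belong to them are both larger than \<open>(n - 2) b\<close>.
\<close>

theorem second_exponent_excluded:
  assumes x: "power_sum_zero b x" "power_sum_zero c x" "nontrivial x" and b: "b \<ge> 2" and n: "n \<ge> 2"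
    and c: "(2 * n + 1) * b \<le> c" "c < (2 * n + 3) * b"
    and bound: "\<And>x'. conjugate x x' \<Longrightarrow>
      norm (x' ^ 2 + x' + 1) ^ i * norm (x' * (1 + x')) ^ j
        \<le> \<rho> * Max {1, norm x', norm (1 + x')} ^ (2 * i + 3 * j)"
    and \<rho>: "0 \<le> \<rho>" "\<rho> \<le> 1" "(27 / 4) ^ (n * (2 * i + 3 * j)) * \<rho> ^ ((n - 2) * b + 1) < 1"
  shows False
proof -
  define A where "A = 2 * i + 3 * j"
  define m where "m = c - (2 * n + 1) * b"
  define K where "K = real ((3 * n + 1) choose n)"
  have m: "c = (2 * n + 1) * b + m" "m < 2 * b"
    using c by (auto simp: m_def algebra_simps)
  have small: "(2 * K) ^ (2 * i + 3 * j) * \<rho> ^ k < 1" if "k \<ge> (n - 2) * b + 1" for k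
  proof -
    have "(2 * K) ^ A * \<rho> ^ k \<le> ((27 / 4) ^ n) ^ A * \<rho> ^ ((n - 2) * b + 1)"
      using double_binomial_le[OF n] that \<rho> unfolding K_def
      by (intro mult_mono power_mono power_decreasing) auto
    then show ?thesis
      using \<rho>(3) unfolding A_def by (simp add: power_mult)
  qed
  have x0: "x \<noteq> 0" "- 1 - x \<noteq> 0"
    using x(3) by (auto simp: nontrivial_def algebra_simps)
  have n0: "n > 0" using n by simp
  obtain w v1 v2 v3 where w: "integral_form n K w" "syzygy (2 * n + 1) w w w"
    and v: "integral_form (n + 1) K v1" "integral_form (n + 1) K v2" "integral_form (n + 1) K v3"
      "syzygy (2 * n + 1) v1 v2 v3"
    and ind: "\<And>X1 X2 X3 A B. X1 + X2 + X3 = 0 \<Longrightarrow> X1 \<noteq> 0 \<Longrightarrow> X2 \<noteq> 0 \<Longrightarrow> X3 \<noteq> 0 \<Longrightarrow>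
       A * w X1 X3 + B * w X2 X1 = 0 \<Longrightarrow> A * v2 X1 X3 + B * v3 X2 X1 = 0 \<Longrightarrow> A = 0 \<and> B = 0"
    by (rule independent_syzygies[OF n0, folded K_def]) (rule that, assumption+)
  have "\<not> (remainder_at b m w w 1 x (- 1 - x) = 0 \<and> remainder_at b m v2 v3 1 x (- 1 - x) = 0)"
  proof
    assume "remainder_at b m w w 1 x (- 1 - x) = 0 \<and> remainder_at b m v2 v3 1 x (- 1 - x) = 0"
    then have z: "- ((- 1 - x) ^ m) * w 1 ((- 1 - x) ^ b) + x ^ m * w (x ^ b) 1 = 0"
      "- ((- 1 - x) ^ m) * v2 1 ((- 1 - x) ^ b) + x ^ m * v3 (x ^ b) 1 = 0"
      unfolding remainder_at_def power_one by simp_all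
    have "1 + x ^ b + (- 1 - x) ^ b = 0" "(1 :: complex) \<noteq> 0" "x ^ b \<noteq> 0" "(- 1 - x) ^ b \<noteq> 0"
      using x(1) x0 by (simp_all add: power_sum_zero_def)
    from ind[OF this z] show False using x0 by simp
  qed
  moreover have "remainder_at b m w w 1 x (- 1 - x) = 0"
  proof (rule ccontr)
    assume nz: "remainder_at b m w w 1 x (- 1 - x) \<noteq> 0"
    have "m \<le> (n + 1) * b"
      using m(2) n mult_le_mono1[of 2 "n + 1" b] by linarith
    then have k: "(2 * n + 1) * b = n * b + m + ((n + 1) * b - m)"
      by (simp add: algebra_simps)
    have "(n - 2) * b + 1 \<le> (n + 1) * b - m"
      using m(2) n by (auto simp: algebra_simps dest!: le_Suc_ex)
    then show False
      using no_small_remainder[OF x b w(1,1,1,2) m(1) k nz bound small] by blast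
  qed
  moreover have "remainder_at b m v2 v3 1 x (- 1 - x) = 0"
  proof (rule ccontr)
    assume nz: "remainder_at b m v2 v3 1 x (- 1 - x) \<noteq> 0"
    have "m \<le> n * b"
      using m(2) n mult_le_mono1[of 2 n b] by linarith
    then have k: "(2 * n + 1) * b = (n + 1) * b + m + (n * b - m)"
      by (simp add: algebra_simps)
    have "(n - 2) * b + 1 \<le> n * b - m"
      using m(2) n by (auto simp: algebra_simps dest!: le_Suc_ex)
    then show False
      using no_small_remainder[OF x b v m(1) k nz bound small] by blast
  qed
  ultimately show False by blast
qed

section \<open>Non-archimedean estimates\<close>

lemma power_split_two: "n \<ge> 2 \<Longrightarrow> z ^ n = z * (z * z ^ (n - 2) :: complex)"
  by (cases n; cases "n - 1") auto

context valuation_ring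
begin

text \<open>
  Two valuations are compared by asking whether a quotient is of one of these two kinds. The number \<open>0\<close>
  counts as an element of positive valuation.
\<close>

definition val_unit :: "complex \<Rightarrow> bool" where
  "val_unit u \<longleftrightarrow> u \<noteq> 0 \<and> u \<in> B \<and> inverse u \<in> B"

definition val_pos :: "complex \<Rightarrow> bool" where
  "val_pos x \<longleftrightarrow> x \<in> B \<and> \<not> val_unit x"

lemma val_posD: "val_pos x \<Longrightarrow> x \<in> B"
  by (simp add: val_pos_def)

lemma val_unitD: "val_unit x \<Longrightarrow> x \<in> B" "val_unit x \<Longrightarrow> x \<noteq> 0"
  by (simp_all add: val_unit_def)

lemma val_unit_mult: "val_unit x \<Longrightarrow> val_unit y \<Longrightarrow> val_unit (x * y)"
  by (auto simp: val_unit_def)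

lemma val_unit_inverse: "val_unit x \<Longrightarrow> val_unit (inverse x)"
  by (auto simp: val_unit_def)

lemma val_unit_uminus: "val_unit x \<Longrightarrow> val_unit (- x)"
  by (auto simp: val_unit_def)

lemma val_unit_factor: "val_unit (x * y) \<Longrightarrow> x \<in> B \<Longrightarrow> y \<in> B \<Longrightarrow> val_unit x"
proof -
  assume u: "val_unit (x * y)" and xy: "x \<in> B" "y \<in> B"
  then have "x \<noteq> 0" "y \<noteq> 0" by (auto simp: val_unit_def)
  then have "inverse x = inverse (x * y) * y"
    by simp
  moreover have "inverse (x * y) * y \<in> B"
    using u xy by (intro mult_mem) (simp_all add: val_unit_def del: inverse_mult_distrib)
  ultimately have "inverse x \<in> B"
    by (simp only:)
  then show ?thesis
    using xy \<open>x \<noteq> 0\<close> by (simp add: val_unit_def)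
qed

lemma val_pos_mult: "val_pos x \<Longrightarrow> y \<in> B \<Longrightarrow> val_pos (x * y)" "val_pos x \<Longrightarrow> y \<in> B \<Longrightarrow> val_pos (y * x)"
  using val_unit_factor[of x y] by (auto simp: val_pos_def mult.commute)

lemma val_pos_add:
  assumes "val_pos x" "val_pos y"
  shows "val_pos (x + y)"
proof (cases "x = 0 \<or> y = 0")
  case False
  have step: "val_pos (a + b)" if "val_pos a" "b / a \<in> B" "a \<noteq> 0" for a b
  proof -
    have "a + b = a * (1 + b / a)"
      using that(3) by (simp add: field_simps)
    then show ?thesis
      using val_pos_mult(1)[OF that(1)] that(2) by auto
  qed
  have "y / x \<in> B \<or> x / y \<in> B"
    using total[of "y / x"] False by auto
  then show ?thesis
    using step[of x y] step[of y x] assms False by (auto simp: add.commute)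
qed (use assms in auto)

lemma val_pos_sum: "(\<And>i. i \<in> I \<Longrightarrow> val_pos (f i)) \<Longrightarrow> val_pos (sum f I)"
proof (induction I rule: infinite_finite_induct)
  case (insert i I)
  then show ?case using val_pos_add by simp
qed (simp_all add: val_pos_def val_unit_def)

lemma val_pos_uminus: "val_pos x \<Longrightarrow> val_pos (- x)"
  using val_pos_mult(1)[of x "- 1"] by (auto simp: uminus_mem)

lemma val_unit_one: "val_unit 1"
  by (simp add: val_unit_def)

lemma val_unit_add:
  assumes "val_unit u" "val_pos x"
  shows "val_unit (u + x)"
proof (rule ccontr)
  assume "\<not> val_unit (u + x)"
  then have "val_pos (u + x)"
    using assms by (auto simp: val_pos_def val_unit_def)
  then have "val_pos (u + x + - x)"
    using assms val_pos_uminus val_pos_add by blast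
  then show False
    using assms(1) by (simp add: val_pos_def)
qed

lemma val_pos_p: "val_pos (of_nat p)"
  using p_nonunit by (auto simp: val_pos_def val_unit_def)

lemma val_unit_of_nat:
  assumes "\<not> p dvd n"
  shows "val_unit (of_nat n)"
proof -
  have "coprime (int n) (int p)"
    using prime_imp_coprime[OF prime assms] by (simp add: coprime_commute)
  then obtain u v where "u * int n + v * int p = 1"
    by (metis bezout_int coprime_imp_gcd_eq_1)
  then have "of_int u * of_nat n + of_int v * of_nat p = (1 :: complex)"
    by (metis of_int_1 of_int_add of_int_mult of_int_of_nat_eq)
  then have "of_nat n * of_int u = (1 + of_nat p * of_int (- v) :: complex)"
    by (simp add: algebra_simps)
  moreover have "val_unit (1 + of_nat p * of_int (- v))"
    using val_unit_add[OF val_unit_one val_pos_mult(1)[OF val_pos_p]] by blast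
  ultimately show ?thesis
    by (metis val_unit_factor of_nat_mem of_int_mem)
qed

lemma of_nat_val_pos_imp_dvd: "val_pos (of_nat n) \<Longrightarrow> p dvd n"
  using val_unit_of_nat by (auto simp: val_pos_def)

lemma val_pos_power: "val_pos x \<Longrightarrow> n > 0 \<Longrightarrow> val_pos (x ^ n)"
  by (cases n) (auto intro: val_pos_mult val_posD)

lemma power_add_expand:
  assumes "a \<in> B" "d \<in> B"
  shows "\<exists>r\<in>B. (a + d) ^ n = a ^ n + d * r"
proof (induction n)
  case (Suc n)
  then obtain r where r: "r \<in> B" "(a + d) ^ n = a ^ n + d * r" by blast
  have "(a + d) ^ Suc n = a ^ Suc n + d * (a ^ n + (a + d) * r)"
    unfolding power_Suc r(2) by (simp add: algebra_simps)
  moreover have "a ^ n + (a + d) * r \<in> B"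
    using assms r by blast
  ultimately show ?case by blast
qed auto

lemma one_plus_power_expand:
  assumes "z \<in> B"
  shows "\<exists>r\<in>B. (1 + z) ^ n = 1 + z * (of_nat n + z * r)"
proof (induction n)
  case 0
  show ?case by (auto intro!: bexI[of _ 0])
next
  case (Suc n)
  then obtain r where r: "r \<in> B" "(1 + z) ^ n = 1 + z * (of_nat n + z * r)" by blast
  have "(1 + z) ^ Suc n = 1 + z * (of_nat (Suc n) + z * (of_nat n + r + z * r))"
    unfolding power_Suc r(2) by (simp add: algebra_simps)
  moreover have "of_nat n + r + z * r \<in> B"
    using assms r by blast
  ultimately show ?case by blast
qed

lemma one_plus_power_prime:
  assumes z: "z \<in> B"
  shows "\<exists>s\<in>B. (1 + z) ^ p = 1 + z ^ p + of_nat p * z * (1 + z * s)"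
proof -
  have p2: "p \<ge> 2" using prime prime_ge_2_nat by blast
  have dvd: "of_nat (p choose k) = (of_nat p * of_nat ((p choose k) div p) :: complex)" if "0 < k" "k < p" for k
  proof -
    have "p dvd (p choose k)"
      using that prime by (intro dvd_choose_prime) auto
    then show ?thesis
      by (metis dvd_mult_div_cancel of_nat_mult)
  qed
  define s where "s = (\<Sum>k=2..<p. of_nat ((p choose k) div p) * z ^ (k - 2))"
  have "(1 + z) ^ p = (\<Sum>k\<le>p. of_nat (p choose k) * z ^ k)"
    using binomial_ring[of z 1 p] by (simp add: add.commute)
  also have "{..p} = {0, 1} \<union> {2..<p} \<union> {p}"
    using p2 by auto
  also have "(\<Sum>k\<in>\<dots>. of_nat (p choose k) * z ^ k)
      = 1 + of_nat p * z + (\<Sum>k=2..<p. of_nat (p choose k) * z ^ k) + z ^ p"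
    using p2 by (subst sum.union_disjoint; (subst sum.union_disjoint)?) auto
  also have "(\<Sum>k=2..<p. of_nat (p choose k) * z ^ k) = of_nat p * z * (z * s)"
    unfolding s_def sum_distrib_left
  proof (intro sum.cong refl)
    fix k assume k: "k \<in> {2..<p}"
    then have "z ^ k = z * (z * z ^ (k - 2))"
      by (intro power_split_two) simp
    then show "of_nat (p choose k) * z ^ k = of_nat p * z * (z * (of_nat ((p choose k) div p) * z ^ (k - 2)))"
      using dvd[of k] k by simp
  qed
  finally have "(1 + z) ^ p = 1 + z ^ p + of_nat p * z * (1 + z * s)"
    by (simp add: algebra_simps)
  moreover have "s \<in> B"
    unfolding s_def using z by blast
  ultimately show ?thesis by blast
qed

lemma one_plus_power_prime_power:
  assumes x: "x \<in> B"
  shows "\<exists>h\<in>B. (1 + x) ^ (p ^ k) = 1 + (x ^ (p ^ k) + of_nat p * x * h)"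
proof (induction k)
  case 0
  show ?case by (auto intro!: bexI[of _ 0])
next
  case (Suc k)
  then obtain h where h: "h \<in> B" "(1 + x) ^ (p ^ k) = 1 + (x ^ (p ^ k) + of_nat p * x * h)" by blast
  define z where "z = x ^ (p ^ k) + of_nat p * x * h"
  have z: "z \<in> B" unfolding z_def using x h by blast
  obtain s where s: "s \<in> B" "(1 + z) ^ p = 1 + z ^ p + of_nat p * z * (1 + z * s)"
    using one_plus_power_prime[OF z] by blast
  obtain r where r: "r \<in> B" "z ^ p = (x ^ (p ^ k)) ^ p + of_nat p * x * h * r"
    using power_add_expand[of "x ^ (p ^ k)" "of_nat p * x * h" p] x h unfolding z_def by blast
  define z' where "z' = x ^ (p ^ k - 1) + of_nat p * h"
  have "p ^ k > 0" using prime prime_gt_0_nat by simp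
  then have z': "z = x * z'" "z' \<in> B"
    using x h by (auto simp: z_def z'_def algebra_simps simp flip: power_Suc)
  have "(1 + x) ^ (p ^ Suc k) = (1 + z) ^ p"
    unfolding z_def h(2)[symmetric] by (simp add: mult.commute flip: power_mult)
  also have "\<dots> = 1 + (x ^ (p ^ Suc k) + of_nat p * x * (h * r + z' * (1 + z * s)))"
    unfolding s(2) r(2) by (simp add: z'(1) algebra_simps flip: power_mult)
  finally show ?case
    using h r z z' s by blast
qed

lemma p_power_div_mem:
  assumes "k \<ge> 1"
  shows "of_nat p ^ (k - 1) / of_nat k \<in> B"
proof -
  obtain k' where k': "k = p ^ multiplicity p k * k'" "\<not> p dvd k'"
    using multiplicity_decompose'[of k p] assms prime by (metis not_one_le_zero not_prime_unit)
  define v where "v = multiplicity p k"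
  have p0: "of_nat p \<noteq> (0 :: complex)" using prime by auto
  have "v < 2 ^ v" by simp
  also have "2 ^ v \<le> p ^ v"
    using prime prime_ge_2_nat by (intro power_mono) auto
  also have "\<dots> \<le> k"
    using k' assms unfolding v_def by (metis dvd_triv_left dvd_imp_le less_le_trans zero_less_one)
  finally have "v \<le> k - 1" by simp
  then have "of_nat p ^ (k - 1) = (of_nat p ^ v * of_nat p ^ (k - 1 - v) :: complex)"
    by (metis le_add_diff_inverse power_add)
  moreover have "(of_nat k :: complex) = of_nat p ^ v * of_nat k'"
    using k'(1) unfolding v_def by (metis of_nat_mult of_nat_power)
  ultimately have "of_nat p ^ (k - 1) / of_nat k = (of_nat p ^ (k - 1 - v) * inverse (of_nat k') :: complex)"
    using p0 by (simp add: field_simps)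
  then show ?thesis
    using val_unit_of_nat[OF k'(2)] by (auto simp: val_unit_def)
qed

text \<open>
  A logarithm in disguise: if \<open>A\<close> has larger valuation than \<open>p\<close>, then in \<open>(1 + A)\<^sup>n - 1\<close> the linear term dominates, because the
  \<open>k\<close>-th term is \<open>n A\<close> times \<open>A ^ (k - 1) / k\<close> up to an integer factor, and \<open>k\<close> divides \<open>p ^ (k - 1)\<close> in \<open>B\<close>.
\<close>

lemma one_plus_power_linear_term:
  assumes A: "A = of_nat p * a" "val_pos a" and n: "n > 0"
  shows "\<exists>u. val_unit u \<and> (1 + A) ^ n = 1 + of_nat n * A * u"
proof -
  define s where "s = (\<Sum>k=2..n. of_nat ((n - 1) choose (k - 1)) * (a ^ (k - 1) * (of_nat p ^ (k - 1) / of_nat k)))"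
  have "(1 + A) ^ n = (\<Sum>k\<le>n. of_nat (n choose k) * A ^ k)"
    using binomial_ring[of A 1 n] by (simp add: add.commute)
  also have "{..n} = {0, 1} \<union> {2..n}"
    using n by auto
  also have "(\<Sum>k\<in>\<dots>. of_nat (n choose k) * A ^ k) = 1 + of_nat n * A + (\<Sum>k=2..n. of_nat (n choose k) * A ^ k)"
    using n by (subst sum.union_disjoint) auto
  also have "(\<Sum>k=2..n. of_nat (n choose k) * A ^ k) = of_nat n * A * s"
    unfolding s_def sum_distrib_left
  proof (intro sum.cong refl)
    fix k assume k: "k \<in> {2..n}"
    then obtain j where j: "k = Suc j" by (cases k) auto
    have "k * (n choose k) = n * ((n - 1) choose (k - 1))"
      using n times_binomial_minus1_eq[of k n] k by simp
    then have "of_nat k * of_nat (n choose k) = (of_nat n * of_nat ((n - 1) choose (k - 1)) :: complex)"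
      by (metis of_nat_mult)
    then have "of_nat (n choose k) = (of_nat n * of_nat ((n - 1) choose (k - 1)) / of_nat k :: complex)"
      using k by (simp add: field_simps)
    then show "of_nat (n choose k) * A ^ k
        = of_nat n * A * (of_nat ((n - 1) choose (k - 1)) * (a ^ (k - 1) * (of_nat p ^ (k - 1) / of_nat k)))"
      using j by (simp add: A(1) power_mult_distrib)
  qed
  finally have "(1 + A) ^ n = 1 + of_nat n * A * (1 + s)"
    by (simp add: algebra_simps)
  moreover have "val_pos s"
    unfolding s_def
  proof (rule val_pos_sum)
    fix k assume "k \<in> {2..n}"
    then show "val_pos (of_nat ((n - 1) choose (k - 1)) * (a ^ (k - 1) * (of_nat p ^ (k - 1) / of_nat k)))"
      using A(2) p_power_div_mem[of k] by (intro val_pos_mult val_pos_power) auto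
  qed
  ultimately show ?thesis
    using val_unit_add[OF val_unit_one] by blast
qed

lemma power_sum_zero_eq:
  "power_sum_zero n x \<Longrightarrow> odd n \<Longrightarrow> (1 + x) ^ n = 1 + x ^ n"
  "power_sum_zero n x \<Longrightarrow> even n \<Longrightarrow> (1 + x) ^ n = - (1 + x ^ n)"
proof -
  have e: "(- 1 - x) ^ n = (- 1) ^ n * (1 + x) ^ n"
    by (subst power_mult_distrib[symmetric]) simp
  show "power_sum_zero n x \<Longrightarrow> odd n \<Longrightarrow> (1 + x) ^ n = 1 + x ^ n"
    unfolding power_sum_zero_def e by simp
  show "power_sum_zero n x \<Longrightarrow> even n \<Longrightarrow> (1 + x) ^ n = - (1 + x ^ n)"
    unfolding power_sum_zero_def e by (simp add: eq_neg_iff_add_eq_0 add_ac del: minus_add_distrib)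
qed

text \<open>
  To first order in \<open>x\<close> the equation reads \<open>n x \<approx> 0\<close> for odd \<open>n\<close>, and \<open>2 \<approx> 0\<close> for even \<open>n\<close>.
\<close>

lemma exponent_divisible:
  assumes x: "power_sum_zero n x" "val_pos x" "x \<noteq> 0" and n: "n \<ge> 2"
  shows "p dvd n" "even n \<longleftrightarrow> p = 2"
proof -
  obtain r where r: "r \<in> B" "(1 + x) ^ n = 1 + x * (of_nat n + x * r)"
    using one_plus_power_expand val_posD[OF x(2)] by blast
  have xn: "x ^ n = x * (x * x ^ (n - 2))"
    using n by (rule power_split_two)
  have odd: "p dvd n" if "odd n"
  proof -
    have "x * (of_nat n + x * r) = x * (x * x ^ (n - 2))"
      using power_sum_zero_eq(1)[OF x(1) that] r(2) xn by simp
    then have "of_nat n + x * r = x * x ^ (n - 2)"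
      using x(3) by simp
    then have "of_nat n = x * (x ^ (n - 2) - r)"
      by (simp add: algebra_simps)
    moreover have "x ^ (n - 2) - r \<in> B"
      using val_posD[OF x(2)] r by blast
    ultimately have "val_pos (of_nat n)"
      using val_pos_mult(1)[OF x(2)] by simp
    then show ?thesis by (rule of_nat_val_pos_imp_dvd)
  qed
  have even: "p = 2" if "even n"
  proof (rule ccontr)
    assume "p \<noteq> 2"
    then have "\<not> p dvd 2"
      using prime by (metis prime_nat_iff two_is_prime_nat primes_dvd_imp_eq)
    then have "val_unit (of_nat 2)" by (rule val_unit_of_nat)
    moreover have "val_pos (x * (of_nat n + x * r + x * x ^ (n - 2)))"
      using val_posD[OF x(2)] r by (intro val_pos_mult x) blast
    ultimately have "val_unit (of_nat 2 + x * (of_nat n + x * r + x * x ^ (n - 2)))"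
      by (rule val_unit_add)
    moreover have "of_nat 2 + x * (of_nat n + x * r + x * x ^ (n - 2)) = 0"
      using power_sum_zero_eq(2)[OF x(1) that] r(2) xn by (simp add: algebra_simps)
    ultimately show False by (simp add: val_unit_def)
  qed
  show "p dvd n" using odd even by (cases "odd n") auto
  show "even n \<longleftrightarrow> p = 2"
  proof
    assume "p = 2"
    then show "even n" using odd by (cases "odd n") auto
  qed (use even in auto)
qed

text \<open>
  A lower bound \<open>v(x) > v(p) / p\<^sup>k\<close> for the valuation of \<open>x\<close>, where \<open>p\<^sup>k\<close> is the exact power of \<open>p\<close> in \<open>n\<close>. With
  \<open>(1 + x)^(p^k) = 1 + z\<close>, the equation forces \<open>z\<close>, which is \<open>x^(p^k)\<close> up to a multiple of \<open>p x\<close>, to be of the order of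
  \<open>x\<^sup>n\<close>. If \<open>n\<close> is itself a power of \<open>p\<close> this says nothing, and the same comparison is made one step earlier, with \<open>p^(k-1)\<close>.
\<close>

lemma valuation_bound_odd:
  assumes x: "power_sum_zero n x" "val_pos x" "x \<noteq> 0" and n: "n \<ge> 2" "odd n"
    and dec: "n = p ^ k * n'" "\<not> p dvd n'"
  shows "\<exists>a. val_pos a \<and> x ^ (p ^ k) = of_nat p * a"
proof -
  have eq: "(1 + x) ^ n = 1 + x ^ n"
    using power_sum_zero_eq x n by blast
  have xB: "x \<in> B" using val_posD x by blast
  have p0: "of_nat p \<noteq> (0 :: complex)" using prime by auto
  have pk: "p ^ j > 0" for j using prime prime_gt_0_nat by simp
  show ?thesis
  proof (cases "n' = 1")
    case False
    then have n': "n' > 1" using dec n by (cases "n' = 0") auto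
    obtain h where h: "h \<in> B" "(1 + x) ^ (p ^ k) = 1 + (x ^ (p ^ k) + of_nat p * x * h)"
      using one_plus_power_prime_power[OF xB] by blast
    define q where "q = p ^ k"
    define z where "z = x ^ q + of_nat p * x * h"
    have zp: "val_pos z"
      unfolding z_def using xB h pk x(2) by (intro val_pos_add val_pos_power val_pos_mult val_pos_p) (auto simp: q_def)
    obtain r where r: "r \<in> B" "(1 + z) ^ n' = 1 + z * (of_nat n' + z * r)"
      using one_plus_power_expand val_posD[OF zp] by blast
    define u where "u = of_nat n' + z * r"
    have u: "val_unit u"
      unfolding u_def using val_unit_of_nat[OF dec(2)] val_pos_mult(1)[OF zp r(1)] by (rule val_unit_add)
    have "1 + z * u = 1 + x ^ q * x ^ (q * n' - q)"
    proof -
      have "(1 + x) ^ n = (1 + z) ^ n'"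
        unfolding dec(1) power_mult h(2) z_def q_def ..
      moreover have "x ^ n = x ^ q * x ^ (q * n' - q)"
        unfolding dec(1) q_def[symmetric] using n' by (simp flip: power_add)
      ultimately show ?thesis
        using eq r(2) u_def by simp
    qed
    then have main: "x ^ q * (u - x ^ (q * n' - q)) = of_nat p * (x * (- h * u))"
      unfolding z_def by (simp add: algebra_simps)
    have "q * n' - q > 0"
      using n' pk[of k] by (simp add: q_def)
    then have "val_unit (u + - (x ^ (q * n' - q)))"
      using u x(2) by (intro val_unit_add val_pos_uminus val_pos_power)
    then have v: "val_unit (u - x ^ (q * n' - q))" by simp
    have "x ^ q = of_nat p * (x * (- h * u * inverse (u - x ^ (q * n' - q))))"
      using main val_unitD(2)[OF v] by (simp add: field_simps)
    moreover have "val_pos (x * (- h * u * inverse (u - x ^ (q * n' - q))))"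
      using h u v by (intro val_pos_mult x mult_mem uminus_mem) (auto simp: val_unit_def)
    ultimately show ?thesis
      unfolding q_def by blast
  next
    case True
    then have "k > 0" using dec n by (cases k) auto
    then obtain j where j: "k = Suc j" by (cases k) auto
    obtain h where h: "h \<in> B" "(1 + x) ^ (p ^ j) = 1 + (x ^ (p ^ j) + of_nat p * x * h)"
      using one_plus_power_prime_power[OF xB] by blast
    define a where "a = x ^ (p ^ j)"
    have a: "val_pos a" "a \<noteq> 0"
      unfolding a_def using x pk by (auto intro: val_pos_power)
    have ap: "x ^ (p ^ k) = a ^ p"
      unfolding a_def j by (simp add: mult.commute flip: power_mult)
    define w where "w = a + of_nat p * x * h"
    have wp: "val_pos w"
      unfolding w_def using xB h a x(2) by (intro val_pos_add val_pos_mult val_pos_p)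
    obtain s where s: "s \<in> B" "(1 + w) ^ p = 1 + w ^ p + of_nat p * w * (1 + w * s)"
      using one_plus_power_prime[OF val_posD[OF wp]] by blast
    have "(1 + x) ^ n = (1 + w) ^ p"
      unfolding dec(1) True j w_def a_def h(2)[symmetric] by (simp add: mult.commute flip: power_mult)
    then have main: "a ^ p = w ^ p + of_nat p * w * (1 + w * s)"
      using eq s(2) ap dec(1) True by simp
    have p2: "p \<ge> 2" using prime prime_ge_2_nat by blast
    show ?thesis
    proof (cases "a / (of_nat p * x) \<in> B")
      case True
      have "a ^ p = a * a ^ (p - 1)"
        using p2 by (metis Suc_diff_1 less_le_trans pos2 power_Suc)
      also have "\<dots> = of_nat p * (x * (a / (of_nat p * x) * a ^ (p - 1)))"
        using p0 x(3) by simp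
      finally have "x ^ (p ^ k) = of_nat p * (x * (a / (of_nat p * x) * a ^ (p - 1)))"
        by (simp only: ap)
      moreover have "val_pos (x * (a / (of_nat p * x) * a ^ (p - 1)))"
        using True val_posD[OF a(1)] by (intro val_pos_mult(1) x(2) mult_mem power_mem)
      ultimately show ?thesis by blast
    next
      case False
      \<comment> \<open>Here \<open>w\<close> is \<open>a\<close> up to a unit, and dividing the equation by \<open>p a\<close> leaves a unit equal to \<open>0\<close>.\<close>
      define d where "d = of_nat p * x / a"
      have "inverse (a / (of_nat p * x)) = d"
        by (simp add: d_def field_simps)
      then have d: "val_pos d"
        using total[of "a / (of_nat p * x)"] False a p0 x(3) by (auto simp: val_pos_def val_unit_def d_def)
      have da: "d * a = of_nat p * x"
        using a by (simp add: d_def)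
      have wd: "w = a * (1 + d * h)"
        unfolding w_def using da by (simp add: algebra_simps)
      obtain r where r: "r \<in> B" "(1 + d * h) ^ p = 1 ^ p + d * h * r"
        using power_add_expand[of 1 "d * h" p] h val_posD[OF d] by blast
      define y where "y = a ^ (p - 2) * (x * (h * r))"
      have app: "a ^ p = a * (a * a ^ (p - 2))"
        using p2 by (rule power_split_two)
      have "a ^ p * (d * h * r) = (a * a ^ (p - 2)) * (d * a) * (h * r)"
        unfolding app by (simp only: mult_ac)
      also have "\<dots> = of_nat p * a * y"
        unfolding da y_def by (simp only: mult_ac)
      finally have "a ^ p * (d * h * r) = of_nat p * a * y" .
      moreover have "w ^ p = a ^ p + a ^ p * (d * h * r)"
        unfolding wd power_mult_distrib r(2) by (simp add: algebra_simps)
      ultimately have "of_nat p * a * (y + (1 + d * h) * (1 + w * s)) = 0"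
        using main wd by (simp add: algebra_simps)
      then have "(1 + d * h) * (1 + w * s) + y = 0"
        using p0 a by (simp add: add.commute)
      moreover have "val_unit ((1 + d * h) * (1 + w * s) + y)"
      proof (intro val_unit_add val_unit_mult val_unit_one)
        show "val_pos (d * h)" "val_pos (w * s)"
          using d h wp s by (auto intro: val_pos_mult)
        show "val_pos y"
          unfolding y_def using x a h r val_posD by (intro val_pos_mult(2) val_pos_mult(1)) auto
      qed
      ultimately show ?thesis by (simp add: val_unit_def)
    qed
  qed
qed

text \<open>
  For \<open>p = 2\<close> the equation has the constant term \<open>2\<close>, which only the term \<open>x^(p^k)\<close> can cancel.
\<close>

lemma valuation_exact_two:
  assumes x: "power_sum_zero n x" "val_pos x" "x \<noteq> 0" and n: "n \<ge> 2" "even n" "p = 2"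
    and dec: "n = p ^ k * n'" "\<not> p dvd n'"
  shows "n' > 1" "\<exists>u. val_unit u \<and> x ^ (p ^ k) = of_nat p * u"
proof -
  have eq: "(1 + x) ^ n = - (1 + x ^ n)"
    using power_sum_zero_eq x n by blast
  have xB: "x \<in> B" using val_posD x by blast
  have pk: "p ^ j > 0" for j using prime prime_gt_0_nat by simp
  obtain h where h: "h \<in> B" "(1 + x) ^ (p ^ k) = 1 + (x ^ (p ^ k) + of_nat p * x * h)"
    using one_plus_power_prime_power[OF xB] by blast
  define q where "q = p ^ k"
  define z where "z = x ^ q + of_nat p * x * h"
  have zp: "val_pos z"
    unfolding z_def using xB h pk x(2) by (intro val_pos_add val_pos_power val_pos_mult val_pos_p) (auto simp: q_def)
  show n': "n' > 1"
  proof (rule ccontr)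
    assume "\<not> n' > 1"
    then have "n' = 1" using dec n by (cases n') auto
    then have "1 + z = - (1 + x ^ q)"
      using eq h(2) dec(1) by (simp add: q_def z_def)
    then have "2 * (1 + (x ^ q + x * h)) = 0"
      unfolding z_def using n(3) by (simp add: algebra_simps)
    then have "1 + (x ^ q + x * h) = 0"
      by (metis mult_eq_0_iff zero_neq_numeral)
    moreover have "val_unit (1 + (x ^ q + x * h))"
      using x(2) h pk by (intro val_unit_add val_unit_one val_pos_add val_pos_power val_pos_mult) (auto simp: q_def)
    ultimately show False by (simp add: val_unit_def)
  qed
  obtain r where r: "r \<in> B" "(1 + z) ^ n' = 1 + z * (of_nat n' + z * r)"
    using one_plus_power_expand val_posD[OF zp] by blast
  define u where "u = of_nat n' + z * r"
  have u: "val_unit u"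
    unfolding u_def using val_unit_of_nat[OF dec(2)] val_pos_mult(1)[OF zp r(1)] by (rule val_unit_add)
  have "1 + z * u = - (1 + x ^ q * x ^ (q * n' - q))"
  proof -
    have "(1 + x) ^ n = (1 + z) ^ n'"
      unfolding dec(1) power_mult h(2) z_def q_def ..
    moreover have "x ^ n = x ^ q * x ^ (q * n' - q)"
      unfolding dec(1) q_def[symmetric] using n' by (simp flip: power_add)
    ultimately show ?thesis
      using eq r(2) u_def by simp
  qed
  then have main: "x ^ q * (u + x ^ (q * n' - q)) = of_nat p * (- (1 + x * (h * u)))"
    unfolding z_def using n(3) by (simp add: algebra_simps) (simp add: eq_neg_iff_add_eq_0 add_ac)
  have "q * n' - q > 0"
    using n' pk[of k] by (simp add: q_def)
  then have v: "val_unit (u + x ^ (q * n' - q))"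
    using u x(2) by (intro val_unit_add val_pos_power)
  have "x ^ q = of_nat p * (- (1 + x * (h * u)) * inverse (u + x ^ (q * n' - q)))"
    using main val_unitD(2)[OF v] by (simp add: field_simps)
  moreover have "val_unit (1 + x * (h * u))"
    using val_unit_add[OF val_unit_one val_pos_mult(1)[OF x(2)]] h val_unitD(1)[OF u] by blast
  then have "val_unit (- (1 + x * (h * u)) * inverse (u + x ^ (q * n' - q)))"
    by (intro val_unit_mult val_unit_uminus val_unit_inverse v)
  ultimately show "\<exists>u. val_unit u \<and> x ^ (p ^ k) = of_nat p * u"
    unfolding q_def by blast
qed

text \<open>
  Both equations give \<open>(1 + x\<^sup>b)\<^sup>c = (1 + x\<^sup>c)\<^sup>b\<close>, and comparing the dominant terms \<open>c x\<^sup>b\<close> and \<open>b x\<^sup>c\<close> shows that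
  \<open>c / b\<close> has the same valuation as \<open>x ^ (c - b)\<close>. For \<open>p = 2\<close> the valuation of \<open>x\<close> determines the powers of \<open>2\<close> in \<open>b\<close> and
  \<open>c\<close>; they agree, although \<open>x ^ (c - b)\<close> is not a unit. For odd \<open>p\<close>, let \<open>p\<^sup>\<beta>\<close> and \<open>p ^ (\<beta> + \<delta>)\<close> be the exact powers of \<open>p\<close> in \<open>b\<close>
  and \<open>c\<close>. The lower bound for the valuation of \<open>x\<close> gives \<open>c - b = p\<^sup>\<beta> t\<close> with \<open>t < \<delta>\<close>, while \<open>c \<ge> p ^ (\<beta> + \<delta>)\<close>. So \<open>c - b\<close> is
  small compared with \<open>b\<close>, contrary to \<open>c \<ge> 2 b - 3\<close>.
\<close>

theorem common_zero_not_val_pos: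
  assumes x: "power_sum_zero b x" "power_sum_zero c x" "x \<noteq> 0" and bc: "2 \<le> b" "b < c" "2 * b \<le> c + 3"
  shows "\<not> val_pos x"
proof
  assume xp: "val_pos x"
  have xB: "x \<in> B" using val_posD xp by blast
  have p0: "of_nat p \<noteq> (0 :: complex)" using prime by auto
  have p2: "p \<ge> 2" using prime prime_ge_2_nat by blast
  have c2: "c \<ge> 2" using bc by simp
  have par: "even b \<longleftrightarrow> p = 2" "even c \<longleftrightarrow> p = 2"
    using exponent_divisible(2) x xp bc c2 by blast+
  obtain \<beta> b' where b': "b = p ^ \<beta> * b'" "\<not> p dvd b'"
    using multiplicity_decompose'[of b p] bc prime by (metis not_numeral_le_zero not_prime_unit)
  obtain \<gamma> c' where c': "c = p ^ \<gamma> * c'" "\<not> p dvd c'"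
    using multiplicity_decompose'[of c p] c2 prime by (metis not_numeral_le_zero not_prime_unit)
  have pos: "\<exists>a. val_pos a \<and> x ^ n = of_nat p * a"
    if prems: "power_sum_zero n x" "n \<ge> 2" "n = p ^ k * n'" "\<not> p dvd n'" "even n \<longleftrightarrow> p = 2" for n k n'
  proof (cases "p = 2")
    case False
    then obtain a where a: "val_pos a" "x ^ (p ^ k) = of_nat p * a"
      using valuation_bound_odd[OF prems(1) xp x(3) prems(2) _ prems(3,4)] prems(5) by blast
    have "n' > 0" using prems(2,3) by (cases n') auto
    then have "x ^ n = x ^ (p ^ k) * x ^ (p ^ k * (n' - 1))"
      unfolding prems(3) by (cases n') (simp_all add: power_add)
    also have "\<dots> = of_nat p * (a * x ^ (p ^ k * (n' - 1)))"
      by (simp add: a)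
    finally show ?thesis
      using val_pos_mult(1)[OF a(1)] xB by blast
  next
    case True
    then obtain u where u: "val_unit u" "x ^ (p ^ k) = of_nat p * u" and n': "n' > 1"
      using valuation_exact_two[OF prems(1) xp x(3) prems(2) _ _ prems(3,4)] prems(5) by blast
    then have "x ^ n = x ^ (p ^ k) * x ^ (p ^ k * (n' - 1))"
      unfolding prems(3) by (cases n') (simp_all add: power_add)
    also have "\<dots> = of_nat p * (u * x ^ (p ^ k * (n' - 1)))"
      by (simp add: u)
    finally show ?thesis
      using val_pos_mult(2)[OF val_pos_power[OF xp, of "p ^ k * (n' - 1)"] val_unitD(1)[OF u(1)]] n' p2
      by (metis mult_pos_pos zero_less_diff zero_less_power pos2 less_le_trans)
  qed
  obtain ab where ab: "val_pos ab" "x ^ b = of_nat p * ab"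
    using pos[OF x(1) bc(1) b' par(1)] by blast
  obtain ac where ac: "val_pos ac" "x ^ c = of_nat p * ac"
    using pos[OF x(2) c2 c' par(2)] by blast
  have "(1 + x ^ b) ^ c = (1 + x ^ c) ^ b"
  proof (cases "p = 2")
    case True
    then have "((1 + x) ^ b) ^ c = (- (1 + x ^ b)) ^ c" "((1 + x) ^ c) ^ b = (- (1 + x ^ c)) ^ b"
      using power_sum_zero_eq(2) x par by simp_all
    moreover have "((1 + x) ^ b) ^ c = ((1 + x) ^ c) ^ b"
      by (simp add: mult.commute flip: power_mult)
    moreover have "(- (1 + x ^ b)) ^ c = (1 + x ^ b) ^ c" "(- (1 + x ^ c)) ^ b = (1 + x ^ c) ^ b"
      using True par by (intro power_minus_even; simp)+
    ultimately show ?thesis by (metis (no_types))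
  next
    case False
    then have "((1 + x) ^ b) ^ c = (1 + x ^ b) ^ c" "((1 + x) ^ c) ^ b = (1 + x ^ c) ^ b"
      using power_sum_zero_eq(1) x par by simp_all
    moreover have "((1 + x) ^ b) ^ c = ((1 + x) ^ c) ^ b"
      by (simp add: mult.commute flip: power_mult)
    ultimately show ?thesis by simp
  qed
  moreover obtain u where u: "val_unit u" "(1 + x ^ b) ^ c = 1 + of_nat c * x ^ b * u"
    using one_plus_power_linear_term[OF ab(2,1), of c] c2 by auto
  moreover obtain v where v: "val_unit v" "(1 + x ^ c) ^ b = 1 + of_nat b * x ^ c * v"
    using one_plus_power_linear_term[OF ac(2,1), of b] bc by auto
  moreover have "x ^ c = x ^ b * x ^ (c - b)"
    using bc by (simp flip: power_add)
  ultimately have "x ^ b * (of_nat c * u) = x ^ b * (of_nat b * x ^ (c - b) * v)"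
    by (simp add: mult_ac)
  then have "of_nat c * u = of_nat b * x ^ (c - b) * v"
    using x(3) by simp
  then have main: "of_nat p ^ \<gamma> * (of_nat c' * u) = of_nat p ^ \<beta> * x ^ (c - b) * (of_nat b' * v)"
    unfolding b'(1) c'(1) by (simp add: mult_ac)
  define U V where "U = of_nat c' * u" and "V = of_nat b' * v"
  have UV: "val_unit U" "val_unit V"
    unfolding U_def V_def using u v val_unit_of_nat b' c' by (auto intro: val_unit_mult)
  have main: "of_nat p ^ \<gamma> * U = of_nat p ^ \<beta> * x ^ (c - b) * V"
    using main unfolding U_def V_def .
  have xcb: "val_pos (x ^ (c - b))"
    using bc by (intro val_pos_power xp) simp
  have not_eq: "U \<noteq> y * V" if "val_pos y" for y
    using UV that val_pos_mult(1)[OF that val_unitD(1)[OF UV(2)]] by (auto simp: val_pos_def)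
  show False
  proof (cases "\<gamma> \<le> \<beta>")
    case True
    then have "of_nat p ^ \<beta> = (of_nat p ^ \<gamma> * of_nat p ^ (\<beta> - \<gamma>) :: complex)"
      by (simp flip: power_add)
    then have "U = (of_nat p ^ (\<beta> - \<gamma>) * x ^ (c - b)) * V"
      using main p0 by (simp add: mult.assoc)
    then show False
      using not_eq val_pos_mult(2)[OF xcb] by blast
  next
    case False
    define \<delta> where "\<delta> = \<gamma> - \<beta>"
    have \<delta>: "\<delta> > 0" "\<gamma> = \<beta> + \<delta>"
      using False by (auto simp: \<delta>_def)
    have main': "of_nat p ^ \<delta> * U = x ^ (c - b) * V"
      using main p0 unfolding \<delta>(2) power_add by (simp add: mult.assoc)
    show False
    proof (cases "p = 2")
      case True
      obtain u1 where u1: "val_unit u1" "x ^ (p ^ \<beta>) = of_nat p * u1"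
        using valuation_exact_two(2)[OF x(1) xp x(3) bc(1) _ True b'] par True by blast
      obtain u2 where u2: "val_unit u2" "x ^ (p ^ \<gamma>) = of_nat p * u2"
        using valuation_exact_two(2)[OF x(2) xp x(3) c2 _ True c'] par True by blast
      have lt: "p ^ \<beta> < p ^ \<gamma>"
        using \<delta> p2 by (intro power_strict_increasing) auto
      then have "x ^ (p ^ \<gamma>) = x ^ (p ^ \<beta>) * x ^ (p ^ \<gamma> - p ^ \<beta>)"
        by (simp flip: power_add)
      then have "u2 = u1 * x ^ (p ^ \<gamma> - p ^ \<beta>)"
        using u1 u2 p0 by (simp add: mult.assoc)
      moreover have "val_pos (u1 * x ^ (p ^ \<gamma> - p ^ \<beta>))"
        using lt u1 by (intro val_pos_mult val_pos_power xp) (auto simp: val_unit_def)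
      ultimately show False
        using u2 by (simp add: val_pos_def)
    next
      case pn2: False
      obtain a where a: "val_pos a" "x ^ (p ^ \<beta>) = of_nat p * a"
        using valuation_bound_odd[OF x(1) xp x(3) bc(1) _ b'] par pn2 by blast
      define t where "t = p ^ \<delta> * c' - b'"
      have cb: "c = p ^ \<beta> * (p ^ \<delta> * c')"
        unfolding c'(1) \<delta>(2) by (simp add: power_add)
      have lt: "b' < p ^ \<delta> * c'"
        using bc(2) unfolding b'(1) cb using p2 by simp
      have t: "t > 0" "p ^ \<delta> * c' = b' + t"
        using lt by (auto simp: t_def)
      have "c - b = p ^ \<beta> * t"
        unfolding b'(1) cb t_def by (simp add: diff_mult_distrib2)
      then have "x ^ (c - b) = of_nat p ^ t * a ^ t"
        by (simp add: power_mult a power_mult_distrib)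
      then have main'': "of_nat p ^ \<delta> * U = of_nat p ^ t * a ^ t * V"
        using main' by simp
      have "t < \<delta>"
      proof (rule ccontr)
        assume "\<not> t < \<delta>"
        then have "of_nat p ^ t = (of_nat p ^ \<delta> * of_nat p ^ (t - \<delta>) :: complex)"
          by (simp flip: power_add)
        then have "U = (of_nat p ^ (t - \<delta>) * a ^ t) * V"
          using main'' p0 by (simp add: mult.assoc)
        then show False
          using not_eq val_pos_mult(2)[OF val_pos_power[OF a(1) t(1)]] by blast
      qed
      have p3: "p \<ge> 3" using p2 pn2 by simp
      have "\<beta> > 0"
      proof (rule ccontr)
        assume "\<not> \<beta> > 0"
        then show False
          using exponent_divisible(1)[OF x(1) xp x(3) bc(1)] b' by simp
      qed
      then have "3 \<le> p ^ \<beta>"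
        using p3 self_le_power[of p \<beta>] by simp
      have "2 * (p ^ \<beta> * b') \<le> p ^ \<beta> * (b' + t) + 3"
        using bc(3) unfolding b'(1) cb t(2) .
      also have "\<dots> \<le> p ^ \<beta> * (b' + t + 1)"
        using \<open>3 \<le> p ^ \<beta>\<close> by (simp add: distrib_left)
      finally have "p ^ \<beta> * (2 * b') \<le> p ^ \<beta> * (b' + t + 1)"
        by (simp only: mult.left_commute)
      then have "2 * b' \<le> b' + t + 1"
        using \<open>3 \<le> p ^ \<beta>\<close> nat_mult_le_cancel1[of "p ^ \<beta>" "2 * b'" "b' + t + 1"] by linarith
      then have "b' + t \<le> 2 * \<delta>"
        using \<open>t < \<delta>\<close> by simp
      moreover have "c' > 0" using c' c2 by (cases c') auto
      then have "p ^ \<delta> \<le> b' + t"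
        using t(2) by (metis Suc_leI mult.right_neutral mult_le_mono2 One_nat_def)
      \<comment> \<open>Together, \<open>3 ^ \<delta> \<le> p ^ \<delta> \<le> 2 * \<delta>\<close>, which is impossible.\<close>
      moreover have "1 + 2 * \<delta> \<le> 3 ^ \<delta>"
        by (induction \<delta>) auto
      moreover have "3 ^ \<delta> \<le> p ^ \<delta>"
        using p3 by (intro power_mono) auto
      ultimately show False by linarith
    qed
  qed
qed

end

section \<open>Excluding nontrivial common zeros\<close>

lemma power_sum_zero_inverse: "power_sum_zero n x \<Longrightarrow> x \<noteq> 0 \<Longrightarrow> power_sum_zero n (inverse x)"
proof -
  assume x: "power_sum_zero n x" "x \<noteq> 0"
  have "- 1 - inverse x = (- 1 - x) * inverse x"
    using x(2) by (simp add: field_simps)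
  then have "1 + inverse x ^ n + (- 1 - inverse x) ^ n = (1 + x ^ n + (- 1 - x) ^ n) * inverse x ^ n"
    using x(2) by (simp only: power_mult_distrib) (simp add: field_simps)
  then show ?thesis
    using x(1) by (simp add: power_sum_zero_def)
qed

lemma power_sum_zero_swap: "power_sum_zero n x \<Longrightarrow> power_sum_zero n (- 1 - x)"
  by (simp add: power_sum_zero_def add_ac)

text \<open>
  The equations are invariant under permuting and scaling the triple \<open>1, x, - 1 - x\<close>, so that what holds for \<open>x\<close> also
  holds for \<open>1 / x\<close>, \<open>- 1 - x\<close> and its inverse.
\<close>

lemma (in valuation_ring) common_zero_unit:
  assumes x: "power_sum_zero b x" "power_sum_zero c x" "nontrivial x" and bc: "2 \<le> b" "b < c"
  shows "val_unit x" "val_unit (1 + x)"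
proof -
  have c3: "2 * b \<le> c + 3"
    using second_exponent_lower_bound[OF x bc] .
  have unit: "val_unit y" if y: "power_sum_zero b y" "power_sum_zero c y" "y \<noteq> 0" for y
  proof -
    have "\<not> val_pos y" "\<not> val_pos (inverse y)"
      using common_zero_not_val_pos[OF y bc c3]
        common_zero_not_val_pos[OF power_sum_zero_inverse[OF y(1,3)] power_sum_zero_inverse[OF y(2,3)] _ bc c3] y(3)
      by auto
    then show ?thesis
      using total[OF y(3)] y(3) by (auto simp: val_pos_def val_unit_def)
  qed
  show "val_unit x"
    using unit x by (simp add: nontrivial_def)
  have "- 1 - x \<noteq> 0"
    using x(3) by (auto simp: nontrivial_def algebra_simps)
  then have "val_unit (- 1 - x)"
    using unit x power_sum_zero_swap by blast
  then show "val_unit (1 + x)"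
    using val_unit_uminus[of "- 1 - x"] by (simp add: add.commute)
qed

lemma (in valuation_ring) invariant_integral:
  assumes x: "power_sum_zero b x" "power_sum_zero c x" "nontrivial x" and bc: "2 \<le> b" "b < c"
  shows "(x ^ 2 + x + 1) ^ 3 / (x * (1 + x)) ^ 2 \<in> B"
proof -
  have u: "x \<in> B" "inverse x \<in> B" "inverse (1 + x) \<in> B"
    using common_zero_unit[OF x bc] by (auto simp: val_unit_def)
  have "(x ^ 2 + x + 1) ^ 3 / (x * (1 + x)) ^ 2 = (x ^ 2 + x + 1) ^ 3 * (inverse x * inverse (1 + x)) ^ 2"
    by (simp add: divide_inverse power_inverse power_mult_distrib)
  then show ?thesis
    using u by (auto intro!: mult_mem power_mem add_mem)
qed

theorem conjugate_with_large_invariant: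
  assumes x: "power_sum_zero b x" "power_sum_zero c x" "nontrivial x" and bc: "2 \<le> b" "b < c"
  obtains x' where "conjugate x x'" and "norm (x' * (1 + x')) ^ 2 \<le> norm (x' ^ 2 + x' + 1) ^ 3"
proof -
  obtain y where y: "1 + y ^ b + (- 1 - y) ^ b \<noteq> (0 :: complex)"
    using power_sum_not_identically_zero[OF bc(1)] by blast
  have "\<exists>x'. conjugate x x' \<and> norm ((x' ^ 2 + x' + 1) ^ 3) \<ge> norm ((x' * (1 + x')) ^ 2)"
  proof (rule conjugate_norm_ge[where P = "\<lambda>x. 1 + x ^ b + (- 1 - x) ^ b", OF _ _ y])
    show "rat_poly_fun (\<lambda>x. 1 + x ^ b + (- 1 - x) ^ b)" "rat_poly_fun (\<lambda>x'. (x' ^ 2 + x' + 1) ^ 3)"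
      "rat_poly_fun (\<lambda>x'. (x' * (1 + x')) ^ 2)"
      by (intro rat_poly_intros)+
    show "1 + x ^ b + (- 1 - x) ^ b = 0"
      using x(1) by (simp add: power_sum_zero_def)
    show "(x ^ 2 + x + 1) ^ 3 \<noteq> 0" "(x * (1 + x)) ^ 2 \<noteq> 0"
      using x(3) by (auto simp: nontrivial_def add_eq_0_iff2 add.commute[of 1])
  next
    fix x' B p assume x': "conjugate x x'" and "valuation_ring B p"
    interpret valuation_ring B p by fact
    show "(x' ^ 2 + x' + 1) ^ 3 / (x' * (1 + x')) ^ 2 \<in> B"
      using invariant_integral[OF _ _ _ bc] x x' conjugate_power_sum_zero conjugate_nontrivial by blast
  qed
  then show ?thesis
    using that by (auto simp: norm_power)
qed

text \<open>
  Here \<open>1, z, w\<close> is the triple divided by its largest element, and \<open>z\<close> the smallest one. By the two equations,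
  \<open>c * Ln (1 + z ^ b) - b * Ln (1 + z ^ c)\<close> is an integral multiple of \<open>pi * \<i>\<close>. It is not \<open>0\<close>, since the first term
  dominates. So its modulus, which is about \<open>c * norm z ^ b\<close>, is at least \<open>pi\<close>.
\<close>

theorem archimedean_gap:
  fixes z w :: complex
  assumes zw: "1 + z ^ b + w ^ b = 0" "1 + z ^ c + w ^ c = 0" and z: "z \<noteq> 0" "norm z \<le> 2 / 3"
    and bc: "8 \<le> b" "b < c" "2 * b \<le> c + 3"
  shows "2 \<le> real c * norm z ^ b"
proof -
  define A A' where "A = z ^ b" and "A' = z ^ c"
  define a where "a = norm A"
  have small: "norm z ^ k \<le> (2 / 3) ^ l" if "l \<le> k" for k l
  proof -
    have "norm z ^ k \<le> (2 / 3) ^ k"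
      using z by (intro power_mono) auto
    also have "\<dots> \<le> (2 / 3) ^ l"
      using that by (intro power_decreasing) auto
    finally show ?thesis .
  qed
  have a: "0 < a" "a \<le> 1 / 25"
    using z small[OF bc(1)] by (auto simp: a_def A_def norm_power power_divide)
  have a': "norm A' \<le> a / 7"
  proof -
    have "norm A' = a * norm z ^ (c - b)"
      using bc by (simp add: A'_def a_def A_def norm_power flip: power_add)
    also have "\<dots> \<le> a * (2 / 3) ^ 5"
      using a bc by (intro mult_left_mono small) auto
    also have "\<dots> \<le> a / 7"
      using a by (simp add: power_divide)
    finally show ?thesis .
  qed
  define L L' where "L = Ln (1 + A)" and "L' = Ln (1 + A')"
  have "norm (L - A) \<le> a ^ 2 / (1 - a)"
    using Ln_approx_linear[of A] a by (simp add: L_def a_def)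
  also have "\<dots> \<le> a / 24"
  proof -
    have "a * 24 \<le> 1 - a" using a by simp
    then have "a * (a * 24) \<le> a * (1 - a)"
      using a by (intro mult_left_mono) auto
    then show ?thesis
      using a by (simp add: field_simps power2_eq_square)
  qed
  finally have LA: "norm (L - A) \<le> a / 24" .
  have L: "norm L \<le> a + a / 24" "a - a / 24 \<le> norm L"
    using LA norm_triangle_ineq2[of L A] norm_triangle_ineq2[of A L] by (auto simp: a_def norm_minus_commute)
  have L': "norm L' \<le> 2 * (a / 7)"
  proof -
    have "norm L' \<le> 2 * norm A'"
      unfolding L'_def using a' a by (intro norm_Ln_le) auto
    then show ?thesis using a' by simp
  qed
  have nz: "1 + A \<noteq> 0" "1 + A' \<noteq> 0"
    using a a' by (auto simp: a_def add_eq_0_iff)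
  define D where "D = of_nat c * L - of_nat b * L'"
  have "exp (2 * D) = 1"
  proof -
    have "exp (of_nat c * L) = (1 + A) ^ c" "exp (of_nat b * L') = (1 + A') ^ b"
      using nz by (simp_all add: exp_of_nat_mult L_def L'_def)
    moreover have "1 + A = - (w ^ b)" "1 + A' = - (w ^ c)"
      using zw by (simp_all add: A_def A'_def eq_neg_iff_add_eq_0)
    then have "((1 + A) ^ c) ^ 2 = ((1 + A') ^ b) ^ 2"
      by (simp add: power_mult_distrib mult_ac flip: power_mult)
    ultimately have "exp (of_nat c * L) ^ 2 = exp (of_nat b * L') ^ 2"
      by simp
    then show ?thesis
      by (simp add: D_def right_diff_distrib exp_diff exp_double)
  qed
  then obtain k :: int where k: "Re D = 0" "Im D = of_int k * pi"
    by (auto simp: exp_eq_1)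
  have "norm (of_nat b * L') \<le> real c * (2 * (a / 7))"
    using L' bc a unfolding norm_mult by (intro mult_mono) auto
  then have bL': "norm (of_nat b * L') \<le> real c * a * (2 / 7)" by simp
  have cL: "norm (of_nat c * L) \<le> real c * a * (25 / 24)" "real c * a * (23 / 24) \<le> norm (of_nat c * L)"
    using mult_left_mono[OF L(1), of "real c"] mult_left_mono[OF L(2), of "real c"]
    by (simp_all add: norm_mult algebra_simps)
  have ca: "real c * a > 0" using a bc by simp
  have "D \<noteq> 0"
  proof
    assume "D = 0"
    then have "norm (of_nat c * L) = norm (of_nat b * L')" by (simp add: D_def)
    then show False using bL' cL ca by linarith
  qed
  then have "k \<noteq> 0"
    using k by (auto simp: complex_eq_iff)
  then have "\<bar>of_int k :: real\<bar> \<ge> 1" by linarith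
  then have "pi \<le> \<bar>Im D\<bar>"
    using k(2) by (simp add: abs_mult)
  also have "\<dots> \<le> norm D" by (rule abs_Im_le_cmod)
  also have "\<dots> \<le> norm (of_nat c * L) + norm (of_nat b * L')"
    unfolding D_def by (rule norm_triangle_ineq4)
  finally have "pi \<le> real c * a * (25 / 24) + real c * a * (2 / 7)"
    using bL' cL by linarith
  then have "2 \<le> real c * a"
    using pi_gt3 by linarith
  then show ?thesis
    by (simp add: a_def A_def norm_power)
qed

text \<open>
  The triple \<open>1, x', - 1 - x'\<close> is \<open>t\<close> times the triple \<open>1, w, z\<close>, in some order, and the latter is sorted by decreasing
  modulus.
\<close>

definition normalization :: "complex \<Rightarrow> complex \<Rightarrow> complex \<Rightarrow> complex \<Rightarrow> bool" where
  "normalization x' t z w \<longleftrightarrow> 1 + z + w = 0 \<and> norm z \<le> norm w \<and> norm w \<le> 1 \<and> z \<noteq> 0 \<and> t \<noteq> 0 \<and>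
     (\<forall>n. power_sum_zero n x' \<longrightarrow> 1 + z ^ n + w ^ n = 0) \<and>
     x' ^ 2 + x' + 1 = t ^ 2 * (z ^ 2 + z + 1) \<and> x' * (1 + x') = t ^ 3 * (z * (1 + z)) \<and>
     norm t = Max {1, norm x', norm (1 + x')}"

lemma normalization_exists:
  assumes "nontrivial x'"
  shows "\<exists>t z w. normalization x' t z w"
proof -
  have nz: "x' \<noteq> 0" "- 1 - x' \<noteq> 0"
    using assms by (auto simp: nontrivial_def algebra_simps)
  have sorted: "normalization x' y3 (y1 / y3) (y2 / y3)"
    if "(y1, y2, y3) \<in> {(1, x', - 1 - x'), (1, - 1 - x', x'), (x', 1, - 1 - x'), (x', - 1 - x', 1), (- 1 - x', 1, x'), (- 1 - x', x', 1)}"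
      "norm y1 \<le> norm y2" "norm y2 \<le> norm y3" for y1 y2 y3
  proof -
    have y0: "y1 \<noteq> 0" "y2 \<noteq> 0" "y3 \<noteq> 0" using that nz by auto
    have sum: "y3 + y1 + y2 = 0" using that by auto
    have q: "x' ^ 2 + x' + 1 = y1 ^ 2 + y1 * y3 + y3 ^ 2"
      using that(1)
      by (elim insertE emptyE; simp only: prod.inject; elim conjE; hypsubst; simp add: power2_eq_square algebra_simps)
    have "x' * (1 + x') = y1 * y3 * (- y2)"
      using that(1) by (elim insertE emptyE; simp only: prod.inject; elim conjE; hypsubst; simp add: algebra_simps)
    moreover have "y3 + y1 = - y2"
      using sum by (simp only: eq_neg_iff_add_eq_0)
    ultimately have r: "x' * (1 + x') = y1 * y3 * (y3 + y1)"
      by simp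
    have mx: "norm y3 = Max {1, norm x', norm (1 + x')}"
    proof -
      have "norm (- 1 - x') = norm (1 + x')"
        using norm_minus_cancel[of "1 + x'"] by simp
      then have "{1, norm x', norm (1 + x')} = {norm y1, norm y2, norm y3}"
        using that(1) by auto
      then show ?thesis
        using that(2,3) by (auto intro!: Max_eqI[symmetric])
    qed
    have pow: "1 + (y1 / y3) ^ n + (y2 / y3) ^ n = 0" if n: "power_sum_zero n x'" for n
    proof -
      have "y3 ^ n + y1 ^ n + y2 ^ n = 0"
        using n \<open>(y1, y2, y3) \<in> _\<close> by (auto simp: power_sum_zero_def add_ac)
      then have "(y3 ^ n + y1 ^ n + y2 ^ n) / y3 ^ n = 0" by simp
      then show ?thesis
        using y0 by (simp add: add_divide_distrib power_divide)
    qed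
    have "1 + y1 / y3 + y2 / y3 = 0"
      using sum y0 by (simp add: field_simps)
    moreover have "x' ^ 2 + x' + 1 = y3 ^ 2 * ((y1 / y3) ^ 2 + y1 / y3 + 1)"
      using y0 unfolding q by (simp add: field_simps power2_eq_square)
    moreover have "x' * (1 + x') = y3 ^ 3 * (y1 / y3 * (1 + y1 / y3))"
      using y0 unfolding r by (simp add: field_simps power3_eq_cube)
    moreover have "norm (y1 / y3) \<le> norm (y2 / y3)" "norm (y2 / y3) \<le> 1"
      using that(2,3) y0 by (simp_all add: norm_divide divide_right_mono)
    ultimately show ?thesis
      unfolding normalization_def using pow mx y0 by simp
  qed
  consider "norm (1 :: complex) \<le> norm x'" "norm x' \<le> norm (- 1 - x')"
    | "norm (1 :: complex) \<le> norm (- 1 - x')" "norm (- 1 - x') \<le> norm x'"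
    | "norm x' \<le> norm (1 :: complex)" "norm (1 :: complex) \<le> norm (- 1 - x')"
    | "norm x' \<le> norm (- 1 - x')" "norm (- 1 - x') \<le> norm (1 :: complex)"
    | "norm (- 1 - x') \<le> norm (1 :: complex)" "norm (1 :: complex) \<le> norm x'"
    | "norm (- 1 - x') \<le> norm x'" "norm x' \<le> norm (1 :: complex)"
    by linarith
  then show ?thesis
    using sorted by cases blast+
qed

text \<open>
  With \<open>s = norm z ^ 2\<close>, the modulus of \<open>e\<^sub>2\<close> is at most \<open>1 - s\<close> and that of \<open>e\<^sub>3\<close> at least \<open>s\<close>. So \<open>s\<^sup>2 \<le> (1 - s)\<^sup>3\<close>, which fails
  for \<open>s > 4 / 9\<close>.
\<close>

lemma normalization_small_root:
  assumes zw: "normalization x' t z w" and J: "norm (x' * (1 + x')) ^ 2 \<le> norm (x' ^ 2 + x' + 1) ^ 3"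
  shows "norm z \<le> 2 / 3"
proof (rule ccontr)
  assume big: "\<not> norm z \<le> 2 / 3"
  define s where "s = norm z ^ 2"
  have w: "norm (1 + z) = norm w" 
  proof -
    have "1 + z = - w" using zw by (simp add: normalization_def eq_neg_iff_add_eq_0)
    then show ?thesis by simp
  qed
  have zw': "norm z \<le> norm w" "norm w \<le> 1" "t \<noteq> 0"
    using zw by (auto simp: normalization_def)
  have "norm (z ^ 2 + z + 1) ^ 2 = 1 ^ 2 + (norm w ^ 2) ^ 2 + s ^ 2 - 1 * norm w ^ 2 - 1 * s - norm w ^ 2 * s"
    unfolding norm_quadratic_squared w s_def by simp
  also have "\<dots> \<le> (1 - s) ^ 2"
    using zw' by (intro quadratic_form_le) (auto simp: s_def power_le_one intro: power_mono)
  finally have "norm (z ^ 2 + z + 1) \<le> 1 - s"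
    by (rule power2_le_imp_le) (use zw' in \<open>simp add: s_def power_le_one\<close>)
  then have 1: "norm (z ^ 2 + z + 1) ^ 3 \<le> (1 - s) ^ 3"
    by (intro power_mono) auto
  have "norm t ^ 6 * (norm z * norm w) ^ 2 \<le> norm t ^ 6 * norm (z ^ 2 + z + 1) ^ 3"
    using J zw unfolding normalization_def by (simp add: w norm_mult norm_power power_mult_distrib flip: power_mult)
  then have "(norm z * norm w) ^ 2 \<le> norm (z ^ 2 + z + 1) ^ 3"
    using zw' by simp
  moreover have "s ^ 2 \<le> (norm z * norm w) ^ 2"
    unfolding s_def power2_eq_square[of "norm z"] using zw' by (intro power_mono mult_left_mono) auto
  ultimately have "s ^ 2 \<le> (1 - s) ^ 3"
    using 1 by linarith
  moreover have "(2 / 3) ^ 2 < s"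
    unfolding s_def using big by (intro power_strict_mono) auto
  then have s: "4 / 9 < s" by (simp add: power2_eq_square)
  have "s \<le> 1" unfolding s_def using zw' by (intro power_le_one) auto
  then have "(1 - s) ^ 3 \<le> (5 / 9) ^ 3"
    using s by (intro power_mono) auto
  moreover have "(4 / 9) ^ 2 \<le> s ^ 2"
    using s by (intro power_mono) auto
  ultimately show False
    by (simp add: power2_eq_square power3_eq_cube)
qed

lemma exponent_quotient:
  fixes b c N :: nat
  assumes "(2 * N + 1) * b \<le> c" "b > 0"
  obtains n where "n \<ge> N" "(2 * n + 1) * b \<le> c" "c < (2 * n + 3) * b"
proof
  define n where "n = (c div b - 1) div 2"
  have d: "2 * N + 1 \<le> c div b"
    using assms by (simp add: less_eq_div_iff_mult_less_eq)
  then show "n \<ge> N" by (simp add: n_def)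
  have "2 * n + 1 \<le> c div b" "c div b < 2 * n + 3"
    using d unfolding n_def by linarith+
  then show "(2 * n + 1) * b \<le> c" "c < (2 * n + 3) * b"
    using assms(2) by (simp_all add: less_eq_div_iff_mult_less_eq div_less_iff_less_mult)
qed

text \<open>
  The gap gives \<open>c \<ge> 2 (3 / 2)\<^sup>b \<ge> 19 b\<close>, hence \<open>n \<ge> 9\<close>, and then \<open>(n - 2) b \<ge> 13 (n - 2) > 10 n\<close>.
\<close>

lemma no_common_zero_large_exponent:
  assumes x: "power_sum_zero b x" "power_sum_zero c x" "nontrivial x" and bc: "13 \<le> b" "b < c"
  shows False
proof -
  obtain x' where x': "conjugate x x'" "norm (x' * (1 + x')) ^ 2 \<le> norm (x' ^ 2 + x' + 1) ^ 3"
    using conjugate_with_large_invariant[OF x _ bc(2)] bc(1) by auto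
  have p: "power_sum_zero b x'" "power_sum_zero c x'" "nontrivial x'"
    using x x'(1) conjugate_power_sum_zero conjugate_nontrivial by blast+
  obtain t z w where zw: "normalization x' t z w"
    using normalization_exists[OF p(3)] by blast
  have z: "norm z \<le> 2 / 3" "z \<noteq> 0"
    using normalization_small_root[OF zw x'(2)] zw by (auto simp: normalization_def)
  have c3: "2 * b \<le> c + 3"
    using second_exponent_lower_bound[OF x _ bc(2)] bc(1) by simp
  have "2 \<le> real c * norm z ^ b"
    using zw p z bc c3 by (intro archimedean_gap[of z b w c]) (auto simp: normalization_def)
  also have "\<dots> \<le> real c * (2 / 3) ^ b"
    using z by (intro mult_left_mono power_mono) auto
  finally have "2 * (3 / 2) ^ b \<le> real c"
    by (simp add: power_divide field_simps)
  moreover have "19 * real b \<le> 2 * (3 / 2) ^ b"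
    using bc(1)
  proof (induction b rule: dec_induct)
    case base
    show ?case by (simp add: power_divide)
  next
    case (step b)
    then show ?case by simp
  qed
  ultimately have "real (19 * b) \<le> real c" by simp
  then have "(2 * 9 + 1) * b \<le> c" by (simp only: of_nat_le_iff) simp
  then obtain n where n: "n \<ge> 9" "(2 * n + 1) * b \<le> c" "c < (2 * n + 3) * b"
    using exponent_quotient[of 9 b c] bc(1) by auto
  have "10 * n + 1 \<le> (n - 2) * b + 1"
  proof -
    have "10 * n \<le> (n - 2) * 13" using n(1) by simp
    also have "\<dots> \<le> (n - 2) * b" using bc(1) by (intro mult_left_mono) auto
    finally show ?thesis by simp
  qed
  then have "sqrt (4 / 27) ^ ((n - 2) * b + 1) \<le> sqrt (4 / 27 :: real) ^ (10 * n + 1)"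
    by (intro power_decreasing) auto
  also have "\<dots> = sqrt (4 / 27) ^ (2 * (5 * n) + 1)"
    by simp
  also have "\<dots> = (sqrt (4 / 27) ^ 2) ^ (5 * n) * sqrt (4 / 27)"
    by (simp only: power_add power_mult power_one_right)
  also have "(sqrt (4 / 27 :: real)) ^ 2 = 4 / 27"
    by (rule real_sqrt_pow2) simp
  finally have "(27 / 4) ^ (5 * n) * sqrt (4 / 27 :: real) ^ ((n - 2) * b + 1)
      \<le> (27 / 4) ^ (5 * n) * ((4 / 27) ^ (5 * n) * sqrt (4 / 27))"
    by (intro mult_left_mono) auto
  also have "\<dots> = ((27 / 4) * (4 / 27)) ^ (5 * n) * sqrt (4 / 27 :: real)"
    by (simp only: power_mult_distrib mult.assoc)
  also have "\<dots> < 1"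
    by simp
  finally have "(27 / 4) ^ (n * (2 * 1 + 3 * 1)) * sqrt (4 / 27) ^ ((n - 2) * b + 1) < (1 :: real)"
    by (simp add: mult.commute)
  moreover have "2 \<le> b" "2 \<le> n"
    using bc n by auto
  ultimately show False
    using second_exponent_excluded[OF x _ _ n(2,3), of 1 1 "sqrt (4 / 27)"] invariants_product_le by auto
qed

lemma real_cubic_root_modulus:
  fixes y :: complex and u J :: real
  assumes J: "J \<ge> 1" and u: "u > 0" "u ^ 3 + J * u = J" and y: "y ^ 3 + of_real J * y = of_real J"
  shows "y = of_real u \<or> norm y ^ 2 = u ^ 2 + J"
proof (rule disjCI)
  assume "norm y ^ 2 \<noteq> u ^ 2 + J"
  show "y = of_real u"
  proof (rule ccontr)
    assume ne: "y \<noteq> of_real u"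
    have "(of_real u :: complex) ^ 3 + of_real J * of_real u = of_real J"
      using arg_cong[OF u(2), of "of_real :: real \<Rightarrow> complex"] by simp
    then have "(y - of_real u) * (y ^ 2 + of_real u * y + (of_real u ^ 2 + of_real J)) = 0"
      using y by (simp add: power2_eq_square power3_eq_cube algebra_simps)
    then have eq: "y ^ 2 + of_real u * y + (of_real u ^ 2 + of_real J) = 0"
      using ne by simp
    define a d where "a = Re y" and "d = Im y"
    have re: "a ^ 2 - d ^ 2 + u * a + (u ^ 2 + J) = 0"
      using arg_cong[OF eq, of Re] by (simp add: a_def d_def Re_power2)
    have im: "d * (2 * a + u) = 0"
      using arg_cong[OF eq, of Im] by (simp add: a_def d_def Im_power2 algebra_simps)
    have "d \<noteq> 0"
    proof
      assume "d = 0"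
      then have "(a + u / 2) ^ 2 + (3 / 4 * u ^ 2 + J) = 0"
        using re by (simp add: power2_eq_square algebra_simps)
      moreover have "0 \<le> (a + u / 2) ^ 2" "0 \<le> u ^ 2" by simp_all
      ultimately show False using J by linarith
    qed
    then have "u = - 2 * a" using im by simp
    moreover have "norm y ^ 2 = a ^ 2 + d ^ 2"
      by (simp add: cmod_power2 a_def d_def)
    ultimately have "norm y ^ 2 = u ^ 2 + J"
      using re by (simp add: power2_eq_square)
    then show False using \<open>norm y ^ 2 \<noteq> u ^ 2 + J\<close> by simp
  qed
qed

text \<open>
  When \<open>e\<^sub>2\<^sup>3 / e\<^sub>3\<^sup>2\<close> is a real number \<open>J\<close>, the triple can be scaled to consist of the roots of \<open>t\<^sup>3 + J t - J\<close>. For \<open>J \<ge> 1\<close> this has one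
  real root \<open>u\<close>, in the interval from \<open>0\<close> to \<open>1\<close>, and two complex conjugate roots of larger modulus \<open>sqrt (J / u)\<close>. So
  \<open>norm z ^ 2 = u ^ 3 / J = 1 - u\<close>, and the condition on \<open>\<tau>\<close> says that the polynomial is negative at \<open>1 - \<tau>\<close>.
\<close>

lemma normalization_rational_invariant:
  fixes J \<tau> :: real
  assumes zw: "normalization x' t z w" and x': "nontrivial x'"
    and J: "J \<ge> 1" "(x' ^ 2 + x' + 1) ^ 3 + of_real J * (x' * (1 + x')) ^ 2 = 0"
    and \<tau>: "0 < \<tau>" "\<tau> < 1" "(1 - \<tau>) ^ 3 < J * \<tau>"
  shows "norm z ^ 2 \<le> \<tau>"
proof -
  have z: "1 + z + w = 0" "norm z \<le> norm w" "norm w \<le> 1" "z \<noteq> 0" "t \<noteq> 0"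
    and inv: "x' ^ 2 + x' + 1 = t ^ 2 * (z ^ 2 + z + 1)" "x' * (1 + x') = t ^ 3 * (z * (1 + z))"
    using zw by (simp_all add: normalization_def)
  define q r where "q = z ^ 2 + z + 1" and "r = z * (1 + z)"
  have "(t ^ 2 * q) ^ 3 + of_real J * (t ^ 3 * r) ^ 2 = 0"
    using J(2) unfolding inv q_def r_def .
  then have "t ^ 6 * (q ^ 3 + of_real J * r ^ 2) = 0"
    by (simp add: power_mult_distrib distrib_left mult_ac flip: power_mult)
  then have qr: "q ^ 3 = - of_real J * r ^ 2"
    using z(5) by (simp add: eq_neg_iff_add_eq_0)
  have r0: "r \<noteq> 0"
    using x' inv(2) unfolding r_def nontrivial_def by (auto simp: add_eq_0_iff2 add.commute[of 1])
  have q0: "q \<noteq> 0"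
    using x' inv(1) unfolding q_def nontrivial_def by auto
  \<comment> \<open>The scaling factor \<open>e\<^sub>2 / e\<^sub>3\<close> makes both symmetric functions equal to \<open>J\<close>.\<close>
  define s where "s = q / r"
  have s0: "s \<noteq> 0" using q0 r0 by (simp add: s_def)
  have s2: "s ^ 2 * q = - of_real J" and s3: "s ^ 3 * r = - of_real J"
    using qr r0 by (simp_all add: s_def field_simps power2_eq_square power3_eq_cube)
  have w: "w = - 1 - z" using z(1) by algebra
  have roots: "y ^ 3 + of_real J * y = of_real J" if "y \<in> {s, s * z, s * w}" for y
  proof -
    have "\<exists>e\<in>{1, z, w}. y = s * e" using that by auto
    then obtain e where e: "y = s * e" "e \<in> {1, z, w}" by blast
    have "e ^ 3 - q * e + r = 0"
      using e(2) unfolding w q_def r_def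
      by (elim insertE emptyE; hypsubst; simp add: power2_eq_square power3_eq_cube algebra_simps)
    then have "s ^ 3 * e ^ 3 - (s ^ 2 * q) * (s * e) + s ^ 3 * r = 0"
      by (metis (no_types, lifting) mult_zero_right right_diff_distrib distrib_left power2_eq_square power3_eq_cube mult.assoc mult.left_commute)
    then show ?thesis
      unfolding s2 s3 e(1) by (simp add: power_mult_distrib algebra_simps)
  qed
  obtain u where u: "1 - \<tau> \<le> u" "u \<le> 1" "u ^ 3 + J * u = J"
  proof -
    have "\<exists>u\<ge>1 - \<tau>. u \<le> 1 \<and> u ^ 3 + J * u = J"
    proof (rule IVT')
      show "(1 - \<tau>) ^ 3 + J * (1 - \<tau>) \<le> J" using \<tau> by (simp add: algebra_simps)
      show "J \<le> 1 ^ 3 + J * 1" by simp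
      show "1 - \<tau> \<le> 1" using \<tau> by simp
      show "continuous_on {1 - \<tau>..1} (\<lambda>u. u ^ 3 + J * u)" by (intro continuous_intros)
    qed
    then show ?thesis using that by blast
  qed
  have u0: "u > 0" using u \<tau> by simp
  define K where "K = u ^ 2 + J"
  have uK: "u * K = J" using u(3) by (simp add: K_def power2_eq_square power3_eq_cube algebra_simps)
  have KJ: "K > J" using u0 by (simp add: K_def)
  have u2K: "u ^ 2 < K" using J by (simp add: K_def)
  have alt: "norm y = u \<or> norm y ^ 2 = K" if "y \<in> {s, s * z, s * w}" for y
    using real_cubic_root_modulus[OF J(1) u0 u(3) roots[OF that]] u0 by (auto simp: K_def)
  have prod: "norm s * norm (s * z) * norm (s * w) = J"
  proof -
    have "s * (s * z) * (s * w) = - (s ^ 3 * r)"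
      unfolding r_def w by (simp add: power3_eq_cube algebra_simps)
    then have "s * (s * z) * (s * w) = of_real J"
      by (simp add: s3)
    then have "norm (s * (s * z) * (s * w)) = \<bar>J\<bar>" by (metis norm_of_real)
    then show ?thesis using J(1) by (simp add: norm_mult)
  qed
  have ord: "norm (s * z) \<le> norm (s * w)" "norm (s * w) \<le> norm s"
    using z s0 by (simp_all add: norm_mult mult_left_mono)
  have sK: "norm s ^ 2 = K"
  proof (rule ccontr)
    assume "norm s ^ 2 \<noteq> K"
    then have su: "norm s = u" using alt by blast
    have "norm s * norm (s * z) * norm (s * w) \<le> u * u * u"
      using ord su by (intro mult_mono) auto
    also have "\<dots> < u * K"
      using u0 u2K by (simp add: power2_eq_square mult.assoc)
    finally show False using prod uK by simp
  qed
  have szu: "norm (s * z) = u"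
  proof (rule ccontr)
    assume "norm (s * z) \<noteq> u"
    then have "norm (s * z) ^ 2 = K" using alt by blast
    moreover have "norm (s * z) ^ 2 \<le> norm (s * w) ^ 2"
      using ord by (intro power_mono) auto
    ultimately have "norm (s * w) \<noteq> u"
      using u2K by (metis not_le)
    then have "norm (s * w) ^ 2 = K"
      using alt by blast
    have "J ^ 2 = norm s ^ 2 * norm (s * z) ^ 2 * norm (s * w) ^ 2"
      using prod by (metis power_mult_distrib)
    also have "\<dots> = K * K * K"
      using \<open>norm (s * z) ^ 2 = K\<close> \<open>norm (s * w) ^ 2 = K\<close> sK by simp
    also have "K * K * K > J * J * 1"
      using KJ J by (intro mult_strict_mono) auto
    finally show False by (simp add: power2_eq_square)
  qed
  have "norm z ^ 2 * K = u ^ 2"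
    using szu sK by (simp add: norm_mult power_mult_distrib[symmetric] mult.commute flip: sK)
  then have "norm z ^ 2 * K \<le> \<tau> * K"
  proof -
    have "u ^ 2 = (1 - u) * K"
      using uK by (simp add: K_def algebra_simps)
    also have "\<dots> \<le> \<tau> * K"
      using u KJ J by (intro mult_right_mono) auto
    finally show ?thesis using \<open>norm z ^ 2 * K = u ^ 2\<close> by simp
  qed
  then show ?thesis
    using KJ J by simp
qed

text \<open>
  All conjugates of \<open>x\<close> have the same invariant \<open>J\<close> and therefore satisfy the sharp bound \<open>norm z ^ 2 \<le> \<tau>\<close>. The
  approximation argument now uses \<open>e\<^sub>3\<close> alone, which for the normalized triple has modulus at most \<open>sqrt \<tau>\<close>.
\<close>

lemma no_common_zero_rational_invariant:
  fixes J \<tau> :: real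
  assumes x: "power_sum_zero b x" "power_sum_zero c x" "nontrivial x" and bc: "8 \<le> b" "b < c"
    and J: "J \<ge> 1" "J \<in> \<int>" "(x ^ 2 + x + 1) ^ 3 + of_real J * (x * (1 + x)) ^ 2 = 0"
    and \<tau>: "0 < \<tau>" "\<tau> \<le> 4 / 9" "(1 - \<tau>) ^ 3 < J * \<tau>"
    and N: "2 \<le> N" "real ((2 * N + 1) * b) ^ 2 * \<tau> ^ b \<le> 4"
    and size: "\<And>n. n \<ge> N \<Longrightarrow> (27 / 4) ^ (6 * n) * \<tau> ^ ((n - 2) * b + 1) < 1"
  shows False
proof -
  obtain j where j: "J = of_int j" using J(2) by (auto elim: Ints_cases)
  have small: "norm z ^ 2 \<le> \<tau>" if x': "conjugate x x'" and zw: "normalization x' t z w" for x' t z w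
  proof (rule normalization_rational_invariant[OF zw _ J(1) _ \<tau>(1) _ \<tau>(3)])
    show "nontrivial x'" using x(3) x' conjugate_nontrivial by blast
    have "rat_poly_fun (\<lambda>x. (x ^ 2 + x + 1) ^ 3 + of_int j * (x * (1 + x)) ^ 2)"
      by (intro rat_poly_intros)
    then show "(x' ^ 2 + x' + 1) ^ 3 + of_real J * (x' * (1 + x')) ^ 2 = 0"
      using conjugateD[OF x', of "\<lambda>x. (x ^ 2 + x + 1) ^ 3 + of_int j * (x * (1 + x)) ^ 2"] J(3) by (simp add: j)
    show "\<tau> < 1" using \<tau> by simp
  qed
  obtain t z w where zw: "normalization x t z w"
    using normalization_exists[OF x(3)] by blast
  have z2: "norm z ^ 2 \<le> \<tau>" using small[OF conjugate_refl zw] .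
  have "norm z ^ 2 \<le> (2 / 3) ^ 2"
    using z2 \<tau> by (simp add: power2_eq_square)
  then have z: "norm z \<le> 2 / 3" by (rule power2_le_imp_le) simp
  have c3: "2 * b \<le> c + 3"
    using second_exponent_lower_bound[OF x _ bc(2)] bc(1) by simp
  have "2 \<le> real c * norm z ^ b"
    using zw x z bc c3 by (intro archimedean_gap[of z b w c]) (auto simp: normalization_def)
  then have "2 ^ 2 \<le> (real c * norm z ^ b) ^ 2"
    by (intro power_mono) auto
  also have "\<dots> = real c ^ 2 * (norm z ^ 2) ^ b"
    by (simp add: power_mult_distrib mult.commute flip: power_mult)
  also have "\<dots> \<le> real c ^ 2 * \<tau> ^ b"
    using z2 by (intro mult_left_mono power_mono) auto
  finally have c4: "4 \<le> real c ^ 2 * \<tau> ^ b" by simp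
  have "(2 * N + 1) * b \<le> c"
  proof (rule ccontr)
    assume "\<not> (2 * N + 1) * b \<le> c"
    then have "real c < real ((2 * N + 1) * b)"
      by (simp only: of_nat_less_iff not_le)
    then have "real c ^ 2 * \<tau> ^ b < real ((2 * N + 1) * b) ^ 2 * \<tau> ^ b"
      using \<tau>(1) by (intro mult_strict_right_mono power_strict_mono zero_less_power) simp_all
    then show False using c4 N(2) by linarith
  qed
  then obtain n where n: "n \<ge> N" "(2 * n + 1) * b \<le> c" "c < (2 * n + 3) * b"
    using exponent_quotient[of N b c] bc(1) by auto
  have bound: "norm (x' ^ 2 + x' + 1) ^ 0 * norm (x' * (1 + x')) ^ 1
      \<le> sqrt \<tau> * Max {1, norm x', norm (1 + x')} ^ (2 * 0 + 3 * 1)" if x': "conjugate x x'" for x'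
  proof -
    have "nontrivial x'" using x(3) x' conjugate_nontrivial by blast
    then obtain t z w where zw: "normalization x' t z w"
      using normalization_exists by blast
    have zs: "norm z \<le> sqrt \<tau>"
      using small[OF x' zw] real_le_rsqrt by blast
    have "1 + z = - w" using zw by (simp add: normalization_def eq_neg_iff_add_eq_0)
    then have "norm (1 + z) \<le> 1"
      using zw by (simp add: normalization_def)
    then have "norm z * norm (1 + z) \<le> sqrt \<tau> * 1"
      using zs \<tau> by (intro mult_mono) auto
    then have "norm t ^ 3 * (norm z * norm (1 + z)) \<le> norm t ^ 3 * sqrt \<tau>"
      by (intro mult_left_mono) auto
    moreover have "norm (x' * (1 + x')) = norm t ^ 3 * (norm z * norm (1 + z))"
      using zw by (simp add: normalization_def norm_mult norm_power)
    moreover have "norm t = Max {1, norm x', norm (1 + x')}"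
      using zw by (simp add: normalization_def)
    ultimately show ?thesis by (simp add: mult.commute)
  qed
  have "((27 / 4) ^ (n * (2 * 0 + 3 * 1)) * sqrt \<tau> ^ ((n - 2) * b + 1)) ^ 2 < (1 :: real) ^ 2"
  proof -
    have "((27 / 4) ^ (n * (2 * 0 + 3 * 1)) * sqrt \<tau> ^ ((n - 2) * b + 1)) ^ 2
        = (27 / 4) ^ (6 * n) * (sqrt \<tau> ^ 2) ^ ((n - 2) * b + 1)"
      by (simp add: power_mult_distrib mult.commute flip: power_mult)
    also have "sqrt \<tau> ^ 2 = \<tau>" using \<tau> by simp
    finally show ?thesis using size[OF n(1)] by simp
  qed
  then have "(27 / 4) ^ (n * (2 * 0 + 3 * 1)) * sqrt \<tau> ^ ((n - 2) * b + 1) < (1 :: real)"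
    by (rule power_less_imp_less_base) simp
  moreover have "0 \<le> sqrt \<tau>" "sqrt \<tau> \<le> 1" "2 \<le> b" "2 \<le> n"
    using \<tau> bc n N by auto
  ultimately show False
    using second_exponent_excluded[OF x _ _ n(2,3) bound] by blast
qed

lemma power_sum_recurrence:
  fixes x :: complex
  defines "q \<equiv> x ^ 2 + x + 1" and "r \<equiv> x * (1 + x)"
  defines "P \<equiv> \<lambda>n. 1 + x ^ n + (- 1 - x) ^ n"
  shows "P (Suc (Suc (Suc n))) = q * P (Suc n) - r * P n"
  unfolding P_def q_def r_def by (simp add: power2_eq_square algebra_simps)

lemma small_power_sums:
  fixes x :: complex
  defines "q \<equiv> x ^ 2 + x + 1" and "r \<equiv> x * (1 + x)"
  defines "P \<equiv> \<lambda>n. 1 + x ^ n + (- 1 - x) ^ n"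
  shows "P 2 = 2 * q" "P 3 = - 3 * r" "P 4 = 2 * q ^ 2" "P 5 = - 5 * (q * r)" "P 6 = 2 * q ^ 3 + 3 * r ^ 2"
    "P 7 = - 7 * (q ^ 2 * r)" "P 8 = 2 * q * (q ^ 3 + 4 * r ^ 2)" "P 9 = - 3 * r * (3 * q ^ 3 + r ^ 2)"
    "P 10 = q ^ 2 * (2 * q ^ 3 + 15 * r ^ 2)" "P 11 = - 11 * (q * r) * (q ^ 3 + r ^ 2)"
    "P 12 = 2 * q ^ 6 + 24 * q ^ 3 * r ^ 2 + 3 * r ^ 4"
proof -
  have rec: "P (n + 3) = q * P (n + 1) - r * P n" for n
    using power_sum_recurrence[of x n] unfolding P_def q_def r_def by (simp add: eval_nat_numeral)
  have P0: "P 0 = 3" "P 1 = 0" "P 2 = 2 * q"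
    by (simp_all add: P_def q_def power2_eq_square algebra_simps)
  have rec': "P 3 = q * P 1 - r * P 0"
    "P 4 = q * P 2 - r * P 1"
    "P 5 = q * P 3 - r * P 2"
    "P 6 = q * P 4 - r * P 3"
    "P 7 = q * P 5 - r * P 4"
    "P 8 = q * P 6 - r * P 5"
    "P 9 = q * P 7 - r * P 6"
    "P 10 = q * P 8 - r * P 7"
    "P 11 = q * P 9 - r * P 8"
    "P 12 = q * P 10 - r * P 9"
    using rec[of 0] rec[of 1] rec[of 2] rec[of 3] rec[of 4] rec[of 5] rec[of 6] rec[of 7] rec[of 8] rec[of 9] by (simp_all add: numeral_eq_Suc)
  show 2: "P 2 = 2 * q" by fact
  show 3: "P 3 = - 3 * r"
    unfolding rec'(1) P0 by (simp add: eval_nat_numeral algebra_simps)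
  show 4: "P 4 = 2 * q ^ 2"
    unfolding rec'(2) P0 by (simp add: eval_nat_numeral algebra_simps)
  show 5: "P 5 = - 5 * (q * r)"
    unfolding rec'(3) 2 3 by (simp add: eval_nat_numeral algebra_simps)
  show 6: "P 6 = 2 * q ^ 3 + 3 * r ^ 2"
    unfolding rec'(4) 4 3 by (simp add: eval_nat_numeral algebra_simps)
  show 7: "P 7 = - 7 * (q ^ 2 * r)"
    unfolding rec'(5) 5 4 by (simp add: eval_nat_numeral algebra_simps)
  show 8: "P 8 = 2 * q * (q ^ 3 + 4 * r ^ 2)"
    unfolding rec'(6) 6 5 by (simp add: eval_nat_numeral algebra_simps)
  show 9: "P 9 = - 3 * r * (3 * q ^ 3 + r ^ 2)"
    unfolding rec'(7) 7 6 by (simp add: eval_nat_numeral algebra_simps)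
  show 10: "P 10 = q ^ 2 * (2 * q ^ 3 + 15 * r ^ 2)"
    unfolding rec'(8) 8 7 by (simp add: eval_nat_numeral algebra_simps)
  show 11: "P 11 = - 11 * (q * r) * (q ^ 3 + r ^ 2)"
    unfolding rec'(9) 9 8 by (simp add: eval_nat_numeral algebra_simps)
  show 12: "P 12 = 2 * q ^ 6 + 24 * q ^ 3 * r ^ 2 + 3 * r ^ 4"
    unfolding rec'(10) 10 9 by (simp add: eval_nat_numeral algebra_simps)
qed

lemma half_integer_root: "(2 * y + of_int k) * s = 0 \<Longrightarrow> s \<noteq> 0 \<Longrightarrow> y = of_int (- k) / (2 :: complex)"
proof -
  assume "(2 * y + of_int k) * s = 0" "s \<noteq> 0"
  then have "2 * y = - of_int k"
    by (simp add: eq_neg_iff_add_eq_0)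
  then show ?thesis by (simp add: field_simps)
qed

lemma (in valuation_ring) half_not_mem: "p = 2 \<Longrightarrow> of_int k / 2 \<in> B \<Longrightarrow> even k"
proof (rule ccontr)
  assume p: "p = 2" and k: "of_int k / 2 \<in> B" "odd k"
  then obtain l where "k = 2 * l + 1" by (auto elim: oddE)
  then have "of_int k / 2 - of_int l = (1 / 2 :: complex)"
    by (simp add: add_divide_distrib)
  moreover have "of_int k / 2 - of_int l \<in> B" using k by blast
  ultimately have "(1 / 2 :: complex) \<in> B" by (simp only:)
  then show False using p_nonunit p by (simp add: inverse_eq_divide)
qed

text \<open>
  For \<open>b \<le> 12\<close> the power sum is a polynomial in \<open>q\<close> and \<open>r\<close>, which determines \<open>I = q\<^sup>3 / r\<^sup>2\<close>. The values \<open>- 3 / 2\<close>, \<open>- 1 / 3\<close>,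
  \<open>- 15 / 2\<close> for \<open>b = 6, 9, 10\<close> and the quadratic equation for \<open>b = 12\<close> contradict integrality. For \<open>b = 8\<close> and \<open>b = 11\<close> the
  bounds \<open>\<tau>\<close> are chosen just above the true values of \<open>norm z ^ 2\<close>, which are about \<open>0.153\<close> and \<open>0.318\<close>, and
  \<open>n = 9\<close> and \<open>n = 23\<close> are the first values for which the estimate of \<open>\<eta>\<close> is less than \<open>1\<close>.
\<close>

theorem no_nontrivial_common_zero:
  assumes x: "power_sum_zero b x" "power_sum_zero c x" and bc: "1 < b" "b < c"
  shows "\<not> nontrivial x"
proof
  assume nt: "nontrivial x"
  define q r where "q = x ^ 2 + x + 1" and "r = x * (1 + x)"
  have q0: "q \<noteq> 0" and r0: "r \<noteq> 0"
    using nt by (auto simp: nontrivial_def q_def r_def add_eq_0_iff2 add.commute[of 1])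
  have P: "1 + x ^ b + (- 1 - x) ^ b = 0"
    using x by (simp add: power_sum_zero_def)
  note ps = small_power_sums[of x, folded q_def r_def]
  have b2: "2 \<le> b" using bc by simp
  define I where "I = q ^ 3 / r ^ 2"
  have I: "I \<in> B" if "valuation_ring B p" for B p
    using valuation_ring.invariant_integral[OF that x nt b2 bc(2)] by (simp add: I_def q_def r_def)
  have qI: "q ^ 3 = I * r ^ 2" using r0 by (simp add: I_def)
  consider "b = 2 \<or> b = 3 \<or> b = 4 \<or> b = 5 \<or> b = 7" | "b = 6" | "b = 8" | "b = 9" | "b = 10" | "b = 11" | "b = 12" | "b \<ge> 13"
  proof -
    have "b = 2 \<or> b = 3 \<or> b = 4 \<or> b = 5 \<or> b = 6 \<or> b = 7 \<or> b = 8 \<or> b = 9 \<or> b = 10 \<or> b = 11 \<or> b = 12 \<or> b \<ge> 13"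
      using bc(1) by arith
    then show thesis using that by blast
  qed
  then show False
  proof cases
    case 1
    then show False
      using P ps q0 r0 by auto
  next
    case 2
    obtain B where B: "valuation_ring B 2" using exists_valuation_ring two_is_prime_nat by blast
    interpret valuation_ring B 2 by fact
    have "(2 * I + 3) * r ^ 2 = 0"
      using P ps(5) unfolding 2 qI by (simp add: algebra_simps)
    then have "I = of_int (- 3) / 2" using half_integer_root[of I 3 "r ^ 2"] r0 by simp
    then show False using I[OF B] half_not_mem[of "- 3"] by simp
  next
    case 3
    have "q ^ 3 + of_real 4 * r ^ 2 = 0"
      using P ps(7) q0 unfolding 3 by simp
    moreover have "(27 / 4) ^ (6 * n) * (4 / 25) ^ ((n - 2) * 8 + 1) < (1 :: real)" if "n \<ge> 9" for n
      using that
    proof (induction n rule: dec_induct)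
      case base
      show ?case by (simp add: power_divide)
    next
      case (step n)
      have "6 * Suc n = 6 * n + 6" "(Suc n - 2) * 8 + 1 = (n - 2) * 8 + 1 + 8" using step by auto
      then have "(27 / 4) ^ (6 * Suc n) * (4 / 25) ^ ((Suc n - 2) * 8 + 1)
        = ((27 / 4) ^ (6 * n) * (4 / 25) ^ ((n - 2) * 8 + 1)) * ((27 / 4) ^ 6 * (4 / 25 :: real) ^ 8)"
        by (simp only: power_add mult_ac)
      also have "\<dots> < 1 * 1"
        using step by (intro mult_strict_mono) (auto simp: power_divide)
      finally show ?case by simp
    qed
    ultimately show False
      using bc(2) 3
      by (intro no_common_zero_rational_invariant[OF x nt, of 4 "4 / 25" 9])
        (auto simp: q_def r_def power_divide power3_eq_cube)
  next
    case 4
    obtain B where B: "valuation_ring B 3" using exists_valuation_ring[of 3] by auto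
    interpret valuation_ring B 3 by fact
    have "3 * q ^ 3 + r ^ 2 = 0"
      using P ps(8) r0 unfolding 4 by simp
    then have "(3 * I + 1) * r ^ 2 = 0"
      unfolding qI by (simp add: algebra_simps)
    then have "3 * I + 1 = 0" using r0 by simp
    then have "3 * I = - 1" by (simp only: eq_neg_iff_add_eq_0)
    then have "- I = inverse (of_nat 3)" by (simp add: field_simps)
    then show False using I[OF B] p_nonunit uminus_mem by metis
  next
    case 5
    obtain B where B: "valuation_ring B 2" using exists_valuation_ring two_is_prime_nat by blast
    interpret valuation_ring B 2 by fact
    have "2 * q ^ 3 + 15 * r ^ 2 = 0"
      using P ps(9) q0 unfolding 5 by simp
    then have "(2 * I + 15) * r ^ 2 = 0"
      unfolding qI by (simp add: algebra_simps)
    then have "I = of_int (- 15) / 2" using half_integer_root[of I 15 "r ^ 2"] r0 by simp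
    then show False using I[OF B] half_not_mem[of "- 15"] by simp
  next
    case 6
    have "q ^ 3 + of_real 1 * r ^ 2 = 0"
      using P ps(10) q0 r0 unfolding 6 by simp
    moreover have "(27 / 4) ^ (6 * n) * (8 / 25) ^ ((n - 2) * 11 + 1) < (1 :: real)" if "n \<ge> 23" for n
      using that
    proof (induction n rule: dec_induct)
      case base
      show ?case by (simp add: power_divide)
    next
      case (step n)
      have "6 * Suc n = 6 * n + 6" "(Suc n - 2) * 11 + 1 = (n - 2) * 11 + 1 + 11" using step by auto
      then have "(27 / 4) ^ (6 * Suc n) * (8 / 25) ^ ((Suc n - 2) * 11 + 1)
        = ((27 / 4) ^ (6 * n) * (8 / 25) ^ ((n - 2) * 11 + 1)) * ((27 / 4) ^ 6 * (8 / 25 :: real) ^ 11)"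
        by (simp only: power_add mult_ac)
      also have "\<dots> < 1 * 1"
        using step by (intro mult_strict_mono) (auto simp: power_divide)
      finally show ?case by simp
    qed
    ultimately show False
      using bc(2) 6
      by (intro no_common_zero_rational_invariant[OF x nt, of 1 "8 / 25" 23])
        (auto simp: q_def r_def power_divide power3_eq_cube)
  next
    case 7
    obtain B where B: "valuation_ring B 2" using exists_valuation_ring two_is_prime_nat by blast
    interpret valuation_ring B 2 by fact
    have "q ^ 6 = (q ^ 3) ^ 2" by (simp flip: power_mult)
    then have "2 * (I * r ^ 2) ^ 2 + 24 * (I * r ^ 2) * r ^ 2 + 3 * r ^ 4 = 0"
      using P ps(11) unfolding 7 qI by simp
    then have "(2 * (I ^ 2 + 12 * I) + 3) * r ^ 4 = 0"
      by (simp add: eval_nat_numeral algebra_simps)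
    then have "I ^ 2 + 12 * I = of_int (- 3) / 2" using half_integer_root[of "I ^ 2 + 12 * I" 3 "r ^ 4"] r0 by simp
    moreover have "I ^ 2 + 12 * I \<in> B" using I[OF B] by blast
    ultimately show False using half_not_mem[of "- 3"] by simp
  next
    case 8
    then show False using no_common_zero_large_exponent[OF x nt _ bc(2)] by simp
  qed
qed

section \<open>The trivial zeros and the conclusion\<close>

lemma omega_equation: "\<omega> ^ 2 + \<omega> + 1 = 0" and omega_cube: "\<omega> ^ 3 = 1"
proof -
  have "\<omega> ^ 3 = exp (of_nat 3 * (2 * complex_of_real pi * \<i> / 3))"
    by (simp only: \<omega>_def exp_of_nat_mult)
  also have "of_nat 3 * (2 * complex_of_real pi * \<i> / 3) = 2 * complex_of_real pi * \<i>"
    by simp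
  finally show cube: "\<omega> ^ 3 = 1"
    by (simp only: exp_two_pi_i)
  have "\<omega> \<noteq> 1"
  proof
    assume "\<omega> = 1"
    then obtain n :: int where "2 * pi / 3 = of_int (2 * n) * pi"
      by (auto simp: \<omega>_def exp_eq_1)
    then have "of_int (3 * n) = (of_int 1 :: real)" by simp
    then have "3 * n = 1" by (simp only: of_int_eq_iff)
    then show False by presburger
  qed
  moreover have "(\<omega> - 1) * (\<omega> ^ 2 + \<omega> + 1) = 0"
    using cube by (simp add: power2_eq_square power3_eq_cube algebra_simps)
  ultimately show "\<omega> ^ 2 + \<omega> + 1 = 0" by simp
qed

lemma omega_complements: "- 1 - \<omega> = \<omega> ^ 2" "- 1 - \<omega> ^ 2 = \<omega>"
  using omega_equation by algebra+

lemma trivial_cases: "\<not> nontrivial x \<Longrightarrow> x \<in> {0, - 1, \<omega>, \<omega>\<^sup>2}"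
proof -
  assume "\<not> nontrivial x"
  moreover have "x \<in> {\<omega>, \<omega>\<^sup>2}" if "x ^ 2 + x + 1 = 0"
  proof -
    have "(x - \<omega>) * (x - \<omega> ^ 2) = x ^ 2 - (\<omega> ^ 2 + \<omega> + 1) * x + x + \<omega> ^ 3"
      by (simp add: power2_eq_square power3_eq_cube algebra_simps)
    also have "\<dots> = 0"
      using that by (simp add: omega_equation omega_cube)
    finally show ?thesis by simp
  qed
  ultimately show ?thesis
    by (auto simp: nontrivial_def)
qed

lemma power_sum_zero_0: "n > 0 \<Longrightarrow> power_sum_zero n 0 \<longleftrightarrow> odd n"
  by (cases "even n") (simp_all add: power_sum_zero_def power_0_left)

lemma power_sum_zero_minus_1: "n > 0 \<Longrightarrow> power_sum_zero n (- 1) \<longleftrightarrow> odd n"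
  by (cases "even n") (simp_all add: power_sum_zero_def power_0_left)

lemma power_sum_zero_omega: "power_sum_zero n \<omega> \<longleftrightarrow> \<not> 3 dvd n"
proof -
  have pw: "\<omega> ^ (3 * k + r) = \<omega> ^ r" for k r
    by (simp add: power_add power_mult omega_cube)
  have red: "power_sum_zero (3 * k + r) \<omega> \<longleftrightarrow> 1 + \<omega> ^ r + \<omega> ^ (2 * r) = 0" for k r
  proof -
    have "(\<omega> ^ 2) ^ (3 * k + r) = \<omega> ^ (3 * (2 * k) + 2 * r)"
      by (simp add: algebra_simps flip: power_mult)
    then show ?thesis
      unfolding power_sum_zero_def omega_complements(1) by (simp only: pw)
  qed
  have four: "\<omega> ^ 4 = \<omega>"
    using pw[of 1 1] by simp
  define k where "k = n div 3"
  consider "n = 3 * k + 0" | "n = 3 * k + 1" | "n = 3 * k + 2"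
    unfolding k_def by linarith
  then show ?thesis
  proof cases
    case 1
    then show ?thesis using red[of k 0] by simp
  next
    case 2
    moreover have "\<not> 3 dvd 3 * k + 1" by presburger
    ultimately show ?thesis using red[of k 1] omega_equation by (simp add: add_ac power2_eq_square)
  next
    case 3
    moreover have "\<not> 3 dvd 3 * k + 2" by presburger
    ultimately show ?thesis using red[of k 2] omega_equation four by (simp add: add_ac)
  qed
qed

lemma power_sum_zero_omega_squared: "power_sum_zero n (\<omega>\<^sup>2) \<longleftrightarrow> \<not> 3 dvd n"
proof -
  have "power_sum_zero n (\<omega>\<^sup>2) \<longleftrightarrow> power_sum_zero n \<omega>"
    using power_sum_zero_swap[of n \<omega>] power_sum_zero_swap[of n "\<omega> ^ 2"] unfolding omega_complements by blast
  then show ?thesis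
    by (simp add: power_sum_zero_omega)
qed

lemma mem_common_zeros_trinom:
  "x \<in> common_zeros (trinom b) (trinom c) \<longleftrightarrow> power_sum_zero b x \<and> power_sum_zero c x"
  by (simp add: common_zeros_def trinom_def power_sum_zero_def)

theorem theorem4p1:
  fixes b c :: nat
  assumes "1 < b" and "b < c"
  shows "common_zeros (trinom b) (trinom c) \<subseteq> {0, - 1, \<omega>, \<omega>\<^sup>2}
    \<and> (0 \<in> common_zeros (trinom b) (trinom c) \<longleftrightarrow> \<not> 2 dvd b * c)
    \<and> (- 1 \<in> common_zeros (trinom b) (trinom c) \<longleftrightarrow> \<not> 2 dvd b * c)
    \<and> (\<omega> \<in> common_zeros (trinom b) (trinom c) \<longleftrightarrow> \<not> 3 dvd b * c)
    \<and> (\<omega>\<^sup>2 \<in> common_zeros (trinom b) (trinom c) \<longleftrightarrow> \<not> 3 dvd b * c)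
    \<and> (6 dvd b * c \<longrightarrow> common_zeros (trinom b) (trinom c) = {})"
proof -
  let ?Z = "common_zeros (trinom b) (trinom c)"
  have sub: "?Z \<subseteq> {0, - 1, \<omega>, \<omega>\<^sup>2}"
    using no_nontrivial_common_zero[OF _ _ assms] trivial_cases unfolding mem_common_zeros_trinom subset_iff by blast
  have three: "3 dvd b * c \<longleftrightarrow> 3 dvd b \<or> 3 dvd c"
    by (rule prime_dvd_mult_iff) simp
  have mem: "0 \<in> ?Z \<longleftrightarrow> \<not> 2 dvd b * c" "- 1 \<in> ?Z \<longleftrightarrow> \<not> 2 dvd b * c"
    "\<omega> \<in> ?Z \<longleftrightarrow> \<not> 3 dvd b * c" "\<omega>\<^sup>2 \<in> ?Z \<longleftrightarrow> \<not> 3 dvd b * c"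
    using assms three
    by (auto simp: mem_common_zeros_trinom power_sum_zero_0 power_sum_zero_minus_1 power_sum_zero_omega
        power_sum_zero_omega_squared)
  moreover have "?Z = {}" if "6 dvd b * c"
  proof -
    have "2 dvd b * c" "3 dvd b * c"
      using that by presburger+
    then show ?thesis
      using sub mem by blast
  qed
  ultimately show ?thesis
    using sub by blast
qed

end
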